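(* Let $f\in C^\infty(\mathbb{R},\mathbb{R})$ and $\alpha\in(0,1]$. For a damping coefficient $a$ satisfying condition (A) of the context, consider $$\partial_t u+\partial_x(f(u))+a(x)\frac{u}{|u|^\alpha}=0\quad\text{in }\mathbb{R}_+\times\mathbb{T}.\qquad(E_a)$$ 1. Let $a$ satisfy condition (A), and let $u$ and $v$ be the solutions of $(E_a)$ with respective initial data $u_0,v_0\in L^\infty(\mathbb{T})$ such that $u_0\le v_0$ a.e. Then $u(t,x)\le v(t,x)$ for all $t\ge0$ and a.e. $x\in\mathbb{T}$. Besides, $|u(t,x)|\le\|u_0\|_{L^\infty(\mathbb{T})}$ for all $t\ge0$ and a.e. $x\in\mathbb{T}$. 2. Let $a_1$ and $a_2$ satisfy condition (A) with $a_1(x)\le a_2(x)$ for almost all $x\in\mathbb{T}$. Let $u_1$ and $u_2$ be the respective solutions of $(E_{a_1})$ and $(E_{a_2})$ with the same initial datum $u_0\in L^\infty(\mathbb{T})$, $u_0\ge0$. Then $u_1(t,x)\ge u_2(t,x)\ge0$ for all $t\ge0$ and a.e. $x\in\mathbb{T}$.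
   Context: $\mathbb{T}=\mathbb{R}/\mathbb{Z}$, $\mathbb{R}_+=[0,\infty)$. Condition (A) on $a:\mathbb{T}\to\mathbb{R}$: $a(x)\ge 0$ for all $x\in\mathbb{T}$, $a\in L^\infty(\mathbb{T})$, and $\sup_{y>0}\frac1y\int_{\mathbb{T}}|a(x+y)-a(x)|\,dx<\infty$. $\mathrm{Sign}(u)=\{1\}$ if $u>0$, $\{-1\}$ if $u<0$, $[-1,1]$ if $u=0$. For $\alpha<1$, $u/|u|^\alpha$ is understood as $0$ at $u=0$. Admissible weak solution on $[0,T]\times\mathbb{T}$ with initial datum $u_0\in L^\infty(\mathbb{T})$: (Case $0<\alpha<1$.) A bounded measurable function $u$ on $[0,T]\times\mathbb{T}$ such that, with $h(t,x)=a(x)\frac{u(t,x)}{|u(t,x)|^\alpha}$, $$\int_0^T\!\!\int_{\mathbb{T}}\big(\partial_t\psi\,\eta(u)+\partial_x\psi\,q(u)-\psi\,\eta'(u)\,h\big)\,dx\,dt+\int_{\mathbb{T}}\psi(0,x)\eta(u_0(x))\,dx\ge 0\qquad( * )$$ for every convex (hence locally Lipschitz) function $\eta:\mathbb{R}\to\mathbb{R}$, with $q$ such that $q'=f'\eta'$, and every nonnegative Lipschitz continuous $\psi$ on $[0,T]\times\mathbb{T}$ with $\psi(T,\cdot)=0$. At points where $\eta$ is not differentiable, $\eta'$ denotes the average of the left and right derivatives. (Case $\alpha=1$.) A bounded measurable function $u$ on $[0,T]\times\mathbb{T}$ for which there exists $h\in L^\infty((0,T)\times\mathbb{T})$ with $\partial_t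 u+\partial_x(f(u))+h=0$ in $\mathscr{D}'((0,T)\times\mathbb{T})$, $h(t,x)\in a(x)\,\mathrm{Sign}(u(t,x))$ for a.e. $(t,x)\in(0,T)\times\mathbb{T}$, and such that $( * )$ holds with this $h$ for every convex (hence locally Lipschitz) function $\eta:\mathbb{R}\to\mathbb{R}$, with $q$ such that $q'=f'\eta'$, and every nonnegative Lipschitz continuous $\psi$ on $[0,T]\times\mathbb{T}$ with $\psi(T,\cdot)=0$ (with $\eta'$ again denoting the average of the left and right derivatives at points where $\eta$ is not differentiable). "Solution" with a given initial datum means the global admissible weak solution (admissible weak solution on $[0,T]\times\mathbb{T}$ for every $T>0$), which exists, is unique, and is taken in its $C^0(\mathbb{R}_+;L^1(\mathbb{T}))$ representative, so that $u(t)$ makes sense for every $t\ge 0$. *)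

theory Defs
  imports "HOL-Analysis.Analysis" "HOL-Probability.Essential_Supremum"
begin

text \<open>
  Functions on the torus \<open>\<real>/\<int>\<close> are represented by 1-periodic functions on \<open>\<real>\<close>, and integrals and
  almost-everywhere statements are taken on the fundamental domain \<open>[0,1)\<close>.
\<close>

definition periodic :: "(real \<Rightarrow> 'a) \<Rightarrow> bool" where
  "periodic g \<longleftrightarrow> (\<forall>x. g (x + 1) = g x)"

definition torus :: "real measure" where
  "torus = lebesgue_on {0..<1}"

text \<open>The measure space \<open>[0,T] \<times> \<real>/\<int>\<close>; the end points \<open>t = 0\<close> and \<open>t = T\<close> are negligible.\<close>

definition cylinder :: "real \<Rightarrow> (real \<times> real) measure" where
  "cylinder T = lebesgue_on ({0..T} \<times> {0..<1})"

definition Linf_norm :: "'a measure \<Rightarrow> ('a \<Rightarrow> real) \<Rightarrow> ereal" where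
  "Linf_norm M g = esssup M (\<lambda>x. ereal \<bar>g x\<bar>)"

definition Linf :: "'a measure \<Rightarrow> ('a \<Rightarrow> real) set" where
  "Linf M = {g \<in> borel_measurable M. Linf_norm M g < \<infinity>}"

definition Linf_torus :: "(real \<Rightarrow> real) set" where
  "Linf_torus = {g \<in> Linf torus. periodic g}"

definition condition_A :: "(real \<Rightarrow> real) \<Rightarrow> bool" where
  "condition_A a \<longleftrightarrow>
     (\<forall>x. 0 \<le> a x) \<and> a \<in> Linf_torus \<and>
     bdd_above ((\<lambda>y. (1 / y) * (\<integral>x. \<bar>a (x + y) - a x\<bar> \<partial>torus)) ` {0<..})"

definition smooth :: "(real \<Rightarrow> real) \<Rightarrow> bool" where
  "smooth f \<longleftrightarrow> (\<forall>n x. (deriv ^^ n) f field_differentiable at x)"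

text \<open>\<open>D i j\<close> is the partial derivative of order \<open>i\<close> in \<open>t\<close> and \<open>j\<close> in \<open>x\<close>.\<close>

definition smooth2 :: "(real \<Rightarrow> real \<Rightarrow> real) \<Rightarrow> bool" where
  "smooth2 \<phi> \<longleftrightarrow>
     (\<exists>D :: nat \<Rightarrow> nat \<Rightarrow> real \<Rightarrow> real \<Rightarrow> real. D 0 0 = \<phi> \<and>
        (\<forall>i j. continuous_on UNIV (\<lambda>(t, x). D i j t x) \<and>
           (\<forall>t x. ((\<lambda>s. D i j s x) has_real_derivative D (Suc i) j t x) (at t) \<and>
                  ((\<lambda>y. D i j t y) has_real_derivative D i (Suc j) t x) (at x))))"

text \<open>
  Partial derivatives. For a Lipschitz function they exist almost everywhere; on the remaining
  null set the value of \<open>deriv\<close> is arbitrary and does not influence any integral.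
\<close>

definition deriv_t :: "(real \<Rightarrow> real \<Rightarrow> real) \<Rightarrow> real \<Rightarrow> real \<Rightarrow> real" where
  "deriv_t \<psi> t x = deriv (\<lambda>s. \<psi> s x) t"

definition deriv_x :: "(real \<Rightarrow> real \<Rightarrow> real) \<Rightarrow> real \<Rightarrow> real \<Rightarrow> real" where
  "deriv_x \<psi> t x = deriv (\<lambda>y. \<psi> t y) x"

text \<open>
  The average of the one-sided derivatives, both of which exist for a convex function on \<open>\<real>\<close>;
  it is the derivative wherever the function is differentiable.
\<close>

definition avg_deriv :: "(real \<Rightarrow> real) \<Rightarrow> real \<Rightarrow> real" where
  "avg_deriv \<eta> w =
     (Lim (at_left w) (\<lambda>y. (\<eta> y - \<eta> w) / (y - w)) +
      Lim (at_right w) (\<lambda>y. (\<eta> y - \<eta> w) / (y - w))) / 2"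

text \<open>
  The flux \<open>q\<close> with \<open>q' = f' \<eta>'\<close>. A convex \<open>\<eta>\<close> has at most countably many kinks, where \<open>q\<close> need not
  be differentiable either; continuity of \<open>q\<close> together with the equation at all other points
  determines \<open>q\<close> up to an additive constant.
\<close>

definition entropy_pair :: "(real \<Rightarrow> real) \<Rightarrow> (real \<Rightarrow> real) \<Rightarrow> (real \<Rightarrow> real) \<Rightarrow> bool" where
  "entropy_pair f \<eta> q \<longleftrightarrow>
     convex_on UNIV \<eta> \<and> continuous_on UNIV q \<and>
     (\<forall>w. \<eta> field_differentiable at w \<longrightarrow>
        (q has_real_derivative deriv f w * deriv \<eta> w) (at w))"

text \<open>
  A 1-periodic function of \<open>x\<close> is Lipschitz for the quotient distance on the torus iff it is
  Lipschitz on \<open>\<real>\<close>, with the same constant.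
\<close>

definition lipschitz_test :: "real \<Rightarrow> (real \<Rightarrow> real \<Rightarrow> real) \<Rightarrow> bool" where
  "lipschitz_test T \<psi> \<longleftrightarrow>
     (\<forall>t\<in>{0..T}. periodic (\<psi> t)) \<and>
     (\<forall>t\<in>{0..T}. \<forall>x. 0 \<le> \<psi> t x) \<and>
     (\<exists>L. L-lipschitz_on ({0..T} \<times> UNIV) (\<lambda>(t, x). \<psi> t x)) \<and>
     (\<forall>x. \<psi> T x = 0)"

definition entropy_ineq ::
  "(real \<Rightarrow> real) \<Rightarrow> real \<Rightarrow> (real \<Rightarrow> real) \<Rightarrow> (real \<Rightarrow> real \<Rightarrow> real) \<Rightarrow> (real \<Rightarrow> real \<Rightarrow> real) \<Rightarrow> bool"
where
  "entropy_ineq f T u0 h u \<longleftrightarrow>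
     (\<forall>\<eta> q \<psi>. entropy_pair f \<eta> q \<longrightarrow> lipschitz_test T \<psi> \<longrightarrow>
        (\<integral>(t, x). (deriv_t \<psi> t x * \<eta> (u t x) + deriv_x \<psi> t x * q (u t x)
                    - \<psi> t x * avg_deriv \<eta> (u t x) * h t x) \<partial>cylinder T)
        + (\<integral>x. \<psi> 0 x * \<eta> (u0 x) \<partial>torus) \<ge> 0)"

definition bounded_measurable :: "real \<Rightarrow> (real \<Rightarrow> real \<Rightarrow> real) \<Rightarrow> bool" where
  "bounded_measurable T u \<longleftrightarrow>
     (\<forall>t\<in>{0..T}. periodic (u t)) \<and>
     bounded ((\<lambda>(t, x). u t x) ` ({0..T} \<times> UNIV)) \<and>
     (\<lambda>(t, x). u t x) \<in> borel_measurable (cylinder T)"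

definition Sign :: "real \<Rightarrow> real set" where
  "Sign w = (if w > 0 then {1} else if w < 0 then {-1} else {-1..1})"

text \<open>Smooth functions with compact support in \<open>(0,T) \<times> \<real>/\<int>\<close>, extended by zero in time.\<close>

definition test_function :: "real \<Rightarrow> (real \<Rightarrow> real \<Rightarrow> real) \<Rightarrow> bool" where
  "test_function T \<phi> \<longleftrightarrow>
     smooth2 \<phi> \<and> (\<forall>t. periodic (\<phi> t)) \<and>
     (\<exists>c d. 0 < c \<and> c \<le> d \<and> d < T \<and> (\<forall>t x. t \<notin> {c..d} \<longrightarrow> \<phi> t x = 0))"

text \<open>\<open>\<partial>\<^sub>t u + \<partial>\<^sub>x (f(u)) + h = 0\<close> in the sense of distributions on \<open>(0,T) \<times> \<real>/\<int>\<close>.\<close>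

definition distributional_eq ::
  "(real \<Rightarrow> real) \<Rightarrow> real \<Rightarrow> (real \<Rightarrow> real \<Rightarrow> real) \<Rightarrow> (real \<Rightarrow> real \<Rightarrow> real) \<Rightarrow> bool"
where
  "distributional_eq f T h u \<longleftrightarrow>
     (\<forall>\<phi>. test_function T \<phi> \<longrightarrow>
        (\<integral>(t, x). (- u t x * deriv_t \<phi> t x - f (u t x) * deriv_x \<phi> t x + h t x * \<phi> t x)
           \<partial>cylinder T) = 0)"

text \<open>
  For \<open>\<alpha> < 1\<close> the expression \<open>w / \<bar>w\<bar> powr \<alpha>\<close> is \<open>0\<close> at \<open>w = 0\<close>, because \<open>0 / 0 = 0\<close>.
\<close>

definition admissible_weak_solution ::
  "(real \<Rightarrow> real) \<Rightarrow> real \<Rightarrow> (real \<Rightarrow> real) \<Rightarrow> real \<Rightarrow> (real \<Rightarrow> real) \<Rightarrow> (real \<Rightarrow> real \<Rightarrow> real) \<Rightarrow> bool"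
where
  "admissible_weak_solution f \<alpha> a T u0 u \<longleftrightarrow>
     bounded_measurable T u \<and>
     (if \<alpha> < 1 then
        entropy_ineq f T u0 (\<lambda>t x. a x * (u t x / \<bar>u t x\<bar> powr \<alpha>)) u
      else
        (\<exists>h. (\<forall>t. periodic (h t)) \<and> (\<lambda>(t, x). h t x) \<in> Linf (cylinder T) \<and>
           distributional_eq f T h u \<and>
           (AE (t, x) in cylinder T. h t x \<in> (\<lambda>s. a x * s) ` Sign (u t x)) \<and>
           entropy_ineq f T u0 h u))"

definition continuous_in_L1 :: "(real \<Rightarrow> real \<Rightarrow> real) \<Rightarrow> bool" where
  "continuous_in_L1 u \<longleftrightarrow>
     (\<forall>t\<ge>0. integrable torus (u t)) \<and>
     (\<forall>t\<ge>0. ((\<lambda>s. \<integral>x. \<bar>u s x - u t x\<bar> \<partial>torus) \<longlongrightarrow> 0) (at t within {0..}))"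

text \<open>
  The global admissible weak solution in its representative in \<open>C\<^sup>0([0,\<infinity>); L\<^sup>1)\<close>. The initial
  datum enters through the entropy inequality.
\<close>

definition is_solution ::
  "(real \<Rightarrow> real) \<Rightarrow> real \<Rightarrow> (real \<Rightarrow> real) \<Rightarrow> (real \<Rightarrow> real) \<Rightarrow> (real \<Rightarrow> real \<Rightarrow> real) \<Rightarrow> bool"
where
  "is_solution f \<alpha> a u0 u \<longleftrightarrow>
     (\<forall>T>0. admissible_weak_solution f \<alpha> a T u0 u) \<and> continuous_in_L1 u"

end

theory Submission
  imports Defs "HOL-Probability.Probability_Measure" "HOL-Library.Periodic_Fun"
begin

text \<open>
The result is a comparison principle, and the engine is Kruzhkov's doubling of variables. To
compare two solutions \<open>u\<close> and \<open>v\<close>, test \<open>u\<close> with the entropy \<open>(u - k)\<^sup>+\<close> at \<open>k = v(s, y)\<close> and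
\<open>v\<close> with \<open>(k - v)\<^sup>+\<close> at \<open>k = u(t, x)\<close>, weight both with a kernel \<open>\<rho>(x - y)\<close> and integrate over the
remaining variable. As \<open>\<rho>\<close> depends on \<open>x - y\<close> only, the flux terms of the two inequalities cancel.
The damping terms are \<open>h = a(x) r\<close> and \<open>g = a'(y) r'\<close> with \<open>r\<close>, \<open>r'\<close> values of the monotone graph
\<open>w / \<bar>w\<bar>\<^sup>\<alpha>\<close> (or \<open>Sign\<close>) at \<open>u\<close> and \<open>v\<close>. Where \<open>u > v\<close>, monotonicity gives \<open>r \<ge> r'\<close>, so that
\<open>h - g \<ge> (a'(x) - a'(y)) r'\<close> if \<open>a' = a\<close>, and also if \<open>a' \<le> a\<close> and \<open>v \<ge> 0\<close>, because then \<open>r \<ge> 0\<close>.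
When the kernel concentrates, \<open>a'(x) - a'(y)\<close> disappears in the mean, and what remains is
\<open>\<integral>(u(t) - v(t))\<^sup>+ \<le> \<integral>(u0 - v0)\<^sup>+\<close>, the theorem \<open>flow_pair.comparison\<close>.

Two features keep the argument short. First, time is not doubled. Solutions are continuous in time
with values in \<open>L\<^sup>1\<close>, hence each entropy inequality holds between any two times (\<open>entropy_increment\<close>).
The two times in the doubled quantity \<open>G(t, s)\<close> may therefore be advanced one after the other in
small steps that stay close to the diagonal \<open>t = s\<close> (\<open>pair_mass_bound\<close>). Secondly, the
positive part is replaced by a \<open>C\<^sup>1\<close> function whose derivative rises from 0 to 1 over a length \<open>\<delta>\<close>.
This costs an error of order \<open>\<delta>\<close> in the flux (\<open>kruzhkov_entropy\<close>) but makes the rate of change of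
\<open>G\<close> Lipschitz in the second solution, so that its value on the diagonal controls such a step. A discontinuous sign
would not do for \<open>\<alpha> = 1\<close>: on the set \<open>u = 0\<close> nothing but \<open>\<bar>h\<bar> \<le> a\<close> is known about \<open>h\<close>.

The sup-norm bound and the nonnegativity of \<open>u\<close> follow without doubling from the entropies
\<open>(\<sigma> (u - k))\<^sup>+\<close> with \<open>\<sigma> = \<plusminus>1\<close>, a constant \<open>k\<close> with \<open>\<sigma> k \<ge> 0\<close> and the weight 1, since the damping
then has a favourable sign (\<open>one_sided_bound\<close>).
\<close>

section \<open>The torus, the cylinder and iterated integrals\<close>

definition timespan :: "real \<Rightarrow> real measure" where
  "timespan T = restrict_space lborel {0..T}"

lemma space_torus [simp]: "space torus = {0..<1}"
  by (simp add: torus_def)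

lemma space_timespan [simp]: "space (timespan T) = {0..T}"
  by (simp add: timespan_def space_restrict_space)

lemma emeasure_torus: "emeasure torus (space torus) = 1"
  by (simp add: torus_def emeasure_restrict_space)

lemma measure_torus [simp]: "measure torus {0..<1} = 1"
  using emeasure_torus by (simp add: measure_def)

interpretation torus: prob_space torus
  by (rule prob_spaceI) (rule emeasure_torus)

interpretation timespan: finite_measure "timespan T" for T
  by (rule finite_measureI) (simp add: timespan_def emeasure_restrict_space emeasure_lborel_Icc_eq)

interpretation torus_timespan: pair_sigma_finite torus "timespan T" for T
  by unfold_locales

interpretation torus_torus: pair_prob_space torus torus
  by unfold_locales

lemma ident_torus: "(\<lambda>x. x) \<in> torus \<rightarrow>\<^sub>M borel"
  unfolding torus_def by (intro measurable_restrict_space1 measurable_completion) simp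

lemma ident_timespan: "(\<lambda>x. x) \<in> timespan T \<rightarrow>\<^sub>M borel"
  unfolding timespan_def by (intro measurable_restrict_space1) simp

lemma borel_measurable_torus: "g \<in> borel_measurable borel \<Longrightarrow> g \<in> borel_measurable torus"
  using measurable_compose[OF ident_torus] by auto

lemma sets_cylinder_domain: "{0..T::real} \<times> {0..<1::real} \<in> sets lebesgue"
proof -
  have "{0..T::real} \<times> {0..<1::real} \<in> sets lborel"
    unfolding sets_lborel by (intro borel_Times) auto
  then show ?thesis by (rule sets_completionI_sets)
qed

text \<open>
Null sets of the cylinder are contained in Borel null sets of the plane, and almost every section
of a Borel null set at a fixed time is null.
\<close>

lemma AE_cylinder_iterated:
  assumes "AE p in cylinder T. P p"
  shows "AE t in timespan T. AE x in torus. P (t, x)"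
proof -
  have "AE p in lborel. p \<in> {0..T} \<times> {0..<1} \<longrightarrow> P p"
    using assms unfolding cylinder_def
    by (subst (asm) AE_restrict_space_iff) (auto simp: AE_completion_iff sets_cylinder_domain)
  then have "AE p in lborel \<Otimes>\<^sub>M lborel. p \<in> {0..T} \<times> {0..<1} \<longrightarrow> P p"
    unfolding lborel_prod .
  then have "AE t in lborel. AE x in lborel. (t, x) \<in> {0..T} \<times> {0..<1} \<longrightarrow> P (t, x)"
    by (rule lborel_pair.AE_pair)
  then show ?thesis
    unfolding timespan_def torus_def
    by (subst AE_restrict_space_iff, simp, subst AE_restrict_space_iff)
       (auto simp: AE_completion_iff elim!: eventually_mono)
qed

lemma AE_torus_cylinder:
  assumes "AE x in torus. P x"
  shows "AE p in cylinder T. P (snd p)"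
proof -
  have "AE x in lborel. x \<in> {0..<1} \<longrightarrow> P x"
    using assms unfolding torus_def
    by (subst (asm) AE_restrict_space_iff) (auto simp: AE_completion_iff sets_cylinder_domain)
  then obtain N where N: "N \<in> null_sets lborel" "\<And>x. x \<notin> N \<Longrightarrow> x \<in> {0..<1} \<longrightarrow> P x"
    by (auto elim!: AE_E3)
  have [measurable]: "N \<in> sets borel" using N(1) by auto
  have "AE p in lborel \<Otimes>\<^sub>M lborel. snd p \<notin> N"
    by (rule lborel_pair.AE_pair_measure, measurable) (auto intro!: AE_not_in N(1))
  then have "AE p in lborel. p \<in> {0..T} \<times> {0..<1} \<longrightarrow> P (snd p)"
    unfolding lborel_prod by eventually_elim (use N(2) in auto)
  then show ?thesis
    unfolding cylinder_def
    by (subst AE_restrict_space_iff) (auto simp: AE_completion_iff sets_cylinder_domain)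
qed

lemma integral_torus_borel:
  fixes g :: "real \<Rightarrow> real"
  assumes "g \<in> borel_measurable borel"
  shows "(\<integral>x. g x \<partial>torus) = (\<integral>x. indicator {0..<1} x * g x \<partial>lborel)"
proof -
  have "(\<integral>x. g x \<partial>torus) = (\<integral>x. indicator {0..<1} x *\<^sub>R g x \<partial>lebesgue)"
    unfolding torus_def by (subst integral_restrict_space) auto
  also have "\<dots> = (\<integral>x. indicator {0..<1} x *\<^sub>R g x \<partial>lborel)"
    using assms by (intro integral_completion) simp
  finally show ?thesis by simp
qed

text \<open>
The cylinder carries the completed planar Lebesgue measure, which is not a product measure; for Borel
integrands the completion is invisible and Fubini's theorem applies.
\<close>

lemma integral_cylinder_iterated:
  fixes F :: "real \<times> real \<Rightarrow> real"
  assumes [measurable]: "F \<in> borel_measurable borel"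
    and B: "\<And>t x. t \<in> {0..T} \<Longrightarrow> x \<in> {0..<1} \<Longrightarrow> \<bar>F (t, x)\<bar> \<le> B"
  shows "(\<integral>p. F p \<partial>cylinder T) = (\<integral>t. \<integral>x. F (t, x) \<partial>torus \<partial>timespan T)"
proof -
  let ?S = "{0..T} \<times> {0..<1::real}"
  have S [measurable]: "?S \<in> sets borel" by (intro borel_Times) auto
  have fin: "emeasure lborel ?S < \<infinity>"
  proof -
    have "emeasure lborel ?S \<le> emeasure lborel (cbox (0,0) (T,1::real))"
      by (rule emeasure_mono) (auto simp: cbox_Pair_eq intro!: borel_Times)
    also have "\<dots> < \<infinity>" by (rule emeasure_bounded_finite) (rule bounded_cbox)
    finally show ?thesis .
  qed
  have F2 [measurable]: "F \<in> borel_measurable (borel \<Otimes>\<^sub>M borel)"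
    by (simp add: borel_prod)
  have "integrable lborel (\<lambda>p. indicator ?S p *\<^sub>R F p)"
  proof (rule integrableI_bounded_set_indicator[where B=B])
    show "AE x\<in>?S in lborel. norm (F x) \<le> B" using B by auto
  qed (use fin in auto)
  then have int: "integrable (lborel \<Otimes>\<^sub>M lborel) (\<lambda>p. indicator ?S p *\<^sub>R F p)"
    by (simp add: lborel_prod)
  have "(\<integral>p. F p \<partial>cylinder T) = (\<integral>p. indicator ?S p *\<^sub>R F p \<partial>lebesgue)"
    unfolding cylinder_def by (subst integral_restrict_space) (auto simp: sets_cylinder_domain)
  also have "\<dots> = (\<integral>p. indicator ?S p *\<^sub>R F p \<partial>lborel)"
    by (rule integral_completion) measurable
  also have "\<dots> = (\<integral>p. indicator ?S p *\<^sub>R F p \<partial>(lborel \<Otimes>\<^sub>M lborel))"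
    by (simp add: lborel_prod)
  also have "\<dots> = (\<integral>t. \<integral>x. indicator ?S (t, x) *\<^sub>R F (t, x) \<partial>lborel \<partial>lborel)"
    by (rule lborel_pair.integral_fst'[OF int, symmetric])
  also have "\<dots> = (\<integral>t. indicator {0..T} t *\<^sub>R (\<integral>x. F (t, x) \<partial>torus) \<partial>lborel)"
    by (intro Bochner_Integration.integral_cong refl)
       (subst integral_torus_borel, measurable, auto simp: indicator_def)
  also have "\<dots> = (\<integral>t. \<integral>x. F (t, x) \<partial>torus \<partial>timespan T)"
    unfolding timespan_def by (subst integral_restrict_space) auto
  finally show ?thesis .
qed

text \<open>
Solutions are only Lebesgue measurable jointly in time and space. Passing to Borel versions makes all
sections and compositions measurable without further exceptional sets.
\<close>

lemma borel_representative:
  fixes g :: "'a::euclidean_space \<Rightarrow> real"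
  assumes S: "S \<in> sets lebesgue"
    and g: "g \<in> borel_measurable (lebesgue_on S)" and B: "AE p in lebesgue_on S. \<bar>g p\<bar> \<le> B" and "0 \<le> B"
  obtains g' where "g' \<in> borel_measurable borel" "\<And>p. \<bar>g' p\<bar> \<le> B"
    "AE p in lebesgue_on S. g p = g' p"
proof -
  have "(\<lambda>p. if p \<in> S then g p else 0) \<in> borel_measurable lebesgue"
    using g S by (simp add: borel_measurable_if)
  then obtain k where k: "k \<in> borel_measurable lborel"
      "AE p in lborel. (if p \<in> S then g p else 0) = k p"
    using completion_ex_borel_measurable_real by blast
  have "AE p in lebesgue. (if p \<in> S then g p else 0) = k p"
    using k(2) by (rule AE_completion)
  then have ae: "AE p in lebesgue_on S. g p = k p"
    using S by (subst AE_restrict_space_iff) (auto elim!: eventually_mono)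
  show ?thesis
  proof
    show "(\<lambda>p. max (- B) (min B (k p))) \<in> borel_measurable borel" using k(1) by measurable
    show "\<bar>max (- B) (min B (k p))\<bar> \<le> B" for p using \<open>0 \<le> B\<close> by auto
    show "AE p in lebesgue_on S. g p = max (- B) (min B (k p))"
      using ae B by eventually_elim auto
  qed
qed

lemma borel_measurable_lebesgue_on_AE:
  fixes g g' :: "'a::euclidean_space \<Rightarrow> real"
  assumes S: "S \<in> sets lebesgue"
    and g: "g \<in> borel_measurable (lebesgue_on S)" and "AE p in lebesgue_on S. g p = g' p"
  shows "g' \<in> borel_measurable (lebesgue_on S)"
proof -
  have 1: "(\<lambda>p. if p \<in> S then g p else 0) \<in> borel_measurable lebesgue"
    using g S by (simp add: borel_measurable_if)
  have "(\<lambda>p. if p \<in> S then g' p else 0) \<in> borel_measurable lebesgue"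
    using assms(3) S
    by (intro borel_measurable_AE[OF 1], subst (asm) AE_restrict_space_iff) (auto elim!: eventually_mono)
  then show ?thesis using S by (simp add: borel_measurable_if)
qed

section \<open>Regularised positive part, sign and ramp\<close>

text \<open>
The entropies, the cut-offs in time and the kernels below are all built from \<open>(max 0 z)\<^sup>2\<close>, which is
\<open>C\<^sup>1\<close> on the whole line. Thus no derivative is ever taken at a kink.
\<close>

lemma DERIV_max_sq: "((\<lambda>z::real. (max 0 z)\<^sup>2) has_real_derivative 2 * max 0 z) (at z)"
proof -
  consider "z < 0" | "z > 0" | "z = 0" by linarith
  then show ?thesis
  proof cases
    case 1
    have "((\<lambda>z::real. 0) has_real_derivative 0) (at z)" by simp
    then have "((\<lambda>z::real. (max 0 z)\<^sup>2) has_real_derivative 0) (at z)"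
      by (rule has_field_derivative_transform_within_open[of _ _ _ "{..<0}"]) (use 1 in auto)
    then show ?thesis using 1 by simp
  next
    case 2
    have "((\<lambda>z::real. z\<^sup>2) has_real_derivative 2 * z) (at z)"
      by (auto intro!: derivative_eq_intros)
    then have "((\<lambda>z::real. (max 0 z)\<^sup>2) has_real_derivative 2 * z) (at z)"
      by (rule has_field_derivative_transform_within_open[of _ _ _ "{0<..}"]) (use 2 in auto)
    then show ?thesis using 2 by simp
  next
    case 3
    have "((\<lambda>h::real. ((max 0 h)\<^sup>2 - (max 0 0)\<^sup>2) / h) \<longlongrightarrow> 0) (at 0)"
    proof (rule Lim_null_comparison[where g="\<lambda>h. \<bar>h\<bar>"])
      show "\<forall>\<^sub>F h::real in at 0. norm (((max 0 h)\<^sup>2 - (max 0 0)\<^sup>2) / h) \<le> \<bar>h\<bar>"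
        by (rule always_eventually) (auto simp: power2_eq_square max_def abs_mult)
      show "((\<lambda>h::real. \<bar>h\<bar>) \<longlongrightarrow> 0) (at 0)"
        by (rule tendsto_rabs_zero) (rule tendsto_ident_at)
    qed
    then show ?thesis using 3 by (simp add: DERIV_def)
  qed
qed

lemmas DERIV_max_sq' [derivative_intros] = DERIV_chain2[OF DERIV_max_sq]

text \<open>
A \<open>C\<^sup>1\<close> version of the positive part, quadratic on \<open>[0, \<delta>]\<close> and equal to \<open>r - \<delta> / 2\<close> beyond.
\<close>

definition smooth_pos :: "real \<Rightarrow> real \<Rightarrow> real" where
  "smooth_pos \<delta> r = ((max 0 r)\<^sup>2 - (max 0 (r - \<delta>))\<^sup>2) / (2 * \<delta>)"

definition smooth_sgn :: "real \<Rightarrow> real \<Rightarrow> real" where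
  "smooth_sgn \<delta> r = (max 0 r - max 0 (r - \<delta>)) / \<delta>"

lemma DERIV_smooth_pos:
  assumes "0 < \<delta>"
  shows "(smooth_pos \<delta> has_real_derivative smooth_sgn \<delta> r) (at r)"
proof -
  have "((\<lambda>r. ((max 0 r)\<^sup>2 - (max 0 (r - \<delta>))\<^sup>2) / (2 * \<delta>)) has_real_derivative
      (2 * max 0 r * 1 - 2 * max 0 (r - \<delta>) * 1) / (2 * \<delta>)) (at r)"
    by (intro DERIV_cdivide DERIV_diff DERIV_max_sq') (auto intro!: derivative_eq_intros)
  also have "(2 * max 0 r * 1 - 2 * max 0 (r - \<delta>) * 1) / (2 * \<delta>) = smooth_sgn \<delta> r"
    using assms by (simp add: smooth_sgn_def divide_simps)
  finally show ?thesis by (simp add: smooth_pos_def[abs_def])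
qed

lemma smooth_sgn_bounds: "0 < \<delta> \<Longrightarrow> 0 \<le> smooth_sgn \<delta> r" "0 < \<delta> \<Longrightarrow> smooth_sgn \<delta> r \<le> 1"
  by (auto simp: smooth_sgn_def divide_simps max_def)

lemma smooth_sgn_nonpos: "0 < \<delta> \<Longrightarrow> r \<le> 0 \<Longrightarrow> smooth_sgn \<delta> r = 0"
  by (auto simp: smooth_sgn_def)

lemma smooth_sgn_ge: "0 < \<delta> \<Longrightarrow> \<delta> \<le> r \<Longrightarrow> smooth_sgn \<delta> r = 1"
  by (auto simp: smooth_sgn_def max_def)

lemma smooth_sgn_mono: "0 < \<delta> \<Longrightarrow> r \<le> s \<Longrightarrow> smooth_sgn \<delta> r \<le> smooth_sgn \<delta> s"
  by (auto simp: smooth_sgn_def divide_simps max_def)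

lemma smooth_sgn_lipschitz: "0 < \<delta> \<Longrightarrow> \<bar>smooth_sgn \<delta> r - smooth_sgn \<delta> s\<bar> \<le> \<bar>r - s\<bar> / \<delta>"
  by (auto simp: smooth_sgn_def divide_simps max_def abs_if)

lemma continuous_smooth_sgn [continuous_intros]:
  "continuous_on S g \<Longrightarrow> continuous_on S (\<lambda>x. smooth_sgn \<delta> (g x))"
  unfolding smooth_sgn_def divide_inverse by (intro continuous_intros)

lemma smooth_pos_eq:
  "0 < \<delta> \<Longrightarrow> smooth_pos \<delta> r = (if r \<le> 0 then 0 else if r \<le> \<delta> then r\<^sup>2 / (2 * \<delta>) else r - \<delta> / 2)"
  by (auto simp: smooth_pos_def field_simps power2_eq_square)

lemma smooth_pos_bounds:
  assumes "0 < \<delta>"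
  shows "max 0 r - \<delta> \<le> smooth_pos \<delta> r" "smooth_pos \<delta> r \<le> max 0 r" "0 \<le> smooth_pos \<delta> r"
proof -
  have "r\<^sup>2 / (2 * \<delta>) \<le> r" if "0 < r" "r \<le> \<delta>"
    using that assms by (simp add: field_simps power2_eq_square mult_left_mono)
  moreover have "0 \<le> r\<^sup>2 / (2 * \<delta>)" using assms by simp
  moreover have "r - \<delta> \<le> r\<^sup>2 / (2 * \<delta>)" if "r \<le> \<delta>"
    using that calculation(2) by linarith
  ultimately show "max 0 r - \<delta> \<le> smooth_pos \<delta> r" "smooth_pos \<delta> r \<le> max 0 r" "0 \<le> smooth_pos \<delta> r"
    using assms by (auto simp: smooth_pos_eq max_def)
qed

lemma smooth_pos_eq_0_iff: "0 < \<delta> \<Longrightarrow> smooth_pos \<delta> r = 0 \<longleftrightarrow> r \<le> 0"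
  by (auto simp: smooth_pos_eq split: if_splits)

text \<open>
A \<open>C\<^sup>1\<close> step from 0 to 1 on \<open>[0, \<kappa>]\<close>. Its derivative is a tent of integral 1, the second difference
of the positive part.
\<close>

definition ramp :: "real \<Rightarrow> real \<Rightarrow> real" where
  "ramp \<kappa> z = 2 * ((max 0 (z / \<kappa>))\<^sup>2 - 2 * (max 0 (z / \<kappa> - 1/2))\<^sup>2 + (max 0 (z / \<kappa> - 1))\<^sup>2)"

definition ramp' :: "real \<Rightarrow> real \<Rightarrow> real" where
  "ramp' \<kappa> z = 4 * (max 0 (z / \<kappa>) - 2 * max 0 (z / \<kappa> - 1/2) + max 0 (z / \<kappa> - 1)) / \<kappa>"

lemma DERIV_ramp:
  assumes "0 < \<kappa>"
  shows "(ramp \<kappa> has_real_derivative ramp' \<kappa> z) (at z)"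
proof -
  have "((\<lambda>z. 2 * ((max 0 (z / \<kappa>))\<^sup>2 - 2 * (max 0 (z / \<kappa> - 1/2))\<^sup>2 + (max 0 (z / \<kappa> - 1))\<^sup>2))
     has_real_derivative
      2 * (2 * max 0 (z / \<kappa>) * (1 / \<kappa>) - 2 * (2 * max 0 (z / \<kappa> - 1/2) * (1 / \<kappa>)) + 2 * max 0 (z / \<kappa> - 1) * (1 / \<kappa>))) (at z)"
    using assms by (auto intro!: derivative_eq_intros)
  also have "2 * (2 * max 0 (z / \<kappa>) * (1 / \<kappa>) - 2 * (2 * max 0 (z / \<kappa> - 1/2) * (1 / \<kappa>)) + 2 * max 0 (z / \<kappa> - 1) * (1 / \<kappa>)) = ramp' \<kappa> z"
    using assms by (simp add: ramp'_def field_simps)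
  finally show ?thesis by (simp add: ramp_def[abs_def])
qed

lemma ramp'_nonneg: "0 < \<kappa> \<Longrightarrow> 0 \<le> ramp' \<kappa> z"
  by (auto simp: ramp'_def max_def field_simps intro!: divide_nonneg_nonneg)

lemma ramp'_outside: "0 < \<kappa> \<Longrightarrow> z \<notin> {0..\<kappa>} \<Longrightarrow> ramp' \<kappa> z = 0"
  by (auto simp: ramp'_def max_def field_simps)

lemma ramp_nonpos: "0 < \<kappa> \<Longrightarrow> z \<le> 0 \<Longrightarrow> ramp \<kappa> z = 0"
  by (auto simp: ramp_def max_def field_simps)

lemma ramp_ge:
  assumes "0 < \<kappa>" "\<kappa> \<le> z" shows "ramp \<kappa> z = 1"
proof -
  have 1: "max 0 (z / \<kappa>) = z / \<kappa>" "max 0 (z / \<kappa> - 1/2) = z / \<kappa> - 1/2" "max 0 (z / \<kappa> - 1) = z / \<kappa> - 1"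
    using assms by (auto simp: field_simps max_def)
  show ?thesis unfolding ramp_def 1 by (simp add: power2_eq_square algebra_simps)
qed

lemma ramp_mono: "0 < \<kappa> \<Longrightarrow> y \<le> z \<Longrightarrow> ramp \<kappa> y \<le> ramp \<kappa> z"
  using DERIV_nonneg_imp_nondecreasing[of y z "ramp \<kappa>"] DERIV_ramp ramp'_nonneg by blast

lemma ramp_bounds: "0 < \<kappa> \<Longrightarrow> 0 \<le> ramp \<kappa> z" "0 < \<kappa> \<Longrightarrow> ramp \<kappa> z \<le> 1"
  using ramp_mono[of \<kappa> "min z 0" z] ramp_mono[of \<kappa> z "max z \<kappa>"]
  by (auto simp: ramp_nonpos ramp_ge)

lemma continuous_ramp [continuous_intros]:
  "continuous_on S g \<Longrightarrow> continuous_on S (\<lambda>x. ramp \<kappa> (g x))"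
  unfolding ramp_def divide_inverse by (intro continuous_intros)

lemma continuous_ramp' [continuous_intros]:
  "continuous_on S g \<Longrightarrow> continuous_on S (\<lambda>x. ramp' \<kappa> (g x))"
  unfolding ramp'_def divide_inverse by (intro continuous_intros)

text \<open>
A 1-periodic \<open>C\<^sup>1\<close> bump around the integers, with support shrinking to them as \<open>c \<rightarrow> 1\<close>.
\<close>

definition cos_bump :: "real \<Rightarrow> real \<Rightarrow> real" where
  "cos_bump c z = (max 0 (cos (2 * pi * z) - c))\<^sup>2"

definition cos_bump' :: "real \<Rightarrow> real \<Rightarrow> real" where
  "cos_bump' c z = 2 * max 0 (cos (2 * pi * z) - c) * (- 2 * pi * sin (2 * pi * z))"

lemma DERIV_cos_bump: "(cos_bump c has_real_derivative cos_bump' c z) (at z)"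
  unfolding cos_bump_def[abs_def] cos_bump'_def
  by (auto intro!: derivative_eq_intros)

lemma continuous_cos_bump: "continuous_on S (cos_bump c)" "continuous_on S (cos_bump' c)"
  unfolding cos_bump_def[abs_def] cos_bump'_def[abs_def] by (intro continuous_intros)+

lemma cos_bump_periodic: "cos_bump c (z + 1) = cos_bump c z"
  by (simp add: cos_bump_def distrib_left)

lemma integral_torus_antiderivative:
  fixes F g :: "real \<Rightarrow> real"
  assumes "\<And>x. (F has_real_derivative g x) (at x)" "continuous_on UNIV g"
  shows "(\<integral>x. g x \<partial>torus) = F 1 - F 0"
proof -
  have "(\<integral>x. g x \<partial>torus) = (\<integral>x. indicator {0..<1} x * g x \<partial>lborel)"
    by (rule integral_torus_borel) (rule borel_measurable_continuous_onI[OF assms(2)])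
  also have "\<dots> = (\<integral>x. indicator {0..1} x * g x \<partial>lborel)"
  proof (rule integral_cong_AE)
    have [measurable]: "g \<in> borel_measurable borel" by (rule borel_measurable_continuous_onI[OF assms(2)])
    show "(\<lambda>x. indicator {0..<1} x * g x) \<in> borel_measurable lborel"
       "(\<lambda>x. indicator {0..1} x * g x) \<in> borel_measurable lborel" by measurable
    show "AE x in lborel. indicator {0..<1} x * g x = indicator {0..1} x * g x"
      using AE_lborel_singleton[of "1::real"] by eventually_elim (auto simp: indicator_def)
  qed
  also have "\<dots> = F 1 - F 0"
    using integral_FTC_Icc_real[of 0 1 F g] assms continuous_on_subset[OF assms(2)]
    by (auto simp: mult.commute continuous_on_eq_continuous_at)
  finally show ?thesis .
qed

lemma antiderivative_exists:
  fixes g :: "real \<Rightarrow> real"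
  assumes "continuous_on UNIV g"
  obtains F where "\<And>x. (F has_real_derivative g x) (at x)" "F a = 0"
proof -
  have "\<exists>F. \<forall>x::real. -\<infinity> < ereal x \<longrightarrow> ereal x < \<infinity> \<longrightarrow> (F has_vector_derivative g x) (at x)"
    using assms by (intro einterval_antiderivative) (auto simp: continuous_on_eq_continuous_at)
  then obtain F where F: "\<And>x. (F has_real_derivative g x) (at x)"
    by (auto simp: has_real_derivative_iff_has_vector_derivative)
  show ?thesis
    by (rule that[of "\<lambda>x. F x - F a"]) (auto intro!: derivative_eq_intros F)
qed

text \<open>
With an antiderivative \<open>F\<close>, both integrals are values of \<open>F (z + 1) - F z\<close>, which is constant in \<open>z\<close>
because its derivative \<open>g (z + 1) - g z\<close> vanishes.
\<close>

lemma integral_torus_shift: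
  fixes g :: "real \<Rightarrow> real"
  assumes "continuous_on UNIV g" "\<And>z. g (z + 1) = g z"
  shows "(\<integral>x. g (x - y) \<partial>torus) = (\<integral>x. g x \<partial>torus)"
    and "(\<integral>y. g (x - y) \<partial>torus) = (\<integral>x. g x \<partial>torus)"
proof -
  obtain F where F: "\<And>x. (F has_real_derivative g x) (at x)"
    using antiderivative_exists[OF assms(1)] by metis
  have const: "F (z + 1) - F z = F 1 - F 0" for z
  proof -
    have "((\<lambda>z. F (z + 1) - F z) has_real_derivative 0) (at z)" for z
    proof -
      have "((\<lambda>z. F (z + 1) - F z) has_real_derivative g (z + 1) * 1 - g z) (at z)"
        by (intro derivative_intros DERIV_chain2[OF F] F) (auto intro!: derivative_eq_intros)
      then show ?thesis by (simp add: assms(2))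
    qed
    then have "(\<lambda>z. F (z + 1) - F z) z = (\<lambda>z. F (z + 1) - F z) 0"
      by (intro DERIV_isconst_all) blast
    then show ?thesis by simp
  qed
  have 0: "(\<integral>x. g x \<partial>torus) = F 1 - F 0"
    by (rule integral_torus_antiderivative[OF F assms(1)])
  have "(\<integral>x. g (x - y) \<partial>torus) = F (1 - y) - F (0 - y)"
  proof (rule integral_torus_antiderivative)
    show "((\<lambda>x. F (x - y)) has_real_derivative g (x - y)) (at x)" for x
      by (rule DERIV_chain2[OF F, THEN DERIV_cong]) (auto intro!: derivative_eq_intros)
    show "continuous_on UNIV (\<lambda>x. g (x - y))"
      by (rule continuous_on_compose2[OF assms(1)]) (auto intro!: continuous_intros)
  qed
  then show "(\<integral>x. g (x - y) \<partial>torus) = (\<integral>x. g x \<partial>torus)"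
    using const[of "- y"] by (simp add: 0)
  have "(\<integral>y. g (x - y) \<partial>torus) = - F (x - 1) - - F (x - 0)"
  proof (rule integral_torus_antiderivative)
    show "((\<lambda>y. - F (x - y)) has_real_derivative g (x - y)) (at y)" for y
      by (rule DERIV_cong, rule DERIV_minus, rule DERIV_chain2[OF F]) (auto intro!: derivative_eq_intros)
    show "continuous_on UNIV (\<lambda>y. g (x - y))"
      by (rule continuous_on_compose2[OF assms(1)]) (auto intro!: continuous_intros)
  qed
  then show "(\<integral>y. g (x - y) \<partial>torus) = (\<integral>x. g x \<partial>torus)"
    using const[of "x - 1"] by (simp add: 0)
qed

section \<open>Kernels on the torus that concentrate at the origin\<close>

definition C1_weight :: "(real \<Rightarrow> real) \<Rightarrow> (real \<Rightarrow> real) \<Rightarrow> bool" where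
  "C1_weight \<rho> \<rho>' \<longleftrightarrow>
     (\<forall>x. (\<rho> has_real_derivative \<rho>' x) (at x)) \<and> continuous_on UNIV \<rho>' \<and>
     periodic \<rho> \<and> (\<forall>x. 0 \<le> \<rho> x)"

lemma periodic_bounded:
  fixes g :: "real \<Rightarrow> real"
  assumes "periodic g" "continuous_on UNIV g"
  shows "\<exists>B\<ge>0. \<forall>x. \<bar>g x\<bar> \<le> B"
proof -
  have "compact (g ` {0..1})"
    by (rule compact_continuous_image[OF continuous_on_subset[OF assms(2)]]) auto
  then obtain B where B: "\<And>x. x \<in> {0..1} \<Longrightarrow> \<bar>g x\<bar> \<le> B"
    by (force dest!: compact_imp_bounded simp: bounded_iff)
  interpret periodic_fun_simple' g
    by standard (use assms(1) in \<open>auto simp: periodic_def\<close>)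
  have "\<bar>g x\<bar> \<le> B" for x
  proof -
    have "g x = g (x - of_int \<lfloor>x\<rfloor>)" by (simp add: minus_of_int)
    moreover have "x - of_int \<lfloor>x\<rfloor> \<in> {0..1}" by (simp add: floor_correct) linarith
    ultimately show ?thesis using B by metis
  qed
  moreover from this[of 0] have "0 \<le> B" by linarith
  ultimately show ?thesis by blast
qed

lemma C1_weight_continuous: "C1_weight \<rho> \<rho>' \<Longrightarrow> continuous_on UNIV \<rho>"
  unfolding C1_weight_def by (intro DERIV_continuous_on[of _ _ \<rho>']) (auto intro: has_field_derivative_at_within)

lemma C1_weight_bounded:
  assumes "C1_weight \<rho> \<rho>'"
  obtains R where "\<And>x. \<bar>\<rho> x\<bar> \<le> R" "\<And>x. \<bar>\<rho>' x\<bar> \<le> R" "0 \<le> R"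
proof -
  obtain B1 where B1: "\<And>x. \<bar>\<rho> x\<bar> \<le> B1" "0 \<le> B1"
    using periodic_bounded[OF _ C1_weight_continuous[OF assms]] assms
    unfolding C1_weight_def by blast
  have "\<rho>' (x + 1) = \<rho>' x" for x
  proof (rule DERIV_unique[of \<rho> _ x])
    have "((\<lambda>x. \<rho> (x + 1)) has_real_derivative \<rho>' (x + 1) * 1) (at x)"
      using assms unfolding C1_weight_def
      by (intro DERIV_chain2[of \<rho> _ "\<lambda>x. x + 1"]) (auto intro!: derivative_eq_intros)
    moreover have "(\<lambda>x. \<rho> (x + 1)) = \<rho>"
      using assms by (auto simp: C1_weight_def periodic_def)
    ultimately show "(\<rho> has_real_derivative \<rho>' (x + 1)) (at x)" by simp
    show "(\<rho> has_real_derivative \<rho>' x) (at x)" using assms by (auto simp: C1_weight_def)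
  qed
  then have "periodic \<rho>'" by (simp add: periodic_def)
  then obtain B2 where B2: "\<And>x. \<bar>\<rho>' x\<bar> \<le> B2" "0 \<le> B2"
    using periodic_bounded[of \<rho>'] assms unfolding C1_weight_def by blast
  show ?thesis
    by (rule that[of "max B1 B2"]) (use B1 B2 in \<open>auto simp: le_max_iff_disj\<close>)
qed

lemma C1_weight_translate:
  assumes "C1_weight \<rho> \<rho>'" shows "C1_weight (\<lambda>x. \<rho> (x - y)) (\<lambda>x. \<rho>' (x - y))"
proof -
  have "((\<lambda>x. \<rho> (x - y)) has_real_derivative \<rho>' (x - y)) (at x)" for x
    using assms unfolding C1_weight_def
    by (intro DERIV_chain2[of \<rho> _ "\<lambda>x. x - y", THEN DERIV_cong]) (auto intro!: derivative_eq_intros)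
  moreover have "\<rho> (x + 1 - y) = \<rho> (x - y)" for x
  proof -
    have "\<rho> (x - y + 1) = \<rho> (x - y)"
      using assms by (simp add: C1_weight_def periodic_def)
    then show ?thesis by (simp add: algebra_simps)
  qed
  moreover have "continuous_on UNIV (\<lambda>x. \<rho>' (x - y))"
    by (rule continuous_on_compose2[of UNIV \<rho>'])
       (use assms in \<open>auto simp: C1_weight_def intro!: continuous_intros\<close>)
  ultimately show ?thesis
    using assms unfolding C1_weight_def periodic_def by (auto intro: continuous_on_minus)
qed

lemma C1_weight_reflect:
  assumes "C1_weight \<rho> \<rho>'" shows "C1_weight (\<lambda>y. \<rho> (x - y)) (\<lambda>y. - \<rho>' (x - y))"
proof -
  have "((\<lambda>y. \<rho> (x - y)) has_real_derivative - \<rho>' (x - y)) (at y)" for y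
    using assms unfolding C1_weight_def
    by (intro DERIV_chain2[of \<rho> _ "\<lambda>y. x - y", THEN DERIV_cong]) (auto intro!: derivative_eq_intros)
  moreover have "\<rho> (x - (y + 1)) = \<rho> (x - y)" for y
  proof -
    have "\<rho> (x - (y + 1) + 1) = \<rho> (x - (y + 1))"
      using assms unfolding C1_weight_def periodic_def by blast
    then show ?thesis by simp
  qed
  moreover have "continuous_on UNIV (\<lambda>y. \<rho>' (x - y))"
    by (rule continuous_on_compose2[of UNIV \<rho>'])
       (use assms in \<open>auto simp: C1_weight_def intro!: continuous_intros\<close>)
  ultimately show ?thesis
    using assms unfolding C1_weight_def periodic_def by (auto intro: continuous_on_minus)
qed

definition cos_kernel :: "nat \<Rightarrow> real \<Rightarrow> real" where
  "cos_kernel n z = cos_bump (1 - inverse (Suc n)) z / (\<integral>x. cos_bump (1 - inverse (Suc n)) x \<partial>torus)"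

definition cos_kernel' :: "nat \<Rightarrow> real \<Rightarrow> real" where
  "cos_kernel' n z = cos_bump' (1 - inverse (Suc n)) z / (\<integral>x. cos_bump (1 - inverse (Suc n)) x \<partial>torus)"

text \<open>
If the integral vanished, the bump would vanish almost everywhere on \<open>(0, 1)\<close>, hence by continuity at
0, where it equals \<open>(1 - c)\<^sup>2\<close>.
\<close>

lemma integral_cos_bump_pos:
  assumes "c < 1" shows "0 < (\<integral>x. cos_bump c x \<partial>torus)"
proof (rule ccontr)
  have nn: "0 \<le> cos_bump c x" for x by (simp add: cos_bump_def)
  assume "\<not> ?thesis"
  then have 0: "(\<integral>x. cos_bump c x \<partial>torus) = 0"
    using Bochner_Integration.integral_nonneg[of torus "cos_bump c", OF nn] by linarith
  have per: "periodic (cos_bump c)" by (simp add: periodic_def cos_bump_periodic)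
  have "integrable torus (cos_bump c)"
  proof -
    obtain B where "\<And>x. \<bar>cos_bump c x\<bar> \<le> B"
      using periodic_bounded[OF per continuous_cos_bump(1)] by metis
    then show ?thesis
      by (intro torus.integrable_const_bound[where B=B] borel_measurable_torus
            borel_measurable_continuous_onI continuous_cos_bump) auto
  qed
  then have "AE x in torus. cos_bump c x = 0"
    using 0 nn by (subst (asm) integral_nonneg_eq_0_iff_AE) auto
  then have "AE x in lebesgue. x \<in> {0..<1} \<longrightarrow> cos_bump c x = 0"
    unfolding torus_def by (subst (asm) AE_restrict_space_iff) auto
  then have ae: "AE x in lebesgue. x \<in> {0<..<1} \<longrightarrow> x \<in> {x. cos_bump c x = 0}"
    by eventually_elim auto
  have cl: "closed {x. cos_bump c x = 0}"
    by (intro closed_Collect_eq continuous_cos_bump continuous_intros)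
  have "{0<..<1} \<subseteq> {x. cos_bump c x = 0}"
    using mem_closed_if_AE_lebesgue_open[OF open_greaterThanLessThan cl ae] by auto
  then have "closure {0<..<1} \<subseteq> {x. cos_bump c x = 0}"
    using cl by (rule closure_minimal)
  then have "0 \<in> {x. cos_bump c x = 0}"
    by (rule subsetD) (simp add: closure_greaterThanLessThan)
  then have "cos_bump c 0 = 0" by simp
  then show False using assms by (simp add: cos_bump_def)
qed

lemma C1_weight_cos_kernel: "C1_weight (cos_kernel n) (cos_kernel' n)"
proof -
  let ?c = "1 - inverse (real (Suc n))"
  have I: "0 < (\<integral>x. cos_bump ?c x \<partial>torus)"
    by (rule integral_cos_bump_pos) simp
  have "(cos_kernel n has_real_derivative cos_kernel' n x) (at x)" for x
    unfolding cos_kernel_def[abs_def] cos_kernel'_def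
    by (intro DERIV_cdivide DERIV_cos_bump)
  moreover have "continuous_on UNIV (cos_kernel' n)"
    unfolding cos_kernel'_def[abs_def] divide_inverse
    by (intro continuous_intros continuous_cos_bump)
  moreover have "periodic (cos_kernel n)"
    by (simp add: periodic_def cos_kernel_def cos_bump_periodic)
  moreover have "0 \<le> cos_kernel n x" for x
    unfolding cos_kernel_def by (intro divide_nonneg_pos I) (simp add: cos_bump_def)
  ultimately show ?thesis by (simp add: C1_weight_def)
qed

lemma integral_cos_kernel:
  "(\<integral>x. cos_kernel n (x - y) \<partial>torus) = 1" "(\<integral>y. cos_kernel n (x - y) \<partial>torus) = 1"
proof -
  have *: "(\<integral>x. cos_kernel n x \<partial>torus) = 1"
    using integral_cos_bump_pos[of "1 - inverse (real (Suc n))"]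
    by (simp add: cos_kernel_def[abs_def])
  have per: "\<And>z. cos_kernel n (z + 1) = cos_kernel n z"
    using C1_weight_cos_kernel[of n] by (simp add: C1_weight_def periodic_def)
  note c = C1_weight_continuous[OF C1_weight_cos_kernel]
  show "(\<integral>x. cos_kernel n (x - y) \<partial>torus) = 1" "(\<integral>y. cos_kernel n (x - y) \<partial>torus) = 1"
    using integral_torus_shift[OF c per] * by auto
qed

lemma cos_kernel_nonneg: "0 \<le> cos_kernel n z"
  using C1_weight_cos_kernel[of n] by (simp add: C1_weight_def)

text \<open>
For \<open>x, y \<in> [0, 1)\<close> the difference \<open>z = x - y\<close> has \<open>\<bar>z\<bar> < 1\<close>, so the kernel can be active near
\<open>z = 0\<close> and near \<open>z = \<plusminus>1\<close>; both mean that \<open>x\<close> and \<open>y\<close> are close on the torus.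
\<close>

lemma cos_kernel_vanishes:
  assumes "0 < \<kappa>" "\<kappa> \<le> 1/2"
  shows "\<forall>\<^sub>F n in sequentially. \<forall>z. \<kappa> \<le> \<bar>z\<bar> \<and> \<bar>z\<bar> \<le> 1 - \<kappa> \<longrightarrow> cos_kernel n z = 0"
proof -
  have *: "cos (2 * pi * \<kappa>) < cos 0"
    using assms pi_gt_zero by (intro cos_monotone_0_pi) (auto simp: field_simps)
  have "(\<lambda>n. 1 - inverse (real (Suc n))) \<longlonglongrightarrow> 1 - 0"
    by (intro tendsto_intros LIMSEQ_inverse_real_of_nat)
  then have "\<forall>\<^sub>F n in sequentially. cos (2 * pi * \<kappa>) < 1 - inverse (real (Suc n))"
    using * by (intro order_tendstoD(1)) auto
  then show ?thesis
  proof (rule eventually_mono, intro allI impI)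
    fix n :: nat and z :: real
    assume n: "cos (2 * pi * \<kappa>) < 1 - inverse (real (Suc n))" and z: "\<kappa> \<le> \<bar>z\<bar> \<and> \<bar>z\<bar> \<le> 1 - \<kappa>"
    have "cos (2 * pi * \<bar>z\<bar>) \<le> cos (2 * pi * \<kappa>)"
    proof (cases "\<bar>z\<bar> \<le> 1/2")
      case True
      then show ?thesis using z assms
        by (intro cos_monotone_0_pi_le) (auto simp: field_simps mult_left_mono)
    next
      case False
      have "cos (2 * pi * \<bar>z\<bar>) = cos (2 * pi - 2 * pi * (1 - \<bar>z\<bar>))" by (simp add: algebra_simps)
      also have "\<dots> = cos (2 * pi * (1 - \<bar>z\<bar>))" by (simp add: cos_diff)
      also have "\<dots> \<le> cos (2 * pi * \<kappa>)" using z assms False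
        by (intro cos_monotone_0_pi_le mult_left_mono) auto
      finally show ?thesis .
    qed
    moreover have "cos (2 * pi * \<bar>z\<bar>) = cos (2 * pi * z)" by (simp add: abs_if)
    ultimately show "cos_kernel n z = 0"
      using n by (simp add: cos_kernel_def cos_bump_def)
  qed
qed

abbreviation torus2 :: "(real \<times> real) measure" where
  "torus2 \<equiv> torus \<Otimes>\<^sub>M torus"

lemma measurable_diff_torus2: "(\<lambda>p. fst p - snd p) \<in> borel_measurable torus2"
  by (intro borel_measurable_diff measurable_compose[OF measurable_fst ident_torus]
      measurable_compose[OF measurable_snd ident_torus])

lemma measurable_translate_torus2:
  "continuous_on UNIV \<rho> \<Longrightarrow> (\<lambda>p. \<rho> (fst p - snd p) :: real) \<in> borel_measurable torus2"
  by (rule measurable_compose[OF measurable_diff_torus2]) (rule borel_measurable_continuous_onI)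

lemma cos_kernel_mean:
  fixes \<phi> :: "real \<Rightarrow> real"
  assumes [measurable]: "\<phi> \<in> borel_measurable torus" and M: "\<And>x. \<bar>\<phi> x\<bar> \<le> M"
  shows "integrable torus2 (\<lambda>p. cos_kernel n (fst p - snd p) * \<phi> (fst p))"
    and "integrable torus2 (\<lambda>p. cos_kernel n (fst p - snd p) * \<phi> (snd p))"
    and "(\<integral>p. cos_kernel n (fst p - snd p) * \<phi> (fst p) \<partial>torus2) = (\<integral>x. \<phi> x \<partial>torus)"
    and "(\<integral>p. cos_kernel n (fst p - snd p) * \<phi> (snd p) \<partial>torus2) = (\<integral>x. \<phi> x \<partial>torus)"
proof -
  note K = C1_weight_cos_kernel[of n]
  obtain R where R: "\<And>x. \<bar>cos_kernel n x\<bar> \<le> R" "0 \<le> R"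
    using C1_weight_bounded[OF K] by metis
  have [measurable]: "(\<lambda>p. cos_kernel n (fst p - snd p)) \<in> borel_measurable torus2"
    by (rule measurable_translate_torus2[OF C1_weight_continuous[OF K]])
  have bd: "\<bar>cos_kernel n z * \<phi> x\<bar> \<le> R * M" for z x
    unfolding abs_mult by (intro mult_mono R M) (auto simp: R)
  show i1: "integrable torus2 (\<lambda>p. cos_kernel n (fst p - snd p) * \<phi> (fst p))"
    by (rule torus_torus.integrable_const_bound[where B="R * M"]) (use bd in auto)
  show i2: "integrable torus2 (\<lambda>p. cos_kernel n (fst p - snd p) * \<phi> (snd p))"
    by (rule torus_torus.integrable_const_bound[where B="R * M"]) (use bd in auto)
  show "(\<integral>p. cos_kernel n (fst p - snd p) * \<phi> (fst p) \<partial>torus2) = (\<integral>x. \<phi> x \<partial>torus)"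
    using torus_torus.integral_fst'[OF i1] by (simp add: integral_cos_kernel)
  show "(\<integral>p. cos_kernel n (fst p - snd p) * \<phi> (snd p) \<partial>torus2) = (\<integral>x. \<phi> x \<partial>torus)"
    using torus_torus.integral_snd[of "\<lambda>x y. cos_kernel n (x - y) * \<phi> y"] i2
    by (simp add: integral_cos_kernel case_prod_beta')
qed

text \<open>
The mean oscillation of \<open>r\<close> at the scale of the kernel, the error made when \<open>r x\<close> is replaced
by \<open>r y\<close> under the kernel.
\<close>

definition kernel_variation :: "nat \<Rightarrow> (real \<Rightarrow> real) \<Rightarrow> real" where
  "kernel_variation n r = (\<integral>p. cos_kernel n (fst p - snd p) * \<bar>r (fst p) - r (snd p)\<bar> \<partial>torus2)"

lemma integrable_kernel_variation:
  fixes r :: "real \<Rightarrow> real"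
  assumes [measurable]: "r \<in> borel_measurable torus" and M: "\<And>x. \<bar>r x\<bar> \<le> M"
  shows "integrable torus2 (\<lambda>p. cos_kernel n (fst p - snd p) * \<bar>r (fst p) - r (snd p)\<bar>)"
proof -
  note K = C1_weight_cos_kernel[of n]
  obtain R where R: "\<And>x. \<bar>cos_kernel n x\<bar> \<le> R" "0 \<le> R"
    using C1_weight_bounded[OF K] by metis
  have [measurable]: "(\<lambda>p. cos_kernel n (fst p - snd p)) \<in> borel_measurable torus2"
    by (rule measurable_translate_torus2[OF C1_weight_continuous[OF K]])
  have bd: "\<bar>cos_kernel n z * \<bar>r x - r y\<bar>\<bar> \<le> R * (2 * M)" for z x y
    unfolding abs_mult using M[of x] M[of y] by (intro mult_mono R) (auto simp: R)
  show ?thesis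
    by (rule torus_torus.integrable_const_bound[where B="R * (2 * M)"]) (use bd in auto)
qed

text \<open>
For an interior point \<open>y\<close> and large \<open>n\<close> the kernel confines \<open>x\<close> to a small interval around \<open>y\<close>
inside \<open>(0, 1)\<close>, where \<open>g\<close> is almost constant. The end point of the fundamental domain is a null
set, so dominated convergence applies.
\<close>

lemma kernel_variation_continuous:
  assumes cont: "continuous_on UNIV g" and M: "\<And>x. \<bar>g x\<bar> \<le> M"
  shows "(\<lambda>n. kernel_variation n g) \<longlonglongrightarrow> 0"
proof -
  have [measurable]: "g \<in> borel_measurable torus"
    by (intro borel_measurable_torus borel_measurable_continuous_onI cont)
  let ?I = "\<lambda>n y. \<integral>x. cos_kernel n (x - y) * \<bar>g x - g y\<bar> \<partial>torus"
  note K0 = cos_kernel_nonneg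
  have Kint: "integrable torus (\<lambda>x. cos_kernel n (x - y))" for n y
    by (rule ccontr) (use integral_cos_kernel(1)[of n y] not_integrable_integral_eq in force)
  have split: "kernel_variation n g = (\<integral>y. ?I n y \<partial>torus)" 
    and meas: "?I n \<in> borel_measurable torus" for n
    using torus_torus.integral_snd[of "\<lambda>x y. cos_kernel n (x - y) * \<bar>g x - g y\<bar>"]
      torus_torus.integrable_snd[of "\<lambda>x y. cos_kernel n (x - y) * \<bar>g x - g y\<bar>"]
      integrable_kernel_variation[of g M n] M
    by (auto simp: kernel_variation_def case_prod_beta')
  have le: "?I n y \<le> e"
    if e: "\<And>x. x \<in> {0..<1} \<Longrightarrow> cos_kernel n (x - y) \<noteq> 0 \<Longrightarrow> \<bar>g x - g y\<bar> \<le> e" for n y e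
  proof -
    have "?I n y \<le> (\<integral>x. cos_kernel n (x - y) * e \<partial>torus)"
    proof (rule integral_mono')
      show "integrable torus (\<lambda>x. cos_kernel n (x - y) * e)" using Kint by simp
      show "cos_kernel n (x - y) * \<bar>g x - g y\<bar> \<le> cos_kernel n (x - y) * e" if "x \<in> space torus" for x
        using e[of x] that K0[of n "x - y"] by (cases "cos_kernel n (x - y) = 0") (auto intro: mult_left_mono)
      then show "0 \<le> cos_kernel n (x - y) * e" if "x \<in> space torus" for x
        using that K0[of n "x - y"] by (meson abs_ge_zero mult_nonneg_nonneg order_trans)
    qed
    then show ?thesis by (simp add: integral_cos_kernel)
  qed
  have nn: "0 \<le> ?I n y" for n y
    by (intro Bochner_Integration.integral_nonneg mult_nonneg_nonneg K0) auto
  have "(\<lambda>n. \<integral>y. ?I n y \<partial>torus) \<longlonglongrightarrow> (\<integral>y. 0 \<partial>torus)"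
  proof (rule integral_dominated_convergence[where w="\<lambda>_. 2 * M"])
    show "AE y in torus. norm (?I n y) \<le> 2 * M" for n
    proof (rule AE_I2)
      fix y
      have "\<bar>g x - g y\<bar> \<le> 2 * M" for x using M[of x] M[of y] by linarith
      then show "norm (?I n y) \<le> 2 * M" using le[of n y "2 * M"] nn by simp
    qed
    have ne: "AE y in torus. y \<noteq> 0"
    proof -
      have "AE y in lebesgue. y \<noteq> (0::real)" by (rule AE_completion) (rule AE_lborel_singleton)
      then show ?thesis unfolding torus_def by (subst AE_restrict_space_iff) auto
    qed
    show "AE y in torus. (\<lambda>n. ?I n y) \<longlonglongrightarrow> 0"
      using ne AE_space
    proof eventually_elim
      fix y assume "y \<noteq> 0" "y \<in> space torus"
      then have y: "0 < y" "y < 1" by auto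
      show "(\<lambda>n. ?I n y) \<longlonglongrightarrow> 0"
      proof (rule LIMSEQ_I)
        fix e :: real assume "0 < e"
        obtain d where d: "0 < d" "\<And>x. \<bar>x - y\<bar> < d \<Longrightarrow> \<bar>g x - g y\<bar> < e / 2"
          using cont \<open>0 < e\<close> unfolding continuous_on_iff dist_real_def
          by (metis UNIV_I half_gt_zero)
        define \<kappa> where "\<kappa> = Min {d, y, 1 - y}"
        have \<kappa>: "0 < \<kappa>" "\<kappa> \<le> 1/2" "\<kappa> \<le> d" "\<kappa> \<le> y" "\<kappa> \<le> 1 - y"
          using d(1) y by (auto simp: \<kappa>_def min_def)
        have "\<forall>\<^sub>F n in sequentially. ?I n y \<le> e / 2"
          using cos_kernel_vanishes[OF \<kappa>(1,2)]
        proof eventually_elim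
          fix n assume n: "\<forall>z. \<kappa> \<le> \<bar>z\<bar> \<and> \<bar>z\<bar> \<le> 1 - \<kappa> \<longrightarrow> cos_kernel n z = 0"
          show "?I n y \<le> e / 2"
          proof (rule le)
            fix x :: real assume x: "x \<in> {0..<1}" "cos_kernel n (x - y) \<noteq> 0"
            have "\<bar>x - y\<bar> \<le> 1 - \<kappa>" using x(1) \<kappa>(4,5) by auto
            then have "\<bar>x - y\<bar> < \<kappa>" using n x(2) by (meson not_less)
            then show "\<bar>g x - g y\<bar> \<le> e / 2" using d(2)[of x] \<kappa>(3) by auto
          qed
        qed
        then show "\<exists>N. \<forall>n\<ge>N. norm (?I n y - 0) < e"
          unfolding eventually_sequentially using nn \<open>0 < e\<close> by fastforce
      qed
    qed
  qed (use meas in auto)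
  then show ?thesis by (simp add: split)
qed

text \<open>
A Lebesgue measurable function is an almost everywhere limit of continuous functions; truncating them
at \<open>M\<close> allows dominated convergence.
\<close>

lemma continuous_approximation:
  assumes r: "r \<in> borel_measurable torus" and M: "\<And>x. \<bar>r x :: real\<bar> \<le> M" and "0 < e"
  obtains g where "continuous_on UNIV g" "\<And>x. \<bar>g x\<bar> \<le> M" "(\<integral>x. \<bar>r x - g x\<bar> \<partial>torus) < e"
proof -
  have "r measurable_on {0..<1}"
    using r unfolding torus_def by (subst measurable_on_iff_borel_measurable) auto
  then obtain N g where N: "negligible N" and g: "\<And>n. continuous_on UNIV (g n)"
    and lim: "\<And>x. x \<notin> N \<Longrightarrow> (\<lambda>n. g n x) \<longlonglongrightarrow> (if x \<in> {0..<1} then r x else 0)"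
    unfolding measurable_on_def by metis
  define k where "k n x = max (- M) (min M (g n x))" for n x
  have M0: "0 \<le> M" using M[of 0] by linarith
  have kc: "continuous_on UNIV (k n)" for n
    unfolding k_def[abs_def] by (intro continuous_intros g)
  have [measurable]: "k n \<in> borel_measurable torus" for n
    by (intro borel_measurable_torus borel_measurable_continuous_onI kc)
  have kM: "\<bar>k n x\<bar> \<le> M" for n x using M0 by (auto simp: k_def)
  have ae: "AE x in torus. x \<notin> N"
  proof -
    have "AE x in lebesgue. x \<notin> N"
      using N by (intro AE_not_in) (simp add: negligible_iff_null_sets)
    then show ?thesis unfolding torus_def by (subst AE_restrict_space_iff) auto
  qed
  have "(\<lambda>n. \<integral>x. \<bar>r x - k n x\<bar> \<partial>torus) \<longlonglongrightarrow> (\<integral>x. 0 \<partial>torus)"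
  proof (rule integral_dominated_convergence[where w="\<lambda>_. 2 * M"])
    show "AE x in torus. norm \<bar>r x - k n x\<bar> \<le> 2 * M" for n
    proof (rule AE_I2)
      show "norm \<bar>r x - k n x\<bar> \<le> 2 * M" for x using M[of x] kM[of n x] by simp
    qed
    show "AE x in torus. (\<lambda>n. \<bar>r x - k n x\<bar>) \<longlonglongrightarrow> 0"
      using ae AE_space
    proof eventually_elim
      fix x assume x: "x \<notin> N" "x \<in> space torus"
      then have "(\<lambda>n. g n x) \<longlonglongrightarrow> r x" using lim[of x] by auto
      then have "(\<lambda>n. \<bar>r x - k n x\<bar>) \<longlonglongrightarrow> \<bar>r x - max (- M) (min M (r x))\<bar>"
        unfolding k_def by (intro tendsto_intros)
      moreover have "max (- M) (min M (r x)) = r x" using M[of x] by auto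
      ultimately show "(\<lambda>n. \<bar>r x - k n x\<bar>) \<longlonglongrightarrow> 0" by simp
    qed
  qed (use r in auto)
  then have "\<forall>\<^sub>F n in sequentially. (\<integral>x. \<bar>r x - k n x\<bar> \<partial>torus) < e"
    using \<open>0 < e\<close> by (intro order_tendstoD(2)) auto
  then obtain n where "(\<integral>x. \<bar>r x - k n x\<bar> \<partial>torus) < e" by (auto simp: eventually_sequentially)
  then show ?thesis using that[of "k n"] kc kM by blast
qed

text \<open>
Replacing \<open>r\<close> by a continuous \<open>g\<close> changes the variation by at most \<open>2 \<integral>\<bar>r - g\<bar>\<close>, uniformly in \<open>n\<close>,
since the kernel has mean 1 in either variable.
\<close>

lemma kernel_variation_tendsto_0:
  assumes r [measurable]: "r \<in> borel_measurable torus" and M: "\<And>x. \<bar>r x :: real\<bar> \<le> M"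
  shows "(\<lambda>n. kernel_variation n r) \<longlonglongrightarrow> 0"
proof (rule LIMSEQ_I)
  fix e :: real assume "0 < e"
  obtain g where g: "continuous_on UNIV g" "\<And>x. \<bar>g x\<bar> \<le> M" "(\<integral>x. \<bar>r x - g x\<bar> \<partial>torus) < e / 4"
    using continuous_approximation[OF r M, of "e/4"] \<open>0 < e\<close> by auto
  have [measurable]: "g \<in> borel_measurable torus"
    by (intro borel_measurable_torus borel_measurable_continuous_onI g)
  note K0 = cos_kernel_nonneg
  have bd: "\<bar>\<bar>r x - g x\<bar>\<bar> \<le> 2 * M" for x using M[of x] g(2)[of x] by linarith
  have le: "kernel_variation n r \<le> kernel_variation n g + e / 2" for n
  proof -
    let ?K = "\<lambda>p. cos_kernel n (fst p - snd p)"
    note i = integrable_kernel_variation[OF r M, of n] integrable_kernel_variation[of g M n]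
      cos_kernel_mean[of "\<lambda>x. \<bar>r x - g x\<bar>" "2 * M" n]
    have "kernel_variation n r \<le> (\<integral>p. ?K p * \<bar>r (fst p) - g (fst p)\<bar> + (?K p * \<bar>g (fst p) - g (snd p)\<bar>
         + ?K p * \<bar>r (snd p) - g (snd p)\<bar>) \<partial>torus2)"
      unfolding kernel_variation_def
    proof (rule Bochner_Integration.integral_mono)
      fix p
      have "?K p * \<bar>r (fst p) - r (snd p)\<bar> \<le> ?K p * (\<bar>r (fst p) - g (fst p)\<bar> + \<bar>g (fst p) - g (snd p)\<bar> + \<bar>r (snd p) - g (snd p)\<bar>)"
        by (intro mult_left_mono K0) linarith
      then show "?K p * \<bar>r (fst p) - r (snd p)\<bar> \<le> ?K p * \<bar>r (fst p) - g (fst p)\<bar> + (?K p * \<bar>g (fst p) - g (snd p)\<bar>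
         + ?K p * \<bar>r (snd p) - g (snd p)\<bar>)" by (simp add: algebra_simps)
    qed (use i bd g(2) in auto)
    also have "\<dots> = (\<integral>x. \<bar>r x - g x\<bar> \<partial>torus) + (kernel_variation n g + (\<integral>x. \<bar>r x - g x\<bar> \<partial>torus))"
      unfolding kernel_variation_def using i bd g(2)
      by (subst Bochner_Integration.integral_add, auto)+
    finally show ?thesis using g(3) by linarith
  qed
  have nn: "0 \<le> kernel_variation n r" for n
    unfolding kernel_variation_def
    by (intro Bochner_Integration.integral_nonneg mult_nonneg_nonneg K0) auto
  have "\<forall>\<^sub>F n in sequentially. kernel_variation n g < e / 2"
    using kernel_variation_continuous[OF g(1,2)] \<open>0 < e\<close> by (intro order_tendstoD(2)) auto
  then obtain N where N: "\<And>n. n \<ge> N \<Longrightarrow> kernel_variation n g < e / 2"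
    unfolding eventually_sequentially by blast
  have "norm (kernel_variation n r - 0) < e" if "n \<ge> N" for n
    using N[OF that] le[of n] nn[of n] by simp
  then show "\<exists>N. \<forall>n\<ge>N. norm (kernel_variation n r - 0) < e" by blast
qed

section \<open>Entropy inequalities between two times\<close>

text \<open>
The bound on \<open>\<eta>'\<close> makes entropies 1-Lipschitz, so that \<open>\<integral>\<rho> \<eta>(u(t))\<close> inherits its continuity in
time from that of \<open>u\<close> in \<open>L\<^sup>1\<close>.
\<close>

definition C1_entropy ::
  "(real \<Rightarrow> real) \<Rightarrow> (real \<Rightarrow> real) \<Rightarrow> (real \<Rightarrow> real) \<Rightarrow> (real \<Rightarrow> real) \<Rightarrow> bool" where
  "C1_entropy f \<eta> \<eta>' q \<longleftrightarrow>
     convex_on UNIV \<eta> \<and> (\<forall>r. (\<eta> has_real_derivative \<eta>' r) (at r)) \<and>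
     continuous_on UNIV \<eta>' \<and> (\<forall>r. \<bar>\<eta>' r\<bar> \<le> 1) \<and>
     (\<forall>r. (q has_real_derivative deriv f r * \<eta>' r) (at r))"

lemma C1_entropy_continuous:
  assumes "C1_entropy f \<eta> \<eta>' q"
  shows "continuous_on UNIV \<eta>" "continuous_on UNIV \<eta>'" "continuous_on UNIV q"
proof -
  note E = assms[unfolded C1_entropy_def]
  show "continuous_on UNIV \<eta>'" using E by blast
  show "continuous_on UNIV \<eta>"
    by (rule DERIV_continuous_on[of _ _ \<eta>']) (use E in \<open>auto intro: has_field_derivative_at_within\<close>)
  show "continuous_on UNIV q"
    by (rule DERIV_continuous_on[of _ _ "\<lambda>r. deriv f r * \<eta>' r"])
       (use E in \<open>auto intro: has_field_derivative_at_within\<close>)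
qed

lemma C1_entropy_lipschitz:
  assumes "C1_entropy f \<eta> \<eta>' q"
  shows "\<bar>\<eta> r - \<eta> s\<bar> \<le> \<bar>r - s\<bar>"
proof -
  have "norm (\<eta> r - \<eta> s) \<le> 1 * norm (r - s)"
    by (rule field_differentiable_bound[of UNIV _ \<eta>']) (use assms in \<open>auto simp: C1_entropy_def\<close>)
  then show ?thesis by simp
qed

lemma bounded_on_symmetric_interval:
  fixes g :: "real \<Rightarrow> real"
  assumes "continuous_on UNIV g"
  obtains B where "0 \<le> B" "\<And>r. \<bar>r\<bar> \<le> M \<Longrightarrow> \<bar>g r\<bar> \<le> B"
proof -
  have "compact (g ` {-M..M})"
    by (rule compact_continuous_image[OF continuous_on_subset[OF assms]]) auto
  then obtain B where B: "\<And>x. x \<in> {-M..M} \<Longrightarrow> \<bar>g x\<bar> \<le> B"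
    by (force dest!: compact_imp_bounded simp: bounded_iff)
  show ?thesis
  proof (rule that[of "\<bar>B\<bar>"])
    show "\<bar>g r\<bar> \<le> \<bar>B\<bar>" if "\<bar>r\<bar> \<le> M" for r
    proof -
      have "- M \<le> r" "r \<le> M" using that by linarith+
      then have "\<bar>g r\<bar> \<le> B" using B[of r] by simp
      then show ?thesis by linarith
    qed
  qed simp
qed

lemma integral_timespan:
  fixes g :: "real \<Rightarrow> real"
  shows "(\<integral>t. g t \<partial>timespan T) = (\<integral>t. indicator {0..T} t * g t \<partial>lborel)"
  unfolding timespan_def by (subst integral_restrict_space) auto

lemma borel_measurable_timespan: "g \<in> borel_measurable borel \<Longrightarrow> g \<in> borel_measurable (timespan T)"
  using measurable_compose[OF ident_timespan] by auto

lemma integrable_timespan_continuous: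
  fixes g :: "real \<Rightarrow> real"
  assumes "continuous_on UNIV g"
  shows "integrable (timespan T) g"
proof -
  obtain B where "\<And>r. \<bar>r\<bar> \<le> \<bar>T\<bar> \<Longrightarrow> \<bar>g r\<bar> \<le> B" using bounded_on_symmetric_interval[OF assms] by metis
  then show ?thesis
    by (intro timespan.integrable_const_bound[where B=B] borel_measurable_timespan
        borel_measurable_continuous_onI assms) auto
qed

lemma integral_timespan_antiderivative:
  fixes F g :: "real \<Rightarrow> real"
  assumes "0 \<le> T" "\<And>x. (F has_real_derivative g x) (at x)" "continuous_on UNIV g"
  shows "(\<integral>x. g x \<partial>timespan T) = F T - F 0"
  unfolding integral_timespan
  using integral_FTC_Icc_real[of 0 T F g] assms
  by (auto simp: mult.commute continuous_on_eq_continuous_at)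

lemma integral_timespan_Icc:
  assumes "0 \<le> s" "s \<le> t" "t \<le> T"
  shows "integrable (timespan T) (indicator {s..t} :: real \<Rightarrow> real)"
    and "(\<integral>x. indicator {s..t} x \<partial>timespan T) = t - s"
proof -
  have sets: "{s..t} \<in> sets (timespan T)"
    unfolding timespan_def using assms by (auto simp: sets_restrict_space_iff)
  then show "integrable (timespan T) (indicator {s..t} :: real \<Rightarrow> real)"
    by (intro timespan.integrable_const_bound[where B=1] borel_measurable_indicator)
       (auto simp: indicator_def)
  have "measure (timespan T) {s..t} = t - s"
    unfolding timespan_def using assms by (subst measure_restrict_space) auto
  then show "(\<integral>x. indicator {s..t} x \<partial>timespan T) = t - s"
    using sets assms by (simp add: Int_absorb2)
qed

lemma AE_timespan_neq: "AE t in timespan T. t \<noteq> s"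
  unfolding timespan_def
  by (subst AE_restrict_space_iff) (auto intro: eventually_mono[OF AE_lborel_singleton[of s]])

lemma ramp_step:
  assumes "0 < \<kappa>"
  shows "\<bar>ramp \<kappa> (t - s) - indicator {s..} t\<bar> \<le> indicator {s..s+\<kappa>} t"
  using ramp_bounds[OF assms, of "t - s"] ramp_nonpos[OF assms, of "t - s"] ramp_ge[OF assms, of "t - s"]
  by (cases "t < s"; cases "t \<le> s + \<kappa>") (auto simp: indicator_def)

lemma integrable_abs_diff_torus:
  fixes p r :: "real \<Rightarrow> real"
  assumes "p \<in> borel_measurable torus" "r \<in> borel_measurable torus"
    and M: "\<And>x. \<bar>p x\<bar> \<le> M" "\<And>x. \<bar>r x\<bar> \<le> M"
  shows "integrable torus (\<lambda>x. \<bar>p x - r x\<bar>)"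
proof -
  have "norm \<bar>p x - r x\<bar> \<le> 2 * M" for x using M(1)[of x] M(2)[of x] by simp
  then show ?thesis
    using assms(1,2) by (intro torus.integrable_const_bound[where B="2 * M"] AE_I2) auto
qed

text \<open>
What is used of a solution on \<open>[0, T]\<close>. Here \<open>u\<close> is the representative that is continuous in \<open>L\<^sup>1\<close>
and defined at every time, whereas \<open>w\<close> and \<open>h\<close> are Borel versions of the solution and of its damping
term, jointly in time and space. The entropy inequality is required for \<open>C\<^sup>1\<close> entropies and products
\<open>\<theta>(t) \<rho>(x)\<close> only, and is written with iterated integrals.
\<close>

locale entropy_flow =
  fixes f :: "real \<Rightarrow> real" and T M H :: real and u0 :: "real \<Rightarrow> real"
    and u :: "real \<Rightarrow> real \<Rightarrow> real" and w h :: "real \<times> real \<Rightarrow> real"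
  assumes T_pos: "0 < T"
    and u0_meas [measurable]: "u0 \<in> borel_measurable torus" and u0_le: "\<And>x. \<bar>u0 x\<bar> \<le> M"
    and u_meas: "\<And>t. 0 \<le> t \<Longrightarrow> t \<le> T \<Longrightarrow> u t \<in> borel_measurable torus"
    and u_le: "\<And>t x. 0 \<le> t \<Longrightarrow> t \<le> T \<Longrightarrow> \<bar>u t x\<bar> \<le> M"
    and w_borel: "w \<in> borel_measurable borel" and w_le: "\<And>p. \<bar>w p\<bar> \<le> M"
    and h_borel: "h \<in> borel_measurable borel" and h_le: "\<And>p. \<bar>h p\<bar> \<le> H"
    and w_eq: "AE t in timespan T. AE x in torus. u t x = w (t, x)"
    and u_cont: "\<And>t. 0 \<le> t \<Longrightarrow> t \<le> T \<Longrightarrow>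
      ((\<lambda>s. \<integral>x. \<bar>u s x - u t x\<bar> \<partial>torus) \<longlongrightarrow> 0) (at t within {0..T})"
    and entropy: "\<And>\<eta> \<eta>' q \<rho> \<rho>' \<theta> \<theta>'.
      C1_entropy f \<eta> \<eta>' q \<Longrightarrow> C1_weight \<rho> \<rho>' \<Longrightarrow>
      (\<And>t. (\<theta> has_real_derivative \<theta>' t) (at t)) \<Longrightarrow> continuous_on UNIV \<theta>' \<Longrightarrow>
      (\<And>t. 0 \<le> \<theta> t) \<Longrightarrow> \<theta> T = 0 \<Longrightarrow>
      0 \<le> (\<integral>t. \<theta>' t * (\<integral>x. \<rho> x * \<eta> (w (t, x)) \<partial>torus)
            + \<theta> t * (\<integral>x. \<rho>' x * q (w (t, x)) - \<rho> x * \<eta>' (w (t, x)) * h (t, x) \<partial>torus) \<partial>timespan T)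
          + \<theta> 0 * (\<integral>x. \<rho> x * \<eta> (u0 x) \<partial>torus)"

lemma ident_timespan_torus: "(\<lambda>p. p) \<in> timespan T \<Otimes>\<^sub>M torus \<rightarrow>\<^sub>M borel"
proof -
  have "(\<lambda>p. (fst p, snd p)) \<in> timespan T \<Otimes>\<^sub>M torus \<rightarrow>\<^sub>M borel \<Otimes>\<^sub>M borel"
    by (intro measurable_Pair measurable_compose[OF measurable_fst ident_timespan]
        measurable_compose[OF measurable_snd ident_torus])
  then show ?thesis by (simp add: borel_prod)
qed

context entropy_flow
begin

lemma M_nonneg: "0 \<le> M" using u0_le[of 0] by linarith

lemma w_meas [measurable]: "w \<in> borel_measurable (timespan T' \<Otimes>\<^sub>M torus)"
  using measurable_compose[OF ident_timespan_torus w_borel] by simp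

lemma h_meas [measurable]: "h \<in> borel_measurable (timespan T' \<Otimes>\<^sub>M torus)"
  using measurable_compose[OF ident_timespan_torus h_borel] by simp

definition mass :: "(real \<Rightarrow> real) \<Rightarrow> (real \<Rightarrow> real) \<Rightarrow> real \<Rightarrow> real" where
  "mass \<eta> \<rho> t = (\<integral>x. \<rho> x * \<eta> (u t x) \<partial>torus)"

definition rate :: "(real \<Rightarrow> real) \<Rightarrow> (real \<Rightarrow> real) \<Rightarrow> (real \<Rightarrow> real) \<Rightarrow> (real \<Rightarrow> real) \<Rightarrow> real \<Rightarrow> real" where
  "rate \<eta>' q \<rho> \<rho>' t = (\<integral>x. \<rho>' x * q (w (t, x)) - \<rho> x * \<eta>' (w (t, x)) * h (t, x) \<partial>torus)"

lemma mass_continuous: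
  assumes E: "C1_entropy f \<eta> \<eta>' q" and W: "C1_weight \<rho> \<rho>'" and s: "0 \<le> s" "s \<le> T"
  shows "(mass \<eta> \<rho> \<longlongrightarrow> mass \<eta> \<rho> s) (at s within {0..T})"
proof -
  obtain R where R: "\<And>x. \<bar>\<rho> x\<bar> \<le> R" "0 \<le> R" using C1_weight_bounded[OF W] by metis
  obtain B where B: "0 \<le> B" "\<And>r. \<bar>r\<bar> \<le> M \<Longrightarrow> \<bar>\<eta> r\<bar> \<le> B"
    using bounded_on_symmetric_interval[OF C1_entropy_continuous(1)[OF E]] by metis
  have [measurable]: "\<rho> \<in> borel_measurable torus" "\<eta> \<in> borel_measurable borel"
    by (intro borel_measurable_torus borel_measurable_continuous_onI
        C1_weight_continuous[OF W] C1_entropy_continuous[OF E])+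
  have int: "integrable torus (\<lambda>x. \<rho> x * \<eta> (u t x))" if t: "0 \<le> t" "t \<le> T" for t
  proof (rule torus.integrable_const_bound[where B="R * B"])
    have [measurable]: "u t \<in> borel_measurable torus" by (rule u_meas[OF t])
    show "(\<lambda>x. \<rho> x * \<eta> (u t x)) \<in> borel_measurable torus" by measurable
  qed (auto simp: abs_mult intro!: mult_mono R B u_le t)
  have intu: "integrable torus (\<lambda>x. \<bar>u t x - u s x\<bar>)" if t: "0 \<le> t" "t \<le> T" for t
    by (rule integrable_abs_diff_torus[OF u_meas[OF t] u_meas[OF s] u_le[OF t] u_le[OF s]])
  show ?thesis
  proof (rule Lim_null_comparison[where g="\<lambda>t. R * (\<integral>x. \<bar>u t x - u s x\<bar> \<partial>torus)", THEN Lim_null[THEN iffD2]])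
    show "\<forall>\<^sub>F t in at s within {0..T}. norm (mass \<eta> \<rho> t - mass \<eta> \<rho> s) \<le> R * (\<integral>x. \<bar>u t x - u s x\<bar> \<partial>torus)"
      unfolding eventually_at_filter
    proof (rule always_eventually, intro allI impI)
      fix t assume "t \<in> {0..T}"
      then have t: "0 \<le> t" "t \<le> T" by auto
      have "norm (mass \<eta> \<rho> t - mass \<eta> \<rho> s) = norm (\<integral>x. \<rho> x * \<eta> (u t x) - \<rho> x * \<eta> (u s x) \<partial>torus)"
        unfolding mass_def using int[OF t] int[OF s] by simp
      also have "\<dots> \<le> (\<integral>x. norm (\<rho> x * \<eta> (u t x) - \<rho> x * \<eta> (u s x)) \<partial>torus)"
        by (rule integral_norm_bound)
      also have "\<dots> \<le> (\<integral>x. R * \<bar>u t x - u s x\<bar> \<partial>torus)"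
      proof (rule Bochner_Integration.integral_mono)
        fix x
        have "norm (\<rho> x * \<eta> (u t x) - \<rho> x * \<eta> (u s x)) = \<bar>\<rho> x\<bar> * \<bar>\<eta> (u t x) - \<eta> (u s x)\<bar>"
          by (simp add: abs_mult flip: right_diff_distrib)
        also have "\<dots> \<le> R * \<bar>u t x - u s x\<bar>"
          by (intro mult_mono R C1_entropy_lipschitz[OF E]) (auto simp: R)
        finally show "norm (\<rho> x * \<eta> (u t x) - \<rho> x * \<eta> (u s x)) \<le> R * \<bar>u t x - u s x\<bar>" .
      qed (use int[OF t] int[OF s] intu[OF t] in auto)
      finally show "norm (mass \<eta> \<rho> t - mass \<eta> \<rho> s) \<le> R * (\<integral>x. \<bar>u t x - u s x\<bar> \<partial>torus)"
        by simp
    qed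
    show "((\<lambda>t. R * (\<integral>x. \<bar>u t x - u s x\<bar> \<partial>torus)) \<longlongrightarrow> 0) (at s within {0..T})"
      by (rule tendsto_mult_right_zero) (rule u_cont[OF s])
  qed
qed

lemma mass_AE:
  assumes E: "C1_entropy f \<eta> \<eta>' q" and W: "C1_weight \<rho> \<rho>'"
  shows "AE t in timespan T. mass \<eta> \<rho> t = (\<integral>x. \<rho> x * \<eta> (w (t, x)) \<partial>torus)"
  using w_eq AE_space
proof eventually_elim
  fix t assume ae: "AE x in torus. u t x = w (t, x)" and "t \<in> space (timespan T)"
  then have t: "t \<in> space (timespan T)" and [measurable]: "u t \<in> borel_measurable torus"
    using u_meas by auto
  have [measurable]: "\<rho> \<in> borel_measurable torus" "\<eta> \<in> borel_measurable borel"
    by (intro borel_measurable_torus borel_measurable_continuous_onI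
        C1_weight_continuous[OF W] C1_entropy_continuous[OF E])+
  have [measurable]: "(\<lambda>x. w (t, x)) \<in> borel_measurable torus"
    using t by (rule measurable_compose[OF measurable_Pair1' w_meas])
  show "mass \<eta> \<rho> t = (\<integral>x. \<rho> x * \<eta> (w (t, x)) \<partial>torus)"
    unfolding mass_def by (rule integral_cong_AE) (use ae in auto)
qed

text \<open>
The mean of \<open>mass\<close> over \<open>[s, s + \<kappa>]\<close> with the density \<open>ramp'\<close> is close to the value at \<open>s\<close>. The
integrand uses \<open>w\<close>, which agrees with \<open>u\<close> at almost every time.
\<close>

lemma time_average:
  assumes E: "C1_entropy f \<eta> \<eta>' q" and W: "C1_weight \<rho> \<rho>'"
    and s: "0 \<le> s" "s + \<kappa> \<le> T" "0 < \<kappa>"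
    and e: "\<And>t. s \<le> t \<Longrightarrow> t \<le> s + \<kappa> \<Longrightarrow> \<bar>mass \<eta> \<rho> t - mass \<eta> \<rho> s\<bar> \<le> e"
  shows "integrable (timespan T) (\<lambda>t. ramp' \<kappa> (t - s) * (\<integral>x. \<rho> x * \<eta> (w (t, x)) \<partial>torus))"
    and "\<bar>(\<integral>t. ramp' \<kappa> (t - s) * (\<integral>x. \<rho> x * \<eta> (w (t, x)) \<partial>torus) \<partial>timespan T) - mass \<eta> \<rho> s\<bar> \<le> e"
proof -
  let ?W = "\<lambda>t. \<integral>x. \<rho> x * \<eta> (w (t, x)) \<partial>torus" and ?r = "\<lambda>t. ramp' \<kappa> (t - s)"
  have rc: "continuous_on UNIV ?r" by (intro continuous_intros)
  have ri: "integrable (timespan T) ?r" by (rule integrable_timespan_continuous[OF rc])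
  have rd: "((\<lambda>t. ramp \<kappa> (t - s)) has_real_derivative ramp' \<kappa> (t - s)) (at t)" for t
    by (rule DERIV_chain2[OF DERIV_ramp[OF s(3)], THEN DERIV_cong]) (auto intro!: derivative_eq_intros)
  have r1: "(\<integral>t. ?r t \<partial>timespan T) = 1"
    using integral_timespan_antiderivative[OF _ rd rc] s by (simp add: ramp_ge ramp_nonpos)
  have [measurable]: "\<rho> \<in> borel_measurable torus" "\<eta> \<in> borel_measurable borel"
    by (intro borel_measurable_torus borel_measurable_continuous_onI
        C1_weight_continuous[OF W] C1_entropy_continuous[OF E])+
  have Wm: "?W \<in> borel_measurable (timespan T)" by measurable
  have rm: "?r \<in> borel_measurable (timespan T)" using ri by (rule borel_measurable_integrable)
  have ae: "AE t in timespan T. \<bar>?r t * ?W t - ?r t * mass \<eta> \<rho> s\<bar> \<le> ?r t * e"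
    using mass_AE[OF E W]
  proof eventually_elim
    fix t assume t: "mass \<eta> \<rho> t = ?W t"
    show "\<bar>?r t * ?W t - ?r t * mass \<eta> \<rho> s\<bar> \<le> ?r t * e"
    proof (cases "t - s \<in> {0..\<kappa>}")
      case True
      then have "\<bar>?W t - mass \<eta> \<rho> s\<bar> \<le> e" using e[of t] t by auto
      then have "?r t * \<bar>?W t - mass \<eta> \<rho> s\<bar> \<le> ?r t * e"
        by (intro mult_left_mono ramp'_nonneg s)
      moreover have "?r t * ?W t - ?r t * mass \<eta> \<rho> s = ?r t * (?W t - mass \<eta> \<rho> s)"
        by (simp add: right_diff_distrib)
      moreover have "\<bar>?r t\<bar> = ?r t" by (intro abs_of_nonneg ramp'_nonneg s)
      ultimately show ?thesis by (simp only: abs_mult)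
    next
      case False
      then show ?thesis using ramp'_outside[OF s(3) False] by simp
    qed
  qed
  have i2: "integrable (timespan T) (\<lambda>t. ?r t * ?W t - ?r t * mass \<eta> \<rho> s)"
  proof (rule Bochner_Integration.integrable_bound[of _ "\<lambda>t. ?r t * e"])
    show "integrable (timespan T) (\<lambda>t. ?r t * e)" using ri by simp
    show "AE t in timespan T. norm (?r t * ?W t - ?r t * mass \<eta> \<rho> s) \<le> norm (?r t * e)"
      using ae by eventually_elim auto
  qed (use Wm rm in simp)
  have "integrable (timespan T) (\<lambda>t. (?r t * ?W t - ?r t * mass \<eta> \<rho> s) + ?r t * mass \<eta> \<rho> s)"
    by (intro Bochner_Integration.integrable_add i2) (use ri in simp)
  then show i: "integrable (timespan T) (\<lambda>t. ?r t * ?W t)" by simp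
  have "(\<integral>t. ?r t * ?W t \<partial>timespan T) - mass \<eta> \<rho> s
      = (\<integral>t. ?r t * ?W t - ?r t * mass \<eta> \<rho> s \<partial>timespan T)"
    using i ri r1 by simp
  moreover have "\<bar>\<integral>t. ?r t * ?W t - ?r t * mass \<eta> \<rho> s \<partial>timespan T\<bar>
      \<le> (\<integral>t. \<bar>?r t * ?W t - ?r t * mass \<eta> \<rho> s\<bar> \<partial>timespan T)"
    by (rule integral_abs_bound)
  moreover have "(\<integral>t. \<bar>?r t * ?W t - ?r t * mass \<eta> \<rho> s\<bar> \<partial>timespan T)
      \<le> (\<integral>t. ?r t * e \<partial>timespan T)"
    by (rule integral_mono_AE[OF _ _ ae]) (use i2 ri in simp_all)
  moreover have "(\<integral>t. ?r t * e \<partial>timespan T) = e" using r1 by simp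
  ultimately show "\<bar>(\<integral>t. ?r t * ?W t \<partial>timespan T) - mass \<eta> \<rho> s\<bar> \<le> e" by linarith
qed

lemma rate_bounded:
  assumes E: "C1_entropy f \<eta> \<eta>' q" and W: "C1_weight \<rho> \<rho>'"
  obtains B where "0 \<le> B" "\<And>t. \<bar>rate \<eta>' q \<rho> \<rho>' t\<bar> \<le> B"
proof -
  obtain R where R: "\<And>x. \<bar>\<rho> x\<bar> \<le> R" "\<And>x. \<bar>\<rho>' x\<bar> \<le> R" "0 \<le> R" using C1_weight_bounded[OF W] by metis
  obtain B where B: "0 \<le> B" "\<And>r. \<bar>r\<bar> \<le> M \<Longrightarrow> \<bar>q r\<bar> \<le> B"
    using bounded_on_symmetric_interval[OF C1_entropy_continuous(3)[OF E]] by metis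
  have H0: "0 \<le> H" using h_le[of "(0,0)"] by linarith
  have b: "\<bar>\<rho>' x * q (w (t, x)) - \<rho> x * \<eta>' (w (t, x)) * h (t, x)\<bar> \<le> R * B + R * 1 * H" for t x
  proof -
    have "\<bar>\<rho>' x * q (w (t, x))\<bar> \<le> R * B"
      unfolding abs_mult by (intro mult_mono R B w_le) (auto simp: R)
    moreover have "\<bar>\<rho> x * \<eta>' (w (t, x)) * h (t, x)\<bar> \<le> R * 1 * H"
      unfolding abs_mult using E R H0 by (intro mult_mono h_le) (auto simp: C1_entropy_def)
    ultimately show ?thesis by linarith
  qed
  have "\<bar>rate \<eta>' q \<rho> \<rho>' t\<bar> \<le> (\<integral>x. R * B + R * 1 * H \<partial>torus)" for t
  proof -
    have "\<bar>rate \<eta>' q \<rho> \<rho>' t\<bar>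
        \<le> (\<integral>x. norm (\<rho>' x * q (w (t, x)) - \<rho> x * \<eta>' (w (t, x)) * h (t, x)) \<partial>torus)"
      unfolding rate_def real_norm_def[symmetric] by (rule integral_norm_bound)
    also have "\<dots> \<le> (\<integral>x. R * B + R * 1 * H \<partial>torus)"
    proof (rule integral_mono')
      show "norm (\<rho>' x * q (w (t, x)) - \<rho> x * \<eta>' (w (t, x)) * h (t, x)) \<le> R * B + R * 1 * H" for x
        using b[of x t] by simp
      show "0 \<le> R * B + R * 1 * H" using R(3) B(1) H0 by simp
    qed simp
    finally show ?thesis .
  qed
  then show ?thesis using that[of "R * B + R * 1 * H"] R B H0 by simp
qed

lemma rate_measurable:
  assumes E: "C1_entropy f \<eta> \<eta>' q" and W: "C1_weight \<rho> \<rho>'"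
  shows "rate \<eta>' q \<rho> \<rho>' \<in> borel_measurable (timespan T)"
proof -
  have "continuous_on UNIV \<rho>'" using W by (simp add: C1_weight_def)
  then have [measurable]: "\<rho> \<in> borel_measurable torus" "\<rho>' \<in> borel_measurable torus"
      "\<eta>' \<in> borel_measurable borel" "q \<in> borel_measurable borel"
    by (intro borel_measurable_torus borel_measurable_continuous_onI
        C1_weight_continuous[OF W] C1_entropy_continuous[OF E]; assumption)+
  show ?thesis unfolding rate_def[abs_def] by measurable
qed

lemma mass_close:
  assumes E: "C1_entropy f \<eta> \<eta>' q" and W: "C1_weight \<rho> \<rho>'" and s: "0 \<le> s" "s < T" and "0 < e"
  obtains \<kappa> where "0 < \<kappa>" "s + \<kappa> \<le> T"
    "\<And>t. s \<le> t \<Longrightarrow> t \<le> s + \<kappa> \<Longrightarrow> \<bar>mass \<eta> \<rho> t - mass \<eta> \<rho> s\<bar> \<le> e"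
proof -
  have "\<forall>\<^sub>F t in at s within {0..T}. dist (mass \<eta> \<rho> t) (mass \<eta> \<rho> s) < e"
    using mass_continuous[OF E W, of s] s \<open>0 < e\<close> by (intro tendstoD) auto
  then obtain d where d: "0 < d"
    "\<And>t. t \<in> {0..T} \<Longrightarrow> t \<noteq> s \<Longrightarrow> dist t s < d \<Longrightarrow> dist (mass \<eta> \<rho> t) (mass \<eta> \<rho> s) < e"
    unfolding eventually_at by blast
  show ?thesis
  proof (rule that[of "min (d / 2) (T - s)"])
    fix t assume t: "s \<le> t" "t \<le> s + min (d / 2) (T - s)"
    show "\<bar>mass \<eta> \<rho> t - mass \<eta> \<rho> s\<bar> \<le> e"
    proof (cases "t = s")
      case False
      have "t \<le> T" "t - s < d" using t(2) d(1) by linarith+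
      then show ?thesis using d(2)[of t] t(1) s False by (simp add: dist_real_def)
    qed (use \<open>0 < e\<close> in simp)
  qed (use d s in auto)
qed

lemma rate_integrable:
  assumes E: "C1_entropy f \<eta> \<eta>' q" and W: "C1_weight \<rho> \<rho>'"
    and m: "m \<in> borel_measurable (timespan T)" and m1: "\<And>t. \<bar>m t\<bar> \<le> 1"
  shows "integrable (timespan T) (\<lambda>t. m t * rate \<eta>' q \<rho> \<rho>' t)"
proof -
  obtain B where B: "0 \<le> B" "\<And>t. \<bar>rate \<eta>' q \<rho> \<rho>' t\<bar> \<le> B"
    using rate_bounded[OF E W] by metis
  have "norm (m t * rate \<eta>' q \<rho> \<rho>' t) \<le> 1 * B" for t
    unfolding real_norm_def abs_mult by (intro mult_mono m1 B(2)) auto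
  then show ?thesis
    by (intro timespan.integrable_const_bound[where B="1 * B"] AE_I2 borel_measurable_times m
        rate_measurable[OF E W])
qed

text \<open>
The entropy inequality for a test function in time that has a free left part \<open>\<phi>\<close> and falls to 0 right
after \<open>t2\<close>. The falling part averages \<open>mass\<close> near \<open>t2\<close>, and the test function differs from the indicator
of \<open>[t1, t2]\<close> at most on two intervals of length \<open>\<kappa>\<close>.
\<close>

lemma entropy_step:
  assumes E: "C1_entropy f \<eta> \<eta>' q" and W: "C1_weight \<rho> \<rho>'"
    and t: "0 \<le> t1" "t1 \<le> t2" "t2 + \<kappa> \<le> T" "0 < \<kappa>"
    and close: "\<And>t. t2 \<le> t \<Longrightarrow> t \<le> t2 + \<kappa> \<Longrightarrow> \<bar>mass \<eta> \<rho> t - mass \<eta> \<rho> t2\<bar> \<le> e"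
    and B: "\<And>t. \<bar>rate \<eta>' q \<rho> \<rho>' t\<bar> \<le> B"
    and \<phi>: "\<And>t. (\<phi> has_real_derivative \<phi>' t) (at t)" "continuous_on UNIV \<phi>'"
      "\<And>t. ramp \<kappa> (t - t2) \<le> \<phi> t" "\<And>t. \<phi> t \<le> 1"
    and \<phi>_step: "\<And>t. 0 \<le> t \<Longrightarrow> \<bar>\<phi> t - indicator {t1..} t\<bar> \<le> indicator {t1..t1+\<kappa>} t"
    and \<phi>_int: "integrable (timespan T) (\<lambda>t. \<phi>' t * (\<integral>x. \<rho> x * \<eta> (w (t, x)) \<partial>torus))"
  shows "mass \<eta> \<rho> t2
    \<le> (\<integral>t. \<phi>' t * (\<integral>x. \<rho> x * \<eta> (w (t, x)) \<partial>torus) \<partial>timespan T)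
      + \<phi> 0 * (\<integral>x. \<rho> x * \<eta> (u0 x) \<partial>torus)
      + (\<integral>t. indicator {t1..t2} t * rate \<eta>' q \<rho> \<rho>' t \<partial>timespan T) + (e + 2 * (B * \<kappa>))"
proof -
  let ?W = "\<lambda>t. \<integral>x. \<rho> x * \<eta> (w (t, x)) \<partial>torus" and ?P = "rate \<eta>' q \<rho> \<rho>'"
  let ?r = "\<lambda>t. ramp' \<kappa> (t - t2)" and ?i = "\<lambda>s t. indicator {s..s+\<kappa>} t :: real"
  define \<theta> where "\<theta> t = \<phi> t - ramp \<kappa> (t - t2)" for t
  have B0: "0 \<le> B" using B[of 0] by linarith
  have t2: "0 \<le> t2" using t by simp
  note a = time_average[OF E W t2 t(3,4) close]
  have \<theta>d: "(\<theta> has_real_derivative \<phi>' t - ?r t) (at t)" for t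
    unfolding \<theta>_def[abs_def]
    by (intro DERIV_diff \<phi>(1) DERIV_chain2[OF DERIV_ramp[OF t(4)], THEN DERIV_cong])
       (auto intro!: derivative_eq_intros)
  have \<theta>c: "continuous_on UNIV (\<lambda>t. \<phi>' t - ?r t)" by (intro continuous_intros \<phi>(2))
  have \<theta>c0: "continuous_on UNIV \<theta>"
    by (rule DERIV_continuous_on[OF has_field_derivative_at_within[OF \<theta>d]])
  have \<theta>0: "0 \<le> \<theta> t" for t unfolding \<theta>_def using \<phi>(3)[of t] by simp
  have \<theta>1: "\<bar>\<theta> t\<bar> \<le> 1" for t
    using \<theta>0[of t] \<phi>(4)[of t] ramp_bounds(1)[OF t(4), of "t - t2"] by (simp add: \<theta>_def)
  have "\<phi> T = 1" using \<phi>(3)[of T] \<phi>(4)[of T] t by (simp add: ramp_ge)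
  then have \<theta>T: "\<theta> T = 0" using t by (simp add: \<theta>_def ramp_ge)
  have \<theta>00: "\<theta> 0 = \<phi> 0" unfolding \<theta>_def using t by (simp add: ramp_nonpos)
  have \<theta>P: "integrable (timespan T) (\<lambda>t. \<theta> t * ?P t)"
    by (intro rate_integrable[OF E W] \<theta>1 borel_measurable_timespan borel_measurable_continuous_onI \<theta>c0)
  have "0 \<le> (\<integral>t. (\<phi>' t - ?r t) * ?W t + \<theta> t * ?P t \<partial>timespan T) + \<phi> 0 * (\<integral>x. \<rho> x * \<eta> (u0 x) \<partial>torus)"
    using entropy[OF E W \<theta>d \<theta>c \<theta>0 \<theta>T] by (simp add: \<theta>00 rate_def)
  also have "(\<lambda>t. (\<phi>' t - ?r t) * ?W t + \<theta> t * ?P t) = (\<lambda>t. (\<phi>' t * ?W t - ?r t * ?W t) + \<theta> t * ?P t)"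
    by (simp add: left_diff_distrib)
  also have "(\<integral>t. (\<phi>' t * ?W t - ?r t * ?W t) + \<theta> t * ?P t \<partial>timespan T)
     = ((\<integral>t. \<phi>' t * ?W t \<partial>timespan T) - (\<integral>t. ?r t * ?W t \<partial>timespan T)) + (\<integral>t. \<theta> t * ?P t \<partial>timespan T)"
    using a(1) \<phi>_int \<theta>P by simp
  finally have 1: "mass \<eta> \<rho> t2 \<le> (\<integral>t. \<phi>' t * ?W t \<partial>timespan T) + \<phi> 0 * (\<integral>x. \<rho> x * \<eta> (u0 x) \<partial>torus)
      + e + (\<integral>t. \<theta> t * ?P t \<partial>timespan T)"
    using a(2) by linarith
  have ind: "integrable (timespan T) (?i t1)" "integrable (timespan T) (?i t2)"
    "(\<integral>t. ?i t1 t \<partial>timespan T) = \<kappa>" "(\<integral>t. ?i t2 t \<partial>timespan T) = \<kappa>"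
    using integral_timespan_Icc[of t1 "t1 + \<kappa>" T] integral_timespan_Icc[of t2 "t2 + \<kappa>" T] t by auto
  have iP: "integrable (timespan T) (\<lambda>t. indicator {t1..t2} t * ?P t)"
    by (intro rate_integrable[OF E W] borel_measurable_timespan borel_measurable_indicator)
       (auto simp: indicator_def)
  have step: "\<bar>ramp \<kappa> (t - t2) - indicator {t2..} t\<bar> \<le> ?i t2 t" for t
    by (rule ramp_step[OF t(4)])
  have "(\<integral>t. \<theta> t * ?P t \<partial>timespan T) \<le> (\<integral>t. indicator {t1..t2} t * ?P t + B * (?i t1 t + ?i t2 t) \<partial>timespan T)"
  proof (rule integral_mono_AE)
    \<comment> \<open>At \<open>t2\<close> itself the closed interval is not the difference of the two half-lines.\<close>
    have "AE t in timespan T. t \<noteq> t2" by (rule AE_timespan_neq)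
    then show "AE t in timespan T. \<theta> t * ?P t \<le> indicator {t1..t2} t * ?P t + B * (?i t1 t + ?i t2 t)"
      using AE_space
    proof eventually_elim
      fix s assume ne: "s \<noteq> t2" and "s \<in> space (timespan T)"
      then have s: "0 \<le> s" by simp
      have i: "indicator {t1..t2} s = (indicator {t1..} s - indicator {t2..} s :: real)"
        using t(2) ne by (auto simp: indicator_def)
      have "\<bar>\<theta> s - indicator {t1..t2} s\<bar> \<le> ?i t1 s + ?i t2 s"
        unfolding \<theta>_def i using step[of s] \<phi>_step[OF s] by linarith
      then have "\<bar>?P s\<bar> * \<bar>\<theta> s - indicator {t1..t2} s\<bar> \<le> B * (?i t1 s + ?i t2 s)"
        by (intro mult_mono B) (auto simp: B0)
      then have "\<bar>?P s * (\<theta> s - indicator {t1..t2} s)\<bar> \<le> B * (?i t1 s + ?i t2 s)"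
        by (simp only: abs_mult)
      then show "\<theta> s * ?P s \<le> indicator {t1..t2} s * ?P s + B * (?i t1 s + ?i t2 s)"
        by (simp add: algebra_simps abs_le_iff)
    qed
  qed (use \<theta>P iP ind in auto)
  also have "\<dots> = (\<integral>t. indicator {t1..t2} t * ?P t \<partial>timespan T) + B * (\<kappa> + \<kappa>)"
    using iP ind by simp
  finally show ?thesis using 1 by (simp add: distrib_left)
qed

text \<open>
Let the test function rise from 0 to 1 right after \<open>t1\<close>. The initial datum is then invisible, and the
rising part averages \<open>mass\<close> near \<open>t1\<close>.
\<close>

theorem entropy_increment:
  assumes E: "C1_entropy f \<eta> \<eta>' q" and W: "C1_weight \<rho> \<rho>'"
    and t: "0 \<le> t1" "t1 \<le> t2" "t2 < T"
  shows "mass \<eta> \<rho> t2 - mass \<eta> \<rho> t1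
    \<le> (\<integral>t. indicator {t1..t2} t * rate \<eta>' q \<rho> \<rho>' t \<partial>timespan T)"
proof (rule field_le_epsilon)
  fix e :: real assume e: "0 < e"
  obtain B where B: "0 \<le> B" "\<And>t. \<bar>rate \<eta>' q \<rho> \<rho>' t\<bar> \<le> B"
    using rate_bounded[OF E W] by metis
  have e4: "0 < e / 4" using e by simp
  obtain k1 where k1: "0 < k1" "t1 + k1 \<le> T"
    "\<And>t. t1 \<le> t \<Longrightarrow> t \<le> t1 + k1 \<Longrightarrow> \<bar>mass \<eta> \<rho> t - mass \<eta> \<rho> t1\<bar> \<le> e / 4"
    using mass_close[OF E W t(1) le_less_trans[OF t(2,3)] e4] by blast
  obtain k2 where k2: "0 < k2" "t2 + k2 \<le> T"
    "\<And>t. t2 \<le> t \<Longrightarrow> t \<le> t2 + k2 \<Longrightarrow> \<bar>mass \<eta> \<rho> t - mass \<eta> \<rho> t2\<bar> \<le> e / 4"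
    using mass_close[OF E W order_trans[OF t(1,2)] t(3) e4] by blast
  \<comment> \<open>The last entry makes the contribution of the two ramps to the rate, \<open>2 B \<kappa>\<close>, at most \<open>e / 2\<close>.\<close>
  define \<kappa> where "\<kappa> = Min {k1, k2, e / (4 * (B + 1))}"
  have \<kappa>: "0 < \<kappa>" "\<kappa> \<le> k1" "\<kappa> \<le> k2" "\<kappa> \<le> e / (4 * (B + 1))"
    using k1(1) k2(1) e B(1) by (auto simp: \<kappa>_def)
  have T1: "t1 + \<kappa> \<le> T" and T2: "t2 + \<kappa> \<le> T" using k1(2) k2(2) \<kappa> by linarith+
  have c1: "\<And>t. t1 \<le> t \<Longrightarrow> t \<le> t1 + \<kappa> \<Longrightarrow> \<bar>mass \<eta> \<rho> t - mass \<eta> \<rho> t1\<bar> \<le> e / 4"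
    using k1(3) \<kappa>(2) by (meson add_left_mono order_trans)
  have c2: "\<And>t. t2 \<le> t \<Longrightarrow> t \<le> t2 + \<kappa> \<Longrightarrow> \<bar>mass \<eta> \<rho> t - mass \<eta> \<rho> t2\<bar> \<le> e / 4"
    using k2(3) \<kappa>(3) by (meson add_left_mono order_trans)
  note a = time_average[OF E W t(1) T1 \<kappa>(1) c1]
  have d: "((\<lambda>t. ramp \<kappa> (t - t1)) has_real_derivative ramp' \<kappa> (t - t1)) (at t)" for t
    by (rule DERIV_chain2[OF DERIV_ramp[OF \<kappa>(1)], THEN DERIV_cong]) (auto intro!: derivative_eq_intros)
  have c: "continuous_on UNIV (\<lambda>t. ramp' \<kappa> (t - t1))" by (intro continuous_intros)
  have le: "ramp \<kappa> (s - t2) \<le> ramp \<kappa> (s - t1)" "ramp \<kappa> (s - t1) \<le> 1" for s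
    using ramp_mono[OF \<kappa>(1), of "s - t2" "s - t1"] ramp_bounds(2)[OF \<kappa>(1)] t(2) by auto
  have "ramp \<kappa> (0 - t1) = 0" using t \<kappa>(1) by (simp add: ramp_nonpos)
  then have "mass \<eta> \<rho> t2
      \<le> (\<integral>t. ramp' \<kappa> (t - t1) * (\<integral>x. \<rho> x * \<eta> (w (t, x)) \<partial>torus) \<partial>timespan T)
        + (\<integral>t. indicator {t1..t2} t * rate \<eta>' q \<rho> \<rho>' t \<partial>timespan T) + (e / 4 + 2 * (B * \<kappa>))"
    using entropy_step[OF E W t(1,2) T2 \<kappa>(1) c2 B(2) d c le ramp_step[OF \<kappa>(1)] a(1)] by simp
  moreover have "B * \<kappa> \<le> (B + 1) * (e / (4 * (B + 1)))"
    using B(1) \<kappa> by (intro mult_mono) auto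
  moreover have "(B + 1) * (e / (4 * (B + 1))) = e / 4" using B(1) by (simp add: field_simps)
  ultimately show "mass \<eta> \<rho> t2 - mass \<eta> \<rho> t1
      \<le> (\<integral>t. indicator {t1..t2} t * rate \<eta>' q \<rho> \<rho>' t \<partial>timespan T) + e"
    using a(2) by linarith
qed

text \<open>
Here the test function is 1 at time 0 and falls to 0 by time \<open>\<kappa>\<close>, so that the initial datum is seen.
This compares \<open>u 0\<close> with \<open>u0\<close> in the form in which they are used, entropy by entropy.
\<close>

theorem entropy_initial:
  assumes E: "C1_entropy f \<eta> \<eta>' q" and W: "C1_weight \<rho> \<rho>'"
  shows "mass \<eta> \<rho> 0 \<le> (\<integral>x. \<rho> x * \<eta> (u0 x) \<partial>torus)"
proof (rule field_le_epsilon)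
  fix e :: real assume e: "0 < e"
  obtain B where B: "0 \<le> B" "\<And>t. \<bar>rate \<eta>' q \<rho> \<rho>' t\<bar> \<le> B"
    using rate_bounded[OF E W] by metis
  have e2: "0 < e / 2" using e by simp
  obtain k where k: "0 < k" "0 + k \<le> T"
    "\<And>t. 0 \<le> t \<Longrightarrow> t \<le> 0 + k \<Longrightarrow> \<bar>mass \<eta> \<rho> t - mass \<eta> \<rho> 0\<bar> \<le> e / 2"
    using mass_close[OF E W order_refl T_pos e2] by blast
  define \<kappa> where "\<kappa> = Min {k, e / (4 * (B + 1))}"
  have \<kappa>: "0 < \<kappa>" "\<kappa> \<le> k" "\<kappa> \<le> e / (4 * (B + 1))"
    using k(1) e B(1) by (auto simp: \<kappa>_def)
  have T1: "0 + \<kappa> \<le> T" using k(2) \<kappa> by linarith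
  have c: "\<And>t. 0 \<le> t \<Longrightarrow> t \<le> 0 + \<kappa> \<Longrightarrow> \<bar>mass \<eta> \<rho> t - mass \<eta> \<rho> 0\<bar> \<le> e / 2"
    using k(3) \<kappa>(2) by (meson add_left_mono order_trans)
  have "(\<integral>t. indicator {0..0} t * rate \<eta>' q \<rho> \<rho>' t \<partial>timespan T) = 0"
    by (rule integral_eq_zero_AE) (use AE_timespan_neq[of 0 T] in \<open>auto elim: eventually_mono\<close>)
  then have "mass \<eta> \<rho> 0 \<le> (\<integral>x. \<rho> x * \<eta> (u0 x) \<partial>torus) + (e / 2 + 2 * (B * \<kappa>))"
    using entropy_step[OF E W order_refl order_refl T1 \<kappa>(1) c B(2), of "\<lambda>_. 1" "\<lambda>_. 0"] ramp_bounds(2)[OF \<kappa>(1)]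
    by (simp add: indicator_def)
  moreover have "B * \<kappa> \<le> (B + 1) * (e / (4 * (B + 1)))"
    using B(1) \<kappa> by (intro mult_mono) auto
  moreover have "(B + 1) * (e / (4 * (B + 1))) = e / 4" using B(1) by (simp add: field_simps)
  ultimately show "mass \<eta> \<rho> 0 \<le> (\<integral>x. \<rho> x * \<eta> (u0 x) \<partial>torus) + e"
    by linarith
qed

end

section \<open>Kruzhkov entropies\<close>

text \<open>
The Kruzhkov flux of the entropy \<open>(\<sigma> (r - k))\<^sup>+\<close>, with \<open>\<sigma> = 1\<close> for subsolutions and \<open>\<sigma> = -1\<close>
for supersolutions.
\<close>

definition kruzhkov_flux :: "(real \<Rightarrow> real) \<Rightarrow> real \<Rightarrow> real \<Rightarrow> real \<Rightarrow> real" where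
  "kruzhkov_flux f \<sigma> r k = (if 0 < \<sigma> * (r - k) then \<sigma> * (f r - f k) else 0)"

text \<open>
Normalise the flux by \<open>q k = 0\<close> and use the variable \<open>s = \<sigma> (r - k)\<close>. For \<open>s \<le> 0\<close> both fluxes vanish.
For \<open>s > 0\<close> their derivatives differ by \<open>f'\<close> times \<open>1 - smooth_sgn \<delta> s\<close>, which is zero for \<open>s \<ge> \<delta>\<close>.
Hence the two fluxes differ by at most \<open>L \<delta>\<close>.
\<close>

lemma kruzhkov_entropy:
  fixes f :: "real \<Rightarrow> real"
  assumes f: "\<And>z. (f has_real_derivative deriv f z) (at z)" and fc: "continuous_on UNIV (deriv f)"
    and L: "\<And>z. \<bar>z\<bar> \<le> M \<Longrightarrow> \<bar>deriv f z\<bar> \<le> L" and k: "\<bar>k\<bar> \<le> M"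
    and \<sigma>: "\<sigma> = 1 \<or> \<sigma> = -1" and \<delta>: "0 < \<delta>"
  obtains q where "C1_entropy f (\<lambda>r. smooth_pos \<delta> (\<sigma> * (r - k))) (\<lambda>r. \<sigma> * smooth_sgn \<delta> (\<sigma> * (r - k))) q"
    and "\<And>r. \<bar>r\<bar> \<le> M \<Longrightarrow> \<bar>q r - kruzhkov_flux f \<sigma> r k\<bar> \<le> L * \<delta>"
proof -
  let ?\<eta> = "\<lambda>r. smooth_pos \<delta> (\<sigma> * (r - k))" and ?\<eta>' = "\<lambda>r. \<sigma> * smooth_sgn \<delta> (\<sigma> * (r - k))"
  have ss: "\<sigma> * \<sigma> = 1" "\<bar>\<sigma>\<bar> = 1" using \<sigma> by auto
  have \<eta>c: "continuous_on UNIV ?\<eta>'" by (intro continuous_intros)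
  have \<eta>d: "(?\<eta> has_real_derivative ?\<eta>' r) (at r)" for r
    by (rule DERIV_chain2[OF DERIV_smooth_pos[OF \<delta>], THEN DERIV_cong])
       (auto intro!: derivative_eq_intros)
  have mono: "?\<eta>' r \<le> ?\<eta>' s" if "r \<le> s" for r s
    using \<sigma> that smooth_sgn_mono[OF \<delta>, of "r - k" "s - k"] smooth_sgn_mono[OF \<delta>, of "k - s" "k - r"]
    by auto
  have conv: "convex_on UNIV ?\<eta>"
    by (rule convex_on_realI[where f'="?\<eta>'"]) (use \<eta>d mono in auto)
  obtain q where q: "\<And>r. (q has_real_derivative deriv f r * ?\<eta>' r) (at r)" "q k = 0"
    using antiderivative_exists[of "\<lambda>r. deriv f r * ?\<eta>' r"] continuous_on_mult[OF fc \<eta>c] by blast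
  have E: "C1_entropy f ?\<eta> ?\<eta>' q"
    unfolding C1_entropy_def
    using conv \<eta>d \<eta>c q(1) smooth_sgn_bounds[OF \<delta>] by (auto simp: abs_mult ss)
  define Q where "Q s = q (k + \<sigma> * s)" for s
  define P where "P s = \<sigma> * (f (k + \<sigma> * s) - f k) - Q s" for s
  have aff: "((\<lambda>s. k + \<sigma> * s) has_real_derivative \<sigma>) (at s)" for s
    by (auto intro!: derivative_eq_intros)
  have Qd: "(Q has_real_derivative deriv f (k + \<sigma> * s) * smooth_sgn \<delta> s) (at s)" for s
  proof -
    have "(Q has_real_derivative (deriv f (k + \<sigma> * s) * ?\<eta>' (k + \<sigma> * s)) * \<sigma>) (at s)"
      unfolding Q_def[abs_def] by (rule DERIV_chain2[OF q(1) aff])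
    moreover have "(deriv f (k + \<sigma> * s) * ?\<eta>' (k + \<sigma> * s)) * \<sigma> = deriv f (k + \<sigma> * s) * smooth_sgn \<delta> s"
      using \<sigma> by auto
    ultimately show ?thesis by (rule DERIV_cong)
  qed
  have Pd: "(P has_real_derivative deriv f (k + \<sigma> * s) * (1 - smooth_sgn \<delta> s)) (at s)" for s
  proof -
    have "(P has_real_derivative \<sigma> * (deriv f (k + \<sigma> * s) * \<sigma> - 0) - deriv f (k + \<sigma> * s) * smooth_sgn \<delta> s) (at s)"
      unfolding P_def[abs_def]
      by (intro DERIV_diff DERIV_cmult DERIV_const Qd DERIV_chain2[OF f aff])
    moreover have "\<sigma> * (deriv f (k + \<sigma> * s) * \<sigma> - 0) - deriv f (k + \<sigma> * s) * smooth_sgn \<delta> s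
        = deriv f (k + \<sigma> * s) * (1 - smooth_sgn \<delta> s)"
      using \<sigma> by (auto simp: algebra_simps)
    ultimately show ?thesis by (rule DERIV_cong)
  qed
  have L0: "0 \<le> L" using L[OF k] by linarith
  have neg: "Q s = 0" if "s \<le> 0" for s
  proof -
    have "norm (Q s - Q 0) \<le> 0 * norm (s - 0)"
      by (rule field_differentiable_bound[OF _ has_field_derivative_at_within[OF Qd], of "{s..0}"])
         (use that smooth_sgn_nonpos[OF \<delta>] in auto)
    then show ?thesis using q(2) by (simp add: Q_def)
  qed
  have pos: "\<bar>P s\<bar> \<le> L * \<delta>" if s: "0 \<le> s" and kM: "\<bar>k + \<sigma> * s\<bar> \<le> M" for s
  proof -
    have M: "\<bar>k + \<sigma> * s'\<bar> \<le> M" if "0 \<le> s'" "s' \<le> s" for s'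
      using \<sigma> that k kM by auto
    have a: "\<bar>P s'\<bar> \<le> L * \<delta>" if s': "0 \<le> s'" "s' \<le> s" "s' \<le> \<delta>" for s'
    proof -
      have "norm (P s' - P 0) \<le> L * norm (s' - 0)"
      proof (rule field_differentiable_bound[OF _ has_field_derivative_at_within[OF Pd], of "{0..s'}"])
        fix x assume "x \<in> {0..s'}"
        then have "\<bar>deriv f (k + \<sigma> * x)\<bar> \<le> L" using L M s' by auto
        then have "\<bar>deriv f (k + \<sigma> * x)\<bar> * \<bar>1 - smooth_sgn \<delta> x\<bar> \<le> L * 1"
          using smooth_sgn_bounds[OF \<delta>, of x] by (intro mult_mono) auto
        then show "norm (deriv f (k + \<sigma> * x) * (1 - smooth_sgn \<delta> x)) \<le> L"
          by (simp add: abs_mult)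
      qed (use s' in auto)
      moreover have "P 0 = 0" using q(2) by (simp add: P_def Q_def)
      moreover have "L * s' \<le> L * \<delta>" using L0 s' by (intro mult_left_mono)
      ultimately show ?thesis using s' by simp
    qed
    show ?thesis
    proof (cases "s \<le> \<delta>")
      case False
      have "norm (P s - P \<delta>) \<le> 0 * norm (s - \<delta>)"
        by (rule field_differentiable_bound[OF _ has_field_derivative_at_within[OF Pd], of "{\<delta>..s}"])
           (use False smooth_sgn_ge[OF \<delta>] in auto)
      then show ?thesis using a[of \<delta>] False \<delta> by simp
    qed (use a s in auto)
  qed
  have "\<bar>q r - kruzhkov_flux f \<sigma> r k\<bar> \<le> L * \<delta>" if r: "\<bar>r\<bar> \<le> M" for r
  proof -
    define s where "s = \<sigma> * (r - k)"
    have rs: "r = k + \<sigma> * s" using ss by (simp add: s_def flip: mult.assoc)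
    show ?thesis
    proof (cases "0 < s")
      case True
      have "\<bar>P s\<bar> \<le> L * \<delta>" using pos[of s] True r rs by simp
      moreover have "P s = \<sigma> * (f r - f k) - q r" unfolding P_def Q_def rs[symmetric] ..
      moreover have "kruzhkov_flux f \<sigma> r k = \<sigma> * (f r - f k)"
        using True by (simp add: kruzhkov_flux_def s_def)
      ultimately show ?thesis by linarith
    next
      case False
      then have "q r = 0" using neg[of s] rs by (simp add: Q_def)
      moreover have "kruzhkov_flux f \<sigma> r k = 0"
        using False by (simp add: kruzhkov_flux_def s_def)
      ultimately show ?thesis using L0 \<delta> by simp
    qed
  qed
  then show ?thesis using that E by blast
qed

lemma kruzhkov_flux_max: "kruzhkov_flux f 1 r k = f (max r k) - f k"
  by (auto simp: kruzhkov_flux_def max_def)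

lemma kruzhkov_flux_swap: "kruzhkov_flux f (- 1) r k = kruzhkov_flux f 1 k r"
  by (auto simp: kruzhkov_flux_def)

text \<open>
For \<open>\<sigma> = 1\<close> the flux is \<open>f (max r k) - f k\<close>, for \<open>\<sigma> = -1\<close> it is \<open>f k - f (min r k)\<close>. Unlike the sign
of \<open>r - k\<close>, both are Lipschitz in \<open>k\<close>.
\<close>

lemma kruzhkov_flux_lipschitz:
  fixes f :: "real \<Rightarrow> real"
  assumes f: "\<And>z. (f has_real_derivative deriv f z) (at z)"
    and L: "\<And>z. \<bar>z\<bar> \<le> M \<Longrightarrow> \<bar>deriv f z\<bar> \<le> L"
    and \<sigma>: "\<sigma> = 1 \<or> \<sigma> = -1" and le: "\<bar>r\<bar> \<le> M" "\<bar>k\<bar> \<le> M" "\<bar>k'\<bar> \<le> M"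
  shows "\<bar>kruzhkov_flux f \<sigma> r k - kruzhkov_flux f \<sigma> r k'\<bar> \<le> 2 * L * \<bar>k - k'\<bar>"
proof -
  have lip: "\<bar>f y - f z\<bar> \<le> L * \<bar>y - z\<bar>" if "\<bar>y\<bar> \<le> M" "\<bar>z\<bar> \<le> M" for y z
  proof -
    have "norm (f y - f z) \<le> L * norm (y - z)"
    proof (rule field_differentiable_bound[OF _ has_field_derivative_at_within[OF f], of "{-M..M}"])
      show "norm (deriv f x) \<le> L" if "x \<in> {-M..M}" for x
        using L[of x] that by (simp add: abs_le_iff)
    qed (use that in auto)
    then show ?thesis by simp
  qed
  have L0: "0 \<le> L" using L[OF le(1)] by linarith
  have tri: "\<bar>(a - b) - (c - d)\<bar> \<le> 2 * L * \<bar>k - k'\<bar>"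
    if "\<bar>a - c\<bar> \<le> L * \<bar>k - k'\<bar>" "\<bar>b - d\<bar> \<le> L * \<bar>k - k'\<bar>" for a b c d
    using that by linarith
  have fk: "\<bar>f k - f k'\<bar> \<le> L * \<bar>k - k'\<bar>" by (rule lip) (use le in auto)
  have 1: "L * \<bar>max r k - max r k'\<bar> \<le> L * \<bar>k - k'\<bar>" by (intro mult_left_mono L0) auto
  have 2: "L * \<bar>min r k - min r k'\<bar> \<le> L * \<bar>k - k'\<bar>" by (intro mult_left_mono L0) auto
  show ?thesis
  proof (cases "\<sigma> = 1")
    case True
    have "\<bar>f (max r k) - f (max r k')\<bar> \<le> L * \<bar>max r k - max r k'\<bar>" by (rule lip) (use le in auto)
    from order_trans[OF this 1] show ?thesis
      unfolding True kruzhkov_flux_max by (rule tri[OF _ fk])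
  next
    case False
    then have F: "\<sigma> = - 1" using \<sigma> by simp
    have *: "kruzhkov_flux f \<sigma> r k = f k - f (min r k)" for k
      unfolding F by (auto simp: kruzhkov_flux_def min_def)
    have "\<bar>f (min r k) - f (min r k')\<bar> \<le> L * \<bar>min r k - min r k'\<bar>" by (rule lip) (use le in auto)
    from order_trans[OF this 2] show ?thesis
      unfolding * by (rule tri[OF fk])
  qed
qed

lemma kruzhkov_flux_bound:
  fixes f :: "real \<Rightarrow> real"
  assumes f: "\<And>z. (f has_real_derivative deriv f z) (at z)"
    and L: "\<And>z. \<bar>z\<bar> \<le> M \<Longrightarrow> \<bar>deriv f z\<bar> \<le> L"
    and \<sigma>: "\<sigma> = 1 \<or> \<sigma> = -1" and le: "\<bar>r\<bar> \<le> M" "\<bar>k\<bar> \<le> M"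
  shows "\<bar>kruzhkov_flux f \<sigma> r k\<bar> \<le> 4 * L * M"
proof -
  have L0: "0 \<le> L" using L[OF le(1)] by linarith
  have "\<bar>kruzhkov_flux f \<sigma> r k - kruzhkov_flux f \<sigma> r r\<bar> \<le> 2 * L * \<bar>k - r\<bar>"
    by (rule kruzhkov_flux_lipschitz[OF f L \<sigma>]) (use le in auto)
  also have "\<dots> \<le> 2 * L * (2 * M)" using le L0 by (intro mult_left_mono) auto
  finally show ?thesis by (simp add: kruzhkov_flux_def)
qed

locale C1_flux_flow = entropy_flow +
  fixes L :: real
  assumes f_deriv: "\<And>z. (f has_real_derivative deriv f z) (at z)"
    and f'_cont: "continuous_on UNIV (deriv f)"
    and f'_le: "\<And>z. \<bar>z\<bar> \<le> M \<Longrightarrow> \<bar>deriv f z\<bar> \<le> L"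
begin

lemma L_nonneg: "0 \<le> L" using f'_le[of 0] M_nonneg by force
lemma H_nonneg: "0 \<le> H" using h_le[of "(0,0)"] by linarith

lemma f_borel [measurable]: "f \<in> borel_measurable borel"
  by (rule borel_measurable_continuous_onI[OF DERIV_continuous_on[OF has_field_derivative_at_within[OF f_deriv]]])

text \<open>
The spatial density of the rate of change of \<open>\<integral>\<rho> (\<sigma> (u - k))\<^sup>+\<close>, with \<open>a\<close> and \<open>b\<close> standing for
\<open>\<rho> x\<close> and \<open>\<rho>' x\<close>.
\<close>

definition kruzhkov_integrand :: "real \<Rightarrow> real \<Rightarrow> real \<Rightarrow> real \<Rightarrow> real \<Rightarrow> real \<Rightarrow> real \<Rightarrow> real" where
  "kruzhkov_integrand \<sigma> \<delta> k a b t x =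
     b * kruzhkov_flux f \<sigma> (w (t, x)) k - a * (\<sigma> * smooth_sgn \<delta> (\<sigma> * (w (t, x) - k))) * h (t, x)"

lemma kruzhkov_integrand_bound:
  assumes "\<sigma> = 1 \<or> \<sigma> = -1" "0 < \<delta>" "\<bar>k\<bar> \<le> M" "\<bar>a\<bar> \<le> R" "\<bar>b\<bar> \<le> R"
  shows "\<bar>kruzhkov_integrand \<sigma> \<delta> k a b t x\<bar> \<le> R * (4 * L * M) + R * 1 * H"
proof -
  have R: "0 \<le> R" using assms(4) by linarith
  have s: "\<bar>\<sigma> * smooth_sgn \<delta> r\<bar> \<le> 1" for r
    using assms(1) smooth_sgn_bounds[OF assms(2), of r] by auto
  have "\<bar>b * kruzhkov_flux f \<sigma> (w (t, x)) k\<bar> \<le> R * (4 * L * M)"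
    unfolding abs_mult[of b]
    by (rule mult_mono[OF assms(5) kruzhkov_flux_bound[OF f_deriv f'_le assms(1) w_le assms(3)]])
       (use R in auto)
  moreover have "\<bar>a * (\<sigma> * smooth_sgn \<delta> (\<sigma> * (w (t, x) - k))) * h (t, x)\<bar> \<le> R * 1 * H"
    unfolding abs_mult[of _ "h (t, x)"] abs_mult[of a]
    by (intro mult_mono assms h_le s R mult_nonneg_nonneg) (auto simp: R)
  ultimately show ?thesis unfolding kruzhkov_integrand_def by linarith
qed

lemma kruzhkov_integrand_lipschitz:
  assumes "\<sigma> = 1 \<or> \<sigma> = -1" "0 < \<delta>" "\<bar>k\<bar> \<le> M" "\<bar>k'\<bar> \<le> M" "\<bar>a\<bar> \<le> R" "\<bar>b\<bar> \<le> R"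
  shows "\<bar>kruzhkov_integrand \<sigma> \<delta> k a b t x - kruzhkov_integrand \<sigma> \<delta> k' a b t x\<bar>
    \<le> (R * (2 * L) + R * (1 / \<delta>) * H) * \<bar>k - k'\<bar>"
proof -
  have R: "0 \<le> R" using assms(5) by linarith
  let ?F = "\<lambda>k. kruzhkov_flux f \<sigma> (w (t, x)) k" and ?S = "\<lambda>k. \<sigma> * smooth_sgn \<delta> (\<sigma> * (w (t, x) - k))"
  have "\<bar>smooth_sgn \<delta> (\<sigma> * (w (t, x) - k)) - smooth_sgn \<delta> (\<sigma> * (w (t, x) - k'))\<bar>
      \<le> \<bar>\<sigma> * (w (t, x) - k) - \<sigma> * (w (t, x) - k')\<bar> / \<delta>"
    by (rule smooth_sgn_lipschitz[OF assms(2)])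
  then have s: "\<bar>?S k - ?S k'\<bar> \<le> 1 / \<delta> * \<bar>k - k'\<bar>"
    using assms(1) by (auto simp: abs_minus_commute)
  have 1: "\<bar>b * (?F k - ?F k')\<bar> \<le> R * (2 * L * \<bar>k - k'\<bar>)"
    unfolding abs_mult[of b]
    by (rule mult_mono[OF assms(6) kruzhkov_flux_lipschitz[OF f_deriv f'_le assms(1) w_le assms(3,4)]])
       (use R in auto)
  have 2: "\<bar>a * (?S k - ?S k') * h (t, x)\<bar> \<le> R * (1 / \<delta> * \<bar>k - k'\<bar>) * H"
    unfolding abs_mult[of _ "h (t, x)"] abs_mult[of a]
    by (intro mult_mono assms h_le s R mult_nonneg_nonneg) (use R assms(2) in auto)
  have "kruzhkov_integrand \<sigma> \<delta> k a b t x - kruzhkov_integrand \<sigma> \<delta> k' a b t x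
     = b * (?F k - ?F k') - a * (?S k - ?S k') * h (t, x)"
    unfolding kruzhkov_integrand_def by (simp add: algebra_simps)
  then have "\<bar>kruzhkov_integrand \<sigma> \<delta> k a b t x - kruzhkov_integrand \<sigma> \<delta> k' a b t x\<bar>
      \<le> R * (2 * L * \<bar>k - k'\<bar>) + R * (1 / \<delta> * \<bar>k - k'\<bar>) * H"
    using 1 2 by linarith
  then show ?thesis by (simp add: algebra_simps)
qed

lemma kruzhkov_integrand_measurable:
  assumes [measurable]: "k \<in> borel_measurable N" "a \<in> borel_measurable N" "b \<in> borel_measurable N"
    "t \<in> N \<rightarrow>\<^sub>M timespan T'" "x \<in> N \<rightarrow>\<^sub>M torus"
  shows "(\<lambda>p. kruzhkov_integrand \<sigma> \<delta> (k p) (a p) (b p) (t p) (x p)) \<in> borel_measurable N"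
  unfolding kruzhkov_integrand_def kruzhkov_flux_def smooth_sgn_def by measurable

theorem kruzhkov_increment:
  assumes \<sigma>: "\<sigma> = 1 \<or> \<sigma> = -1" and \<delta>: "0 < \<delta>" and k: "\<bar>k\<bar> \<le> M"
    and W: "C1_weight \<rho> \<rho>'" and R: "\<And>x. \<bar>\<rho> x\<bar> \<le> R0" "\<And>x. \<bar>\<rho>' x\<bar> \<le> R"
    and t: "0 \<le> t1" "t1 \<le> t2" "t2 < T"
  shows "mass (\<lambda>r. smooth_pos \<delta> (\<sigma> * (r - k))) \<rho> t2 - mass (\<lambda>r. smooth_pos \<delta> (\<sigma> * (r - k))) \<rho> t1
    \<le> (\<integral>t. indicator {t1..t2} t * (\<integral>x. kruzhkov_integrand \<sigma> \<delta> k (\<rho> x) (\<rho>' x) t x \<partial>torus) \<partial>timespan T)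
       + R * (L * \<delta>) * (t2 - t1)"
proof -
  obtain q where E: "C1_entropy f (\<lambda>r. smooth_pos \<delta> (\<sigma> * (r - k))) (\<lambda>r. \<sigma> * smooth_sgn \<delta> (\<sigma> * (r - k))) q"
    and q: "\<And>r. \<bar>r\<bar> \<le> M \<Longrightarrow> \<bar>q r - kruzhkov_flux f \<sigma> r k\<bar> \<le> L * \<delta>"
    using kruzhkov_entropy[OF f_deriv f'_cont f'_le k \<sigma> \<delta>] by blast
  let ?\<eta>' = "\<lambda>r. \<sigma> * smooth_sgn \<delta> (\<sigma> * (r - k))"
  let ?I = "\<lambda>t x. kruzhkov_integrand \<sigma> \<delta> k (\<rho> x) (\<rho>' x) t x"
  have R0: "0 \<le> R" using R(2)[of 0] by linarith
  have [measurable]: "\<rho> \<in> borel_measurable torus" "\<rho>' \<in> borel_measurable torus" "q \<in> borel_measurable borel"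
    using W C1_weight_continuous[OF W] C1_entropy_continuous[OF E]
    by (auto intro!: borel_measurable_torus borel_measurable_continuous_onI simp: C1_weight_def)
  obtain B where B: "0 \<le> B" "\<And>t. \<bar>rate ?\<eta>' q \<rho> \<rho>' t\<bar> \<le> B"
    using rate_bounded[OF E W] by metis
  have Pm [measurable]: "rate ?\<eta>' q \<rho> \<rho>' \<in> borel_measurable (timespan T)" by (rule rate_measurable[OF E W])
  have Im [measurable]: "(\<lambda>(t, x). ?I t x) \<in> borel_measurable (timespan T \<Otimes>\<^sub>M torus)"
    unfolding case_prod_beta' by (intro kruzhkov_integrand_measurable) measurable
  define R1 where "R1 = max R0 R"
  have Ib: "\<bar>?I t x\<bar> \<le> R1 * (4 * L * M) + R1 * 1 * H" for t x
    by (rule kruzhkov_integrand_bound[OF \<sigma> \<delta> k]) (use R in \<open>auto simp: R1_def le_max_iff_disj\<close>)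
  have Ixi: "integrable torus (?I t)" if "t \<in> space (timespan T)" for t
    by (rule torus.integrable_const_bound[where B="R1 * (4 * L * M) + R1 * 1 * H"])
       (use Ib measurable_compose[OF measurable_Pair1'[OF that] Im] in auto)
  have le: "rate ?\<eta>' q \<rho> \<rho>' t \<le> (\<integral>x. ?I t x \<partial>torus) + R * (L * \<delta>)" if t: "t \<in> space (timespan T)" for t
  proof -
    have p: "\<rho>' x * q (w (t, x)) - \<rho> x * ?\<eta>' (w (t, x)) * h (t, x) \<le> ?I t x + R * (L * \<delta>)" for x
    proof -
      have "\<bar>\<rho>' x * (q (w (t, x)) - kruzhkov_flux f \<sigma> (w (t, x)) k)\<bar> \<le> R * (L * \<delta>)"
        unfolding abs_mult[of "\<rho>' x"] by (intro mult_mono R q w_le R0) auto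
      then have "\<rho>' x * (q (w (t, x)) - kruzhkov_flux f \<sigma> (w (t, x)) k) \<le> R * (L * \<delta>)" by linarith
      then show ?thesis unfolding kruzhkov_integrand_def by (simp add: right_diff_distrib)
    qed
    have "integrable torus (\<lambda>x. \<rho>' x * q (w (t, x)) - \<rho> x * ?\<eta>' (w (t, x)) * h (t, x))"
    proof (rule Bochner_Integration.integrable_bound[of _ "\<lambda>x. R1 * (4 * L * M) + R1 * 1 * H + R * (L * \<delta>)"])
      have [measurable]: "(\<lambda>x. w (t, x)) \<in> borel_measurable torus" "(\<lambda>x. h (t, x)) \<in> borel_measurable torus"
        using t by (rule measurable_compose[OF measurable_Pair1' w_meas], rule measurable_compose[OF measurable_Pair1' h_meas])
      show "(\<lambda>x. \<rho>' x * q (w (t, x)) - \<rho> x * ?\<eta>' (w (t, x)) * h (t, x)) \<in> borel_measurable torus"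
        unfolding smooth_sgn_def by measurable
      show "AE x in torus. norm (\<rho>' x * q (w (t, x)) - \<rho> x * ?\<eta>' (w (t, x)) * h (t, x))
         \<le> norm (R1 * (4 * L * M) + R1 * 1 * H + R * (L * \<delta>))"
      proof (rule AE_I2)
        fix x
        have "\<bar>\<rho>' x * (q (w (t, x)) - kruzhkov_flux f \<sigma> (w (t, x)) k)\<bar> \<le> R * (L * \<delta>)"
          unfolding abs_mult[of "\<rho>' x"] by (intro mult_mono R q w_le R0) auto
        moreover have "\<rho>' x * q (w (t, x)) - \<rho> x * ?\<eta>' (w (t, x)) * h (t, x)
            = ?I t x + \<rho>' x * (q (w (t, x)) - kruzhkov_flux f \<sigma> (w (t, x)) k)"
          unfolding kruzhkov_integrand_def by (simp add: right_diff_distrib)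
        ultimately show "norm (\<rho>' x * q (w (t, x)) - \<rho> x * ?\<eta>' (w (t, x)) * h (t, x))
         \<le> norm (R1 * (4 * L * M) + R1 * 1 * H + R * (L * \<delta>))"
          using Ib[of x t] unfolding real_norm_def by linarith
      qed
    qed simp
    then have "rate ?\<eta>' q \<rho> \<rho>' t \<le> (\<integral>x. ?I t x + R * (L * \<delta>) \<partial>torus)"
      unfolding rate_def using Ixi[OF t] p by (intro Bochner_Integration.integral_mono) auto
    also have "\<dots> = (\<integral>x. ?I t x \<partial>torus) + R * (L * \<delta>)" using Ixi[OF t] by simp
    finally show ?thesis .
  qed
  have Jm [measurable]: "(\<lambda>t. \<integral>x. ?I t x \<partial>torus) \<in> borel_measurable (timespan T)"
    using Im by (rule torus.borel_measurable_lebesgue_integral)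
  have Jb: "\<bar>\<integral>x. ?I t x \<partial>torus\<bar> \<le> R1 * (4 * L * M) + R1 * 1 * H" for t
  proof -
    have "(\<integral>x. \<bar>?I t x\<bar> \<partial>torus) \<le> (\<integral>x. R1 * (4 * L * M) + R1 * 1 * H \<partial>torus)"
      by (rule integral_mono'[OF _ Ib]) (use order_trans[OF abs_ge_zero Ib] in auto)
    from order_trans[OF integral_abs_bound this] show ?thesis by simp
  qed
  have ind [measurable]: "(indicator {t1..t2} :: real \<Rightarrow> real) \<in> borel_measurable (timespan T)"
    by (intro borel_measurable_timespan borel_measurable_indicator) auto
  have iI: "integrable (timespan T) (\<lambda>t. indicator {t1..t2} t * (\<integral>x. ?I t x \<partial>torus))"
  proof (rule timespan.integrable_const_bound[where B="R1 * (4 * L * M) + R1 * 1 * H"])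
    show "AE t in timespan T. norm (indicator {t1..t2} t * (\<integral>x. ?I t x \<partial>torus)) \<le> R1 * (4 * L * M) + R1 * 1 * H"
      using Jb order_trans[OF abs_ge_zero Jb] by (auto simp: indicator_def)
  qed measurable
  have iR: "integrable (timespan T) (\<lambda>t. indicator {t1..t2} t * rate ?\<eta>' q \<rho> \<rho>' t)"
  proof (rule timespan.integrable_const_bound[where B=B])
    show "AE t in timespan T. norm (indicator {t1..t2} t * rate ?\<eta>' q \<rho> \<rho>' t) \<le> B"
      using B by (auto simp: indicator_def)
  qed measurable
  note ii = integral_timespan_Icc[OF t(1,2) less_imp_le[OF t(3)]]
  have "(\<integral>t. indicator {t1..t2} t * rate ?\<eta>' q \<rho> \<rho>' t \<partial>timespan T)
     \<le> (\<integral>t. indicator {t1..t2} t * (\<integral>x. ?I t x \<partial>torus) + R * (L * \<delta>) * indicator {t1..t2} t \<partial>timespan T)"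
  proof (rule Bochner_Integration.integral_mono)
    show "integrable (timespan T)
        (\<lambda>t. indicator {t1..t2} t * (\<integral>x. ?I t x \<partial>torus) + R * (L * \<delta>) * indicator {t1..t2} t)"
      using iI ii(1) by (intro Bochner_Integration.integrable_add integrable_mult_right) auto
    show "indicator {t1..t2} t * rate ?\<eta>' q \<rho> \<rho>' t
        \<le> indicator {t1..t2} t * (\<integral>x. ?I t x \<partial>torus) + R * (L * \<delta>) * indicator {t1..t2} t"
      if "t \<in> space (timespan T)" for t
      using le[OF that] by (simp add: indicator_def)
  qed (rule iR)
  also have "\<dots> = (\<integral>t. indicator {t1..t2} t * (\<integral>x. ?I t x \<partial>torus) \<partial>timespan T) + R * (L * \<delta>) * (t2 - t1)"
    using iI ii by simp
  finally show ?thesis using entropy_increment[OF E W t] by linarith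
qed

end

section \<open>Doubling the space variable for one solution\<close>

lemma integrable_torus2:
  assumes "F \<in> borel_measurable torus2" "\<And>p. \<bar>F p :: real\<bar> \<le> B"
  shows "integrable torus2 F"
  by (rule torus_torus.integrable_const_bound[where B=B]) (use assms in auto)

context C1_flux_flow
begin

text \<open>
One solution \<open>u\<close> paired with a fixed companion \<open>r\<close>, which takes the place of the constant \<open>k\<close>. The
kernel is a function of the pair (companion point, solution point), so that either solution of a pair
can play the role of \<open>u\<close>.
\<close>

definition doubled_mass ::
  "real \<Rightarrow> real \<Rightarrow> (real \<Rightarrow> real) \<Rightarrow> (real \<times> real \<Rightarrow> real) \<Rightarrow> real \<Rightarrow> real" where
  "doubled_mass \<sigma> \<delta> r \<kappa> t =
     (\<integral>(y, x). \<kappa> (y, x) * smooth_pos \<delta> (\<sigma> * (u t x - r y)) \<partial>torus2)"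

definition doubled_rate ::
  "real \<Rightarrow> real \<Rightarrow> (real \<Rightarrow> real) \<Rightarrow> (real \<times> real \<Rightarrow> real) \<Rightarrow> (real \<times> real \<Rightarrow> real) \<Rightarrow> real \<Rightarrow> real" where
  "doubled_rate \<sigma> \<delta> r \<kappa> \<kappa>' t =
     (\<integral>(y, x). kruzhkov_integrand \<sigma> \<delta> (r y) (\<kappa> (y, x)) (\<kappa>' (y, x)) t x \<partial>torus2)"

definition doubling_kernel :: "(real \<times> real \<Rightarrow> real) \<Rightarrow> (real \<times> real \<Rightarrow> real) \<Rightarrow> real \<Rightarrow> bool" where
  "doubling_kernel \<kappa> \<kappa>' R \<longleftrightarrow>
     \<kappa> \<in> borel_measurable torus2 \<and> \<kappa>' \<in> borel_measurable torus2 \<and>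
     (\<forall>y. C1_weight (\<lambda>x. \<kappa> (y, x)) (\<lambda>x. \<kappa>' (y, x))) \<and>
     (\<forall>p. \<bar>\<kappa> p\<bar> \<le> R) \<and> (\<forall>p. \<bar>\<kappa>' p\<bar> \<le> R)"

lemma doubled_integral:
  assumes \<sigma>: "\<bar>\<sigma>\<bar> = 1" and \<delta>: "0 < \<delta>" and K: "doubling_kernel \<kappa> \<kappa>' R"
    and r [measurable]: "r \<in> borel_measurable torus" and rM: "\<And>y. \<bar>r y\<bar> \<le> M"
    and v [measurable]: "v \<in> borel_measurable torus" and vM: "\<And>x. \<bar>v x\<bar> \<le> M"
  shows "integrable torus2 (\<lambda>(y, x). \<kappa> (y, x) * smooth_pos \<delta> (\<sigma> * (v x - r y)))"
    and "integrable torus (\<lambda>y. \<integral>x. \<kappa> (y, x) * smooth_pos \<delta> (\<sigma> * (v x - r y)) \<partial>torus)"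
    and "(\<integral>(y, x). \<kappa> (y, x) * smooth_pos \<delta> (\<sigma> * (v x - r y)) \<partial>torus2)
       = (\<integral>y. \<integral>x. \<kappa> (y, x) * smooth_pos \<delta> (\<sigma> * (v x - r y)) \<partial>torus \<partial>torus)"
proof -
  have [measurable]: "\<kappa> \<in> borel_measurable torus2" using K unfolding doubling_kernel_def by blast
  have KR: "\<bar>\<kappa> p\<bar> \<le> R" for p using K unfolding doubling_kernel_def by blast
  have R: "0 \<le> R" using KR[of "(0,0)"] by linarith
  have sp: "\<bar>smooth_pos \<delta> (\<sigma> * (v x - r y))\<bar> \<le> 2 * M" for x y
  proof -
    have "\<bar>\<sigma> * (v x - r y)\<bar> \<le> 2 * M"
      unfolding abs_mult \<sigma> mult_1 using rM[of y] vM[of x] by linarith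
    then have "max 0 (\<sigma> * (v x - r y)) \<le> 2 * M" using M_nonneg by linarith
    then show ?thesis using smooth_pos_bounds(2,3)[OF \<delta>, of "\<sigma> * (v x - r y)"] by linarith
  qed
  have bd: "\<bar>\<kappa> (y, x) * smooth_pos \<delta> (\<sigma> * (v x - r y))\<bar> \<le> R * (2 * M)" for x y
    unfolding abs_mult[of "\<kappa> _"] by (rule mult_mono[OF KR sp R]) simp
  have m: "(\<lambda>(y, x). \<kappa> (y, x) * smooth_pos \<delta> (\<sigma> * (v x - r y))) \<in> borel_measurable torus2"
    unfolding smooth_pos_def by measurable
  show i: "integrable torus2 (\<lambda>(y, x). \<kappa> (y, x) * smooth_pos \<delta> (\<sigma> * (v x - r y)))"
    by (rule integrable_torus2[OF m, of "R * (2 * M)"]) (use bd in auto)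
  show "integrable torus (\<lambda>y. \<integral>x. \<kappa> (y, x) * smooth_pos \<delta> (\<sigma> * (v x - r y)) \<partial>torus)"
    by (rule torus_torus.integrable_fst[OF i])
  show "(\<integral>(y, x). \<kappa> (y, x) * smooth_pos \<delta> (\<sigma> * (v x - r y)) \<partial>torus2)
       = (\<integral>y. \<integral>x. \<kappa> (y, x) * smooth_pos \<delta> (\<sigma> * (v x - r y)) \<partial>torus \<partial>torus)"
    by (rule torus_torus.integral_fst[OF i, symmetric])
qed

theorem doubled_initial:
  assumes \<sigma>: "\<sigma> = 1 \<or> \<sigma> = -1" and \<delta>: "0 < \<delta>" and K: "doubling_kernel \<kappa> \<kappa>' R"
    and r [measurable]: "r \<in> borel_measurable torus" and rM: "\<And>y. \<bar>r y\<bar> \<le> M"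
  shows "doubled_mass \<sigma> \<delta> r \<kappa> 0 \<le> (\<integral>(y, x). \<kappa> (y, x) * smooth_pos \<delta> (\<sigma> * (u0 x - r y)) \<partial>torus2)"
proof -
  have \<sigma>1: "\<bar>\<sigma>\<bar> = 1" using \<sigma> by auto
  note a = doubled_integral[OF \<sigma>1 \<delta> K r rM u_meas[OF order_refl less_imp_le[OF T_pos]] u_le[OF order_refl less_imp_le[OF T_pos]]] 
  note b = doubled_integral[OF \<sigma>1 \<delta> K r rM u0_meas u0_le]
  have "(\<integral>x. \<kappa> (y, x) * smooth_pos \<delta> (\<sigma> * (u 0 x - r y)) \<partial>torus)
      \<le> (\<integral>x. \<kappa> (y, x) * smooth_pos \<delta> (\<sigma> * (u0 x - r y)) \<partial>torus)" for y
  proof -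
    obtain q where E: "C1_entropy f (\<lambda>x. smooth_pos \<delta> (\<sigma> * (x - r y))) (\<lambda>x. \<sigma> * smooth_sgn \<delta> (\<sigma> * (x - r y))) q"
      using kruzhkov_entropy[OF f_deriv f'_cont f'_le rM \<sigma> \<delta>] by blast
    show ?thesis
      using entropy_initial[OF E, of "\<lambda>x. \<kappa> (y, x)" "\<lambda>x. \<kappa>' (y, x)"] K
      by (simp add: mass_def doubling_kernel_def)
  qed
  then show ?thesis
    unfolding doubled_mass_def using a b T_pos
    by (simp add: Bochner_Integration.integral_mono)
qed

lemma doubled_rate_integral:
  assumes \<sigma>: "\<sigma> = 1 \<or> \<sigma> = -1" and \<delta>: "0 < \<delta>" and K: "doubling_kernel \<kappa> \<kappa>' R"
    and r [measurable]: "r \<in> borel_measurable torus" and rM: "\<And>y. \<bar>r y\<bar> \<le> M" and t: "t \<in> {0..T}"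
  shows "integrable torus2 (\<lambda>(y, x). kruzhkov_integrand \<sigma> \<delta> (r y) (\<kappa> (y, x)) (\<kappa>' (y, x)) t x)"
proof -
  have [measurable]: "\<kappa> \<in> borel_measurable torus2" "\<kappa>' \<in> borel_measurable torus2"
    using K unfolding doubling_kernel_def by blast+
  have KR: "\<bar>\<kappa> p\<bar> \<le> R" "\<bar>\<kappa>' p\<bar> \<le> R" for p using K unfolding doubling_kernel_def by blast+
  have m: "(\<lambda>(y, x). kruzhkov_integrand \<sigma> \<delta> (r y) (\<kappa> (y, x)) (\<kappa>' (y, x)) t x) \<in> borel_measurable torus2"
    unfolding case_prod_beta'
    by (rule kruzhkov_integrand_measurable[where T'=T, OF _ _ _ measurable_const[of t] measurable_snd])
       (measurable, use t in simp)
  show ?thesis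
    by (rule integrable_torus2[OF m, of "R * (4 * L * M) + R * 1 * H"])
       (use kruzhkov_integrand_bound[OF \<sigma> \<delta> rM KR] in auto)
qed

text \<open>
For each companion point \<open>y\<close> this is \<open>kruzhkov_increment\<close> with \<open>k = r y\<close>; integrate in \<open>y\<close> and
exchange the integrals.
\<close>

theorem doubled_increment:
  assumes \<sigma>: "\<sigma> = 1 \<or> \<sigma> = -1" and \<delta>: "0 < \<delta>" and K: "doubling_kernel \<kappa> \<kappa>' R"
    and r [measurable]: "r \<in> borel_measurable torus" and rM: "\<And>y. \<bar>r y\<bar> \<le> M"
    and t: "0 \<le> t1" "t1 \<le> t2" "t2 < T"
  shows "integrable (timespan T) (\<lambda>t. indicator {t1..t2} t * doubled_rate \<sigma> \<delta> r \<kappa> \<kappa>' t)"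
    and "doubled_mass \<sigma> \<delta> r \<kappa> t2 - doubled_mass \<sigma> \<delta> r \<kappa> t1
    \<le> (\<integral>t. indicator {t1..t2} t * doubled_rate \<sigma> \<delta> r \<kappa> \<kappa>' t \<partial>timespan T) + R * (L * \<delta>) * (t2 - t1)"
proof -
  have \<sigma>1: "\<bar>\<sigma>\<bar> = 1" using \<sigma> by auto
  have [measurable]: "\<kappa> \<in> borel_measurable torus2" "\<kappa>' \<in> borel_measurable torus2"
    using K unfolding doubling_kernel_def by blast+
  have KR: "\<bar>\<kappa> p\<bar> \<le> R" "\<bar>\<kappa>' p\<bar> \<le> R" for p using K unfolding doubling_kernel_def by blast+
  have R: "0 \<le> R" using KR(1)[of "(0,0)"] by linarith
  have W: "C1_weight (\<lambda>x. \<kappa> (y, x)) (\<lambda>x. \<kappa>' (y, x))" for y using K unfolding doubling_kernel_def by blast+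
  have T1: "0 \<le> t1" "t1 \<le> T" and T2: "0 \<le> t2" "t2 \<le> T" using t by auto
  note a1 = doubled_integral[OF \<sigma>1 \<delta> K r rM u_meas[OF T1] u_le[OF T1]]
  note a2 = doubled_integral[OF \<sigma>1 \<delta> K r rM u_meas[OF T2] u_le[OF T2]]
  let ?B = "R * (4 * L * M) + R * 1 * H"
  have B0: "0 \<le> ?B" using R L_nonneg M_nonneg H_nonneg by simp
  let ?I = "\<lambda>t y x. kruzhkov_integrand \<sigma> \<delta> (r y) (\<kappa> (y, x)) (\<kappa>' (y, x)) t x"
  let ?J = "\<lambda>y t. indicator {t1..t2} t * (\<integral>x. ?I t y x \<partial>torus)"
  have Ib: "\<bar>?I t y x\<bar> \<le> ?B" for t y x by (rule kruzhkov_integrand_bound[OF \<sigma> \<delta> rM KR])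
  have Im [measurable]: "(\<lambda>(p, x). ?I (snd p) (fst p) x) \<in> borel_measurable ((torus \<Otimes>\<^sub>M timespan T) \<Otimes>\<^sub>M torus)"
    unfolding case_prod_beta' by (rule kruzhkov_integrand_measurable[where T'=T]) measurable
  have Jm: "(\<lambda>p. \<integral>x. ?I (snd p) (fst p) x \<partial>torus) \<in> borel_measurable (torus \<Otimes>\<^sub>M timespan T)"
    using Im by (rule torus.borel_measurable_lebesgue_integral)
  have Jb: "\<bar>\<integral>x. ?I t y x \<partial>torus\<bar> \<le> ?B" for t y
  proof -
    have "(\<integral>x. \<bar>?I t y x\<bar> \<partial>torus) \<le> (\<integral>x. ?B \<partial>torus)"
      by (rule integral_mono'[OF _ Ib]) (use B0 in auto)
    from order_trans[OF integral_abs_bound this] show ?thesis by simp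
  qed
  have ind: "(indicator {t1..t2} :: real \<Rightarrow> real) \<in> borel_measurable (timespan T)"
    by (intro borel_measurable_timespan borel_measurable_indicator) auto
  interpret tt: finite_measure "torus \<Otimes>\<^sub>M timespan T"
    by (rule finite_measure_pair_measure) unfold_locales
  have int: "integrable (torus \<Otimes>\<^sub>M timespan T) (\<lambda>(y, t). ?J y t)"
    unfolding case_prod_beta'
  proof (rule tt.integrable_const_bound[where B="?B"])
    show "AE p in torus \<Otimes>\<^sub>M timespan T. norm (?J (fst p) (snd p)) \<le> ?B"
      using Jb B0 by (auto simp: indicator_def)
    show "(\<lambda>p. ?J (fst p) (snd p)) \<in> borel_measurable (torus \<Otimes>\<^sub>M timespan T)"
      by (intro borel_measurable_times Jm measurable_compose[OF measurable_snd ind])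
  qed
  have rate: "doubled_rate \<sigma> \<delta> r \<kappa> \<kappa>' t = (\<integral>y. \<integral>x. ?I t y x \<partial>torus \<partial>torus)" if "t \<in> {0..T}" for t
    unfolding doubled_rate_def
    by (rule torus_torus.integral_fst[OF doubled_rate_integral[OF \<sigma> \<delta> K r rM that], symmetric])
  have iJ: "(\<integral>y. ?J y t \<partial>torus) = indicator {t1..t2} t * doubled_rate \<sigma> \<delta> r \<kappa> \<kappa>' t" 
    if "t \<in> space (timespan T)" for t
    using rate[of t] that by simp
  have "integrable (timespan T) (\<lambda>t. \<integral>y. ?J y t \<partial>torus)"
    by (rule torus_timespan.integrable_snd[OF int])
  then show "integrable (timespan T) (\<lambda>t. indicator {t1..t2} t * doubled_rate \<sigma> \<delta> r \<kappa> \<kappa>' t)"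
    by (subst (asm) Bochner_Integration.integrable_cong[OF refl iJ])
  have inc: "(\<integral>x. \<kappa> (y, x) * smooth_pos \<delta> (\<sigma> * (u t2 x - r y)) \<partial>torus)
      - (\<integral>x. \<kappa> (y, x) * smooth_pos \<delta> (\<sigma> * (u t1 x - r y)) \<partial>torus)
      \<le> (\<integral>t. ?J y t \<partial>timespan T) + R * (L * \<delta>) * (t2 - t1)" for y
    using kruzhkov_increment[OF \<sigma> \<delta> rM W KR t] by (simp add: mass_def)
  have "doubled_mass \<sigma> \<delta> r \<kappa> t2 - doubled_mass \<sigma> \<delta> r \<kappa> t1
     = (\<integral>y. (\<integral>x. \<kappa> (y, x) * smooth_pos \<delta> (\<sigma> * (u t2 x - r y)) \<partial>torus)
      - (\<integral>x. \<kappa> (y, x) * smooth_pos \<delta> (\<sigma> * (u t1 x - r y)) \<partial>torus) \<partial>torus)"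
    unfolding doubled_mass_def using a1 a2 by simp
  also have "\<dots> \<le> (\<integral>y. (\<integral>t. ?J y t \<partial>timespan T) + R * (L * \<delta>) * (t2 - t1) \<partial>torus)"
    by (rule Bochner_Integration.integral_mono)
       (use a1 a2 inc torus_timespan.integrable_fst[OF int] in auto)
  also have "\<dots> = (\<integral>y. \<integral>t. ?J y t \<partial>timespan T \<partial>torus) + R * (L * \<delta>) * (t2 - t1)"
    using torus_timespan.integrable_fst[OF int] by simp
  also have "(\<integral>y. \<integral>t. ?J y t \<partial>timespan T \<partial>torus) = (\<integral>t. \<integral>y. ?J y t \<partial>torus \<partial>timespan T)"
    by (rule torus_timespan.Fubini_integral[OF int, symmetric])
  also have "\<dots> = (\<integral>t. indicator {t1..t2} t * doubled_rate \<sigma> \<delta> r \<kappa> \<kappa>' t \<partial>timespan T)"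
    by (rule Bochner_Integration.integral_cong[OF refl iJ])
  finally show "doubled_mass \<sigma> \<delta> r \<kappa> t2 - doubled_mass \<sigma> \<delta> r \<kappa> t1
    \<le> (\<integral>t. indicator {t1..t2} t * doubled_rate \<sigma> \<delta> r \<kappa> \<kappa>' t \<partial>timespan T) + R * (L * \<delta>) * (t2 - t1)" .
qed

text \<open>
Stability of the rate under a change of the companion in \<open>L\<^sup>1\<close>. The constant blows up as \<open>\<delta> \<rightarrow> 0\<close>,
which does no harm: \<open>\<delta>\<close> is fixed while the partition in time is refined.
\<close>

lemma doubled_rate_lipschitz:
  assumes \<sigma>: "\<sigma> = 1 \<or> \<sigma> = -1" and \<delta>: "0 < \<delta>" and K: "doubling_kernel \<kappa> \<kappa>' R"
    and r [measurable]: "r \<in> borel_measurable torus" and rM: "\<And>y. \<bar>r y\<bar> \<le> M"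
    and s [measurable]: "s \<in> borel_measurable torus" and sM: "\<And>y. \<bar>s y\<bar> \<le> M" and t: "t \<in> {0..T}"
  shows "\<bar>doubled_rate \<sigma> \<delta> r \<kappa> \<kappa>' t - doubled_rate \<sigma> \<delta> s \<kappa> \<kappa>' t\<bar>
    \<le> (R * (2 * L) + R * (1 / \<delta>) * H) * (\<integral>y. \<bar>r y - s y\<bar> \<partial>torus)"
proof -
  let ?C = "R * (2 * L) + R * (1 / \<delta>) * H"
  let ?I = "\<lambda>r (y, x). kruzhkov_integrand \<sigma> \<delta> (r y) (\<kappa> (y, x)) (\<kappa>' (y, x)) t x"
  have KR: "\<bar>\<kappa> p\<bar> \<le> R" "\<bar>\<kappa>' p\<bar> \<le> R" for p using K unfolding doubling_kernel_def by blast+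
  note i1 = doubled_rate_integral[OF \<sigma> \<delta> K r rM t] and i2 = doubled_rate_integral[OF \<sigma> \<delta> K s sM t]
  have i3: "integrable torus2 (\<lambda>(y, x). \<bar>r y - s y\<bar>)"
  proof (rule integrable_torus2[of _ "2 * M"])
    have "\<bar>r y - s y\<bar> \<le> 2 * M" for y using rM[of y] sM[of y] by linarith
    then show "\<bar>case p of (y, x) \<Rightarrow> \<bar>r y - s y\<bar>\<bar> \<le> 2 * M" for p by (cases p) simp
  qed measurable
  have d: "doubled_rate \<sigma> \<delta> r \<kappa> \<kappa>' t - doubled_rate \<sigma> \<delta> s \<kappa> \<kappa>' t = (\<integral>p. ?I r p - ?I s p \<partial>torus2)"
    unfolding doubled_rate_def by (rule Bochner_Integration.integral_diff[OF i1 i2, symmetric])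
  have "(\<integral>p. \<bar>?I r p - ?I s p\<bar> \<partial>torus2) \<le> (\<integral>p. ?C * (case p of (y, x) \<Rightarrow> \<bar>r y - s y\<bar>) \<partial>torus2)"
  proof (rule Bochner_Integration.integral_mono)
    show "\<bar>?I r p - ?I s p\<bar> \<le> ?C * (case p of (y, x) \<Rightarrow> \<bar>r y - s y\<bar>)" for p
      using kruzhkov_integrand_lipschitz[OF \<sigma> \<delta> rM sM KR] by (cases p) auto
    show "integrable torus2 (\<lambda>p. \<bar>?I r p - ?I s p\<bar>)"
      by (rule integrable_abs[OF Bochner_Integration.integrable_diff[OF i1 i2]])
  qed (use i3 in auto)
  also have "\<dots> = ?C * (\<integral>y. \<bar>r y - s y\<bar> \<partial>torus)"
    using torus_torus.integral_fst[OF i3] by simp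
  finally show ?thesis unfolding d by (rule order_trans[OF integral_abs_bound])
qed

end

section \<open>Comparison of two flows and of a flow with constants\<close>

text \<open>
This quantity stands in for \<open>\<integral>(p - r)\<^sup>+\<close>; the next lemma bounds the difference of the two by the kernel
variation of \<open>r\<close>.
\<close>

abbreviation smeared_excess :: "nat \<Rightarrow> (real \<Rightarrow> real) \<Rightarrow> (real \<Rightarrow> real) \<Rightarrow> real" where
  "smeared_excess n p r \<equiv> \<integral>(x, y). cos_kernel n (x - y) * max 0 (p x - r y) \<partial>torus2"

lemma kernel_positive_part:
  fixes p r :: "real \<Rightarrow> real"
  assumes [measurable]: "p \<in> borel_measurable torus" "r \<in> borel_measurable torus"
    and M: "\<And>x. \<bar>p x\<bar> \<le> M" "\<And>x. \<bar>r x\<bar> \<le> M"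
  shows "integrable torus2 (\<lambda>(x, y). cos_kernel n (x - y) * max 0 (p x - r y))"
    and "smeared_excess n p r
       \<le> (\<integral>x. max 0 (p x - r x) \<partial>torus) + kernel_variation n r"
    and "(\<integral>x. max 0 (p x - r x) \<partial>torus)
       \<le> smeared_excess n p r + kernel_variation n r"
proof -
  note K = C1_weight_cos_kernel[of n]
  obtain R where R: "\<And>x. \<bar>cos_kernel n x\<bar> \<le> R" "0 \<le> R"
    using C1_weight_bounded[OF K] by metis
  note K0 = cos_kernel_nonneg
  have [measurable]: "(\<lambda>p. cos_kernel n (fst p - snd p)) \<in> borel_measurable torus2"
    by (rule measurable_translate_torus2[OF C1_weight_continuous[OF K]])
  have b: "\<bar>max 0 (p x - r y)\<bar> \<le> 2 * M" for x y using M(1)[of x] M(2)[of y] by linarith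
  have bd: "\<bar>cos_kernel n (x - y) * max 0 (p x - r y)\<bar> \<le> R * (2 * M)" for x y
    unfolding abs_mult[of "cos_kernel n _"] by (rule mult_mono[OF R(1) b R(2)]) simp
  let ?F = "\<lambda>q. cos_kernel n (fst q - snd q) * max 0 (p (fst q) - r (snd q))"
  let ?D = "\<lambda>q. cos_kernel n (fst q - snd q) * max 0 (p (fst q) - r (fst q))"
  let ?V = "\<lambda>q. cos_kernel n (fst q - snd q) * \<bar>r (fst q) - r (snd q)\<bar>"
  have iF: "integrable torus2 ?F"
    by (rule integrable_torus2[of _ "R * (2 * M)"]) (measurable, rule bd)
  then show "integrable torus2 (\<lambda>(x, y). cos_kernel n (x - y) * max 0 (p x - r y))"
    by (simp add: case_prod_beta')
  have iV: "integrable torus2 ?V" by (rule integrable_kernel_variation) (use M in auto)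
  have bp: "\<bar>max 0 (p x - r x)\<bar> \<le> 2 * M" for x by (rule b)
  note D = cos_kernel_mean[of "\<lambda>x. max 0 (p x - r x)" "2 * M" n, OF _ bp]
  have iD: "integrable torus2 ?D" and vD: "(\<integral>q. ?D q \<partial>torus2) = (\<integral>x. max 0 (p x - r x) \<partial>torus)"
    using D(1,3) by auto
  have "(\<integral>q. ?F q \<partial>torus2) \<le> (\<integral>q. ?D q + ?V q \<partial>torus2)"
  proof (rule Bochner_Integration.integral_mono[OF iF Bochner_Integration.integrable_add[OF iD iV]])
    fix q
    have "?F q \<le> cos_kernel n (fst q - snd q) * (max 0 (p (fst q) - r (fst q)) + \<bar>r (fst q) - r (snd q)\<bar>)"
      by (intro mult_left_mono K0) linarith
    then show "?F q \<le> ?D q + ?V q" by (simp only: distrib_left)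
  qed
  then show "smeared_excess n p r
       \<le> (\<integral>x. max 0 (p x - r x) \<partial>torus) + kernel_variation n r"
    using iD iV vD by (simp add: case_prod_beta' kernel_variation_def)
  have "(\<integral>q. ?D q \<partial>torus2) \<le> (\<integral>q. ?F q + ?V q \<partial>torus2)"
  proof (rule Bochner_Integration.integral_mono[OF iD Bochner_Integration.integrable_add[OF iF iV]])
    fix q
    have "?D q \<le> cos_kernel n (fst q - snd q) * (max 0 (p (fst q) - r (snd q)) + \<bar>r (fst q) - r (snd q)\<bar>)"
      by (intro mult_left_mono K0) linarith
    then show "?D q \<le> ?F q + ?V q" by (simp only: distrib_left)
  qed
  then show "(\<integral>x. max 0 (p x - r x) \<partial>torus)
       \<le> smeared_excess n p r + kernel_variation n r"
    using iF iV vD by (simp add: case_prod_beta' kernel_variation_def)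
qed

lemma (in entropy_flow) continuity_modulus:
  assumes s: "0 \<le> s" "s \<le> T" and e: "0 < e"
  obtains d where "0 < d"
    "\<And>t t'. t \<in> {0..T} \<Longrightarrow> t' \<in> {0..T} \<Longrightarrow> \<bar>t - s\<bar> < d \<Longrightarrow> \<bar>t' - s\<bar> < d \<Longrightarrow>
       (\<integral>x. \<bar>u t x - u t' x\<bar> \<partial>torus) \<le> e"
proof -
  have "\<forall>\<^sub>F t in at s within {0..T}. dist (\<integral>x. \<bar>u t x - u s x\<bar> \<partial>torus) 0 < e / 2"
    using u_cont[OF s] e by (intro tendstoD) auto
  then obtain d where d: "0 < d"
    "\<And>t. t \<in> {0..T} \<Longrightarrow> t \<noteq> s \<Longrightarrow> dist t s < d \<Longrightarrow> dist (\<integral>x. \<bar>u t x - u s x\<bar> \<partial>torus) 0 < e / 2"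
    unfolding eventually_at by blast
  have near: "(\<integral>x. \<bar>u t x - u s x\<bar> \<partial>torus) \<le> e / 2" if "t \<in> {0..T}" "\<bar>t - s\<bar> < d" for t
    using d(2)[of t] that e by (cases "t = s") (auto simp: dist_real_def)
  have int: "integrable torus (\<lambda>x. \<bar>u t x - u t' x\<bar>)" if "t \<in> {0..T}" "t' \<in> {0..T}" for t t'
    by (rule integrable_abs_diff_torus[OF u_meas u_meas u_le u_le]) (use that in auto)
  show ?thesis
  proof (rule that[OF d(1)])
    fix t t' assume t: "t \<in> {0..T}" "t' \<in> {0..T}" "\<bar>t - s\<bar> < d" "\<bar>t' - s\<bar> < d"
    have "s \<in> {0..T}" using s by simp
    note i = int[OF t(1) this] int[OF t(2) this]
    have "(\<integral>x. \<bar>u t x - u t' x\<bar> \<partial>torus) \<le> (\<integral>x. \<bar>u t x - u s x\<bar> + \<bar>u t' x - u s x\<bar> \<partial>torus)"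
    proof (rule Bochner_Integration.integral_mono[OF int[OF t(1,2)] Bochner_Integration.integrable_add[OF i]])
      show "\<bar>u t x - u t' x\<bar> \<le> \<bar>u t x - u s x\<bar> + \<bar>u t' x - u s x\<bar>" for x by linarith
    qed
    also have "\<dots> = (\<integral>x. \<bar>u t x - u s x\<bar> \<partial>torus) + (\<integral>x. \<bar>u t' x - u s x\<bar> \<partial>torus)"
      by (rule Bochner_Integration.integral_add[OF i])
    also have "\<dots> \<le> e" using near[OF t(1,3)] near[OF t(2,4)] by simp
    finally show "(\<integral>x. \<bar>u t x - u t' x\<bar> \<partial>torus) \<le> e" .
  qed
qed

text \<open>
The last hypothesis is all that is used of the damping: where \<open>u > v\<close>, the damping of \<open>u\<close> at \<open>x\<close> is
not smaller than that of \<open>v\<close> at \<open>y\<close>, up to the oscillation of a coefficient \<open>b\<close> between \<open>x\<close> and \<open>y\<close>.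
\<close>

locale flow_pair =
  U: C1_flux_flow f T M H u0 u w h L + V: C1_flux_flow f T M H v0 v z g L
  for f :: "real \<Rightarrow> real" and T M H u0 u w h L v0 v z g +
  fixes b :: "real \<Rightarrow> real" and B C :: real
  assumes b_meas [measurable]: "b \<in> borel_measurable torus" and b_le: "\<And>x. \<bar>b x\<bar> \<le> B"
    and C_nonneg: "0 \<le> C"
    and damping: "AE t in timespan T. AE x in torus. AE y in torus.
      z (t, y) < w (t, x) \<longrightarrow> - (C * \<bar>b x - b y\<bar>) \<le> h (t, x) - g (t, y)"
begin

text \<open>
The doubled quantity \<open>G(t, s)\<close>, a regularisation of \<open>smeared_excess n (u t) (v s)\<close>.
\<close>

definition pair_mass :: "nat \<Rightarrow> real \<Rightarrow> real \<Rightarrow> real \<Rightarrow> real" where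
  "pair_mass n \<delta> t s = (\<integral>(x, y). cos_kernel n (x - y) * smooth_pos \<delta> (u t x - v s y) \<partial>torus2)"

abbreviation kernelU where "kernelU n \<equiv> \<lambda>(y, x). cos_kernel n (x - y)"
abbreviation kernelU' where "kernelU' n \<equiv> \<lambda>(y, x). cos_kernel' n (x - y)"
abbreviation kernelV where "kernelV n \<equiv> \<lambda>(x, y). cos_kernel n (x - y)"
abbreviation kernelV' where "kernelV' n \<equiv> \<lambda>(x, y). - cos_kernel' n (x - y)"

lemma kernel_bound:
  obtains R where "0 \<le> R" "U.doubling_kernel (kernelU n) (kernelU' n) R"
    "V.doubling_kernel (kernelV n) (kernelV' n) R"
proof -
  note K = C1_weight_cos_kernel[of n]
  obtain R where R: "\<And>x. \<bar>cos_kernel n x\<bar> \<le> R" "\<And>x. \<bar>cos_kernel' n x\<bar> \<le> R" "0 \<le> R"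
    using C1_weight_bounded[OF K] by metis
  have m: "(\<lambda>p. cos_kernel n (fst p - snd p)) \<in> borel_measurable torus2"
    "(\<lambda>p. cos_kernel' n (fst p - snd p)) \<in> borel_measurable torus2"
    using K by (rule measurable_translate_torus2[OF C1_weight_continuous], intro measurable_translate_torus2)
       (use K in \<open>simp add: C1_weight_def\<close>)
  have m': "(\<lambda>p. cos_kernel n (snd p - fst p)) \<in> borel_measurable torus2"
    "(\<lambda>p. cos_kernel' n (snd p - fst p)) \<in> borel_measurable torus2"
    using measurable_compose[OF measurable_pair_swap' m(1)] measurable_compose[OF measurable_pair_swap' m(2)]
    by (simp_all add: case_prod_beta')
  show ?thesis
  proof (rule that[OF R(3)])
    show "U.doubling_kernel (kernelU n) (kernelU' n) R"
      unfolding U.doubling_kernel_def using m' R C1_weight_translate[OF K] by (simp add: case_prod_beta')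
    show "V.doubling_kernel (kernelV n) (kernelV' n) R"
      unfolding V.doubling_kernel_def using m R C1_weight_reflect[OF K] by (simp add: case_prod_beta')
  qed
qed

lemma pair_mass_V: "V.doubled_mass (- 1) \<delta> (u t) (kernelV n) s = pair_mass n \<delta> t s"
  by (simp add: V.doubled_mass_def pair_mass_def)

lemma pair_mass_U:
  assumes "0 < \<delta>" and t: "0 \<le> t" "t \<le> T" and s: "0 \<le> s" "s \<le> T"
  shows "U.doubled_mass 1 \<delta> (v s) (kernelU n) t = pair_mass n \<delta> t s"
proof -
  obtain R where "0 \<le> R" "U.doubling_kernel (kernelU n) (kernelU' n) R"
    using kernel_bound by metis
  note i = U.doubled_integral(1)[OF _ assms(1) this(2) V.u_meas[OF s] V.u_le[OF s] U.u_meas[OF t] U.u_le[OF t], of 1]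
  have "(\<integral>(x, y). (\<lambda>(y, x). kernelU n (y, x) * smooth_pos \<delta> (1 * (u t x - v s y))) (y, x) \<partial>torus2)
    = (\<integral>(y, x). kernelU n (y, x) * smooth_pos \<delta> (1 * (u t x - v s y)) \<partial>torus2)"
    by (rule torus_torus.integral_product_swap) (rule borel_measurable_integrable, rule i, simp)
  then show ?thesis
    by (simp add: U.doubled_mass_def pair_mass_def)
qed

text \<open>
At equal times the two rates add up to at most the error of the coefficient: the derivatives of the
kernel in \<open>x\<close> and in \<open>y\<close> are opposite and the Kruzhkov flux is symmetric under the exchange of
solution and companion together with the change of \<open>\<sigma>\<close>, so the flux terms cancel, and the damping
terms combine to \<open>\<rho> smooth_sgn (g - h)\<close>.
\<close>

lemma diagonal_rate:
  assumes \<delta>: "0 < \<delta>"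
  shows "AE t in timespan T.
    U.doubled_rate 1 \<delta> (v t) (kernelU n) (kernelU' n) t
      + V.doubled_rate (- 1) \<delta> (u t) (kernelV n) (kernelV' n) t \<le> C * kernel_variation n b"
  using U.w_eq V.w_eq damping AE_space
proof eventually_elim
  fix t
  assume u: "AE x in torus. u t x = w (t, x)" and v: "AE y in torus. v t y = z (t, y)"
    and d: "AE x in torus. AE y in torus.
      z (t, y) < w (t, x) \<longrightarrow> - (C * \<bar>b x - b y\<bar>) \<le> h (t, x) - g (t, y)"
    and t: "t \<in> space (timespan T)"
  then have t': "0 \<le> t" "t \<le> T" "t \<in> {0..T}" by auto
  obtain R where R: "0 \<le> R" "U.doubling_kernel (kernelU n) (kernelU' n) R"
    "V.doubling_kernel (kernelV n) (kernelV' n) R"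
    using kernel_bound by metis
  note K0 = cos_kernel_nonneg
  let ?FU = "\<lambda>(y, x). U.kruzhkov_integrand 1 \<delta> (v t y) (kernelU n (y, x)) (kernelU' n (y, x)) t x"
  let ?FV = "\<lambda>(x, y). V.kruzhkov_integrand (- 1) \<delta> (u t x) (kernelV n (x, y)) (kernelV' n (x, y)) t y"
  have iU: "integrable torus2 ?FU"
    by (rule U.doubled_rate_integral[OF _ \<delta> R(2) V.u_meas V.u_le]) (use t' in auto)
  have iV: "integrable torus2 ?FV"
    by (rule V.doubled_rate_integral[OF _ \<delta> R(3) U.u_meas U.u_le]) (use t' in auto)
  have iU': "integrable torus2 (\<lambda>(x, y). ?FU (y, x))"
    by (rule torus_torus.integrable_product_swap[OF iU])
  have sU: "(\<integral>(x, y). ?FU (y, x) \<partial>torus2) = (\<integral>p. ?FU p \<partial>torus2)"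
    by (rule torus_torus.integral_product_swap) (rule borel_measurable_integrable[OF iU])
  have iK: "integrable torus2 (\<lambda>p. cos_kernel n (fst p - snd p) * \<bar>b (fst p) - b (snd p)\<bar>)"
    by (rule integrable_kernel_variation[OF b_meas b_le])
  have "U.doubled_rate 1 \<delta> (v t) (kernelU n) (kernelU' n) t
      + V.doubled_rate (- 1) \<delta> (u t) (kernelV n) (kernelV' n) t
      = (\<integral>p. (\<lambda>(x, y). ?FU (y, x)) p + ?FV p \<partial>torus2)"
    unfolding U.doubled_rate_def V.doubled_rate_def
    using Bochner_Integration.integral_add[OF iU' iV] sU by (simp only: prod.case)
  also have "\<dots> \<le> (\<integral>p. C * (cos_kernel n (fst p - snd p) * \<bar>b (fst p) - b (snd p)\<bar>) \<partial>torus2)"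
  proof (rule integral_mono_AE[OF Bochner_Integration.integrable_add[OF iU' iV] integrable_mult_right[OF iK]])
    note [measurable] = borel_measurable_integrable[OF iU'] borel_measurable_integrable[OF iV]
      borel_measurable_integrable[OF iK]
    show "AE p in torus2. (\<lambda>(x, y). ?FU (y, x)) p + ?FV p
       \<le> C * (cos_kernel n (fst p - snd p) * \<bar>b (fst p) - b (snd p)\<bar>)"
    proof (rule torus_torus.AE_pair_measure)
      show "{p \<in> space torus2. (\<lambda>(x, y). ?FU (y, x)) p + ?FV p
       \<le> C * (cos_kernel n (fst p - snd p) * \<bar>b (fst p) - b (snd p)\<bar>)} \<in> sets torus2"
        by measurable
      let ?s = "\<lambda>x y. U.kruzhkov_integrand 1 \<delta> (v t y) (cos_kernel n (x - y)) (cos_kernel' n (x - y)) t x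
          + V.kruzhkov_integrand (- 1) \<delta> (u t x) (cos_kernel n (x - y)) (- cos_kernel' n (x - y)) t y"
      have "AE x in torus. AE y in torus.
          ?s x y
          \<le> C * (cos_kernel n (x - y) * \<bar>b x - b y\<bar>)"
        using u d
      proof eventually_elim
        fix x assume ux: "u t x = w (t, x)"
          and dx: "AE y in torus. z (t, y) < w (t, x) \<longrightarrow> - (C * \<bar>b x - b y\<bar>) \<le> h (t, x) - g (t, y)"
        show "AE y in torus.
          ?s x y
          \<le> C * (cos_kernel n (x - y) * \<bar>b x - b y\<bar>)"
          using dx v
        proof eventually_elim
          fix y assume d: "z (t, y) < w (t, x) \<longrightarrow> - (C * \<bar>b x - b y\<bar>) \<le> h (t, x) - g (t, y)"
            and vy: "v t y = z (t, y)"
          let ?S = "smooth_sgn \<delta> (w (t, x) - z (t, y))" and ?k = "cos_kernel n (x - y)"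
          have "?s x y
              = ?k * (?S * (g (t, y) - h (t, x)))"
            by (simp add: U.kruzhkov_integrand_def V.kruzhkov_integrand_def ux vy
                kruzhkov_flux_swap algebra_simps)
          also have "\<dots> \<le> ?k * (C * \<bar>b x - b y\<bar>)"
          proof (rule mult_left_mono[OF _ K0])
            show "?S * (g (t, y) - h (t, x)) \<le> C * \<bar>b x - b y\<bar>"
            proof (cases "z (t, y) < w (t, x)")
              case True
              then have "?S * (g (t, y) - h (t, x)) \<le> ?S * (C * \<bar>b x - b y\<bar>)"
                using d by (intro mult_left_mono smooth_sgn_bounds \<delta>) auto
              also have "\<dots> \<le> 1 * (C * \<bar>b x - b y\<bar>)"
                by (intro mult_right_mono smooth_sgn_bounds \<delta> mult_nonneg_nonneg C_nonneg) auto
              finally show ?thesis by simp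
            next
              case False
              then show ?thesis using C_nonneg by (simp add: smooth_sgn_nonpos[OF \<delta>])
            qed
          qed
          also have "?k * (C * \<bar>b x - b y\<bar>) = C * (?k * \<bar>b x - b y\<bar>)" by simp
          finally show "?s x y
              \<le> C * (?k * \<bar>b x - b y\<bar>)" .
        qed
      qed
      then show "AE x in torus. AE y in torus. (\<lambda>(x, y). ?FU (y, x)) (x, y) + ?FV (x, y)
       \<le> C * (cos_kernel n (fst (x, y) - snd (x, y)) * \<bar>b (fst (x, y)) - b (snd (x, y))\<bar>)"
        by (simp only: prod.case fst_conv snd_conv)
    qed
  qed
  also have "\<dots> = C * kernel_variation n b" by (simp add: kernel_variation_def)
  finally show "U.doubled_rate 1 \<delta> (v t) (kernelU n) (kernelU' n) t
      + V.doubled_rate (- 1) \<delta> (u t) (kernelV n) (kernelV' n) t \<le> C * kernel_variation n b" .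
qed

text \<open>
Write \<open>G(c, c) - G(a, a)\<close> as \<open>(G(c, c) - G(a, c)) + (G(a, c) - G(a, a))\<close>. The two increments are
controlled by the rates with the frozen companions \<open>v c\<close> and \<open>u a\<close>, and on a short interval these are
close in \<open>L\<^sup>1\<close> to \<open>v t\<close> and \<open>u t\<close>, for which \<open>diagonal_rate\<close> applies. The bound on short intervals
is propagated to \<open>[0, T']\<close> by bisection.
\<close>

theorem pair_mass_bound:
  assumes \<delta>: "0 < \<delta>" and R: "0 \<le> R" "U.doubling_kernel (kernelU n) (kernelU' n) R"
    "V.doubling_kernel (kernelV n) (kernelV' n) R" and T': "0 \<le> T'" "T' < T"
  shows "pair_mass n \<delta> T' T' - pair_mass n \<delta> 0 0 \<le> (C * kernel_variation n b + 2 * (R * (L * \<delta>))) * T'"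
proof -
  let ?m = "\<lambda>t. pair_mass n \<delta> t t"
  define D where "D = C * kernel_variation n b"
  define Q where "Q = R * (2 * L) + R * (1 / \<delta>) * H"
  define E where "E = D + 2 * (R * (L * \<delta>))"
  have Q0: "0 \<le> Q" using R(1) U.L_nonneg U.H_nonneg \<delta> by (simp add: Q_def)
  have local: "?m T' - ?m 0 \<le> (E + e) * (T' - 0)" if e: "0 < e" for e
  proof -
    \<comment> \<open>Each of the two frozen companions costs at most \<open>Q e'\<close>, where \<open>Q\<close> is the Lipschitz constant of the rate.\<close>
    define e' where "e' = e / (2 * (Q + 1))"
    have e': "0 < e'" using e Q0 by (simp add: e'_def)
    have Qe: "2 * (Q * e') \<le> e"
    proof -
      have "2 * (Q * e') \<le> 2 * ((Q + 1) * e')" using e' by (simp add: mult_right_mono)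
      also have "\<dots> = e" using Q0 by (simp add: e'_def field_simps)
      finally show ?thesis .
    qed
    have "0 \<le> (0::real) \<longrightarrow> T' \<le> T' \<longrightarrow>
        ?m T' - ?m 0 \<le> (E + e) * (T' - 0)"
    proof (rule Bolzano[OF T'(1), of "\<lambda>a c. 0 \<le> a \<longrightarrow> c \<le> T' \<longrightarrow>
        ?m c - ?m a \<le> (E + e) * (c - a)"])
      fix a m c :: real
      assume 1: "0 \<le> a \<longrightarrow> m \<le> T' \<longrightarrow> ?m m - ?m a \<le> (E + e) * (m - a)"
        and 2: "0 \<le> m \<longrightarrow> c \<le> T' \<longrightarrow> ?m c - ?m m \<le> (E + e) * (c - m)"
        and le: "a \<le> m" "m \<le> c"
      show "0 \<le> a \<longrightarrow> c \<le> T' \<longrightarrow> ?m c - ?m a \<le> (E + e) * (c - a)"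
      proof (intro impI)
        assume "0 \<le> a" "c \<le> T'"
        then have "?m c - ?m a
            \<le> (E + e) * (m - a) + (E + e) * (c - m)"
          using 1 2 le by linarith
        then show "?m c - ?m a \<le> (E + e) * (c - a)"
          by (simp add: distrib_left[symmetric])
      qed
    next
      fix s assume s: "0 \<le> s" "s \<le> T'"
      then have sT: "0 \<le> s" "s \<le> T" using T' by auto
      obtain d1 where d1: "0 < d1" "\<And>t t'. t \<in> {0..T} \<Longrightarrow> t' \<in> {0..T} \<Longrightarrow> \<bar>t - s\<bar> < d1 \<Longrightarrow> \<bar>t' - s\<bar> < d1 \<Longrightarrow>
         (\<integral>x. \<bar>u t x - u t' x\<bar> \<partial>torus) \<le> e'"
        using U.continuity_modulus[OF sT e'] by blast
      obtain d2 where d2: "0 < d2" "\<And>t t'. t \<in> {0..T} \<Longrightarrow> t' \<in> {0..T} \<Longrightarrow> \<bar>t - s\<bar> < d2 \<Longrightarrow> \<bar>t' - s\<bar> < d2 \<Longrightarrow>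
         (\<integral>x. \<bar>v t x - v t' x\<bar> \<partial>torus) \<le> e'"
        using V.continuity_modulus[OF sT e'] by blast
      show "\<exists>d>0. \<forall>a c. a \<le> s \<and> s \<le> c \<and> c - a < d \<longrightarrow> 0 \<le> a \<longrightarrow> c \<le> T' \<longrightarrow>
          ?m c - ?m a \<le> (E + e) * (c - a)"
      proof (intro exI[of _ "min d1 d2"] conjI allI impI)
        fix a c assume "a \<le> s \<and> s \<le> c \<and> c - a < min d1 d2" and a0: "0 \<le> a" and cT: "c \<le> T'"
        then have as: "a \<le> s" "s \<le> c" "c - a < d1" "c - a < d2" by auto
        have a: "0 \<le> a" "a \<le> T" and c: "0 \<le> c" "c \<le> T" "c < T" and ac: "a \<le> c"
          using as a0 cT T' by auto
        let ?i = "indicator {a..c} :: real \<Rightarrow> real"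
        let ?U = "\<lambda>r. U.doubled_rate 1 \<delta> r (kernelU n) (kernelU' n)"
        let ?V = "\<lambda>r. V.doubled_rate (- 1) \<delta> r (kernelV n) (kernelV' n)"
        note incU = U.doubled_increment[OF _ \<delta> R(2) V.u_meas[OF c(1,2)] V.u_le[OF c(1,2)] a(1) ac c(3), of 1]
        note incV = V.doubled_increment[OF _ \<delta> R(3) U.u_meas[OF a] U.u_le[OF a] a(1) ac c(3), of "- 1"]
        note ii = integral_timespan_Icc[OF a(1) ac c(2)]
        have iU: "integrable (timespan T) (\<lambda>t. ?i t * ?U (v c) t)" by (rule incU) simp
        have iV: "integrable (timespan T) (\<lambda>t. ?i t * ?V (u a) t)" by (rule incV) simp
        have 1: "?m c - pair_mass n \<delta> a c
            \<le> (\<integral>t. ?i t * ?U (v c) t \<partial>timespan T) + R * (L * \<delta>) * (c - a)"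
          using incU(2) pair_mass_U[OF \<delta> c(1,2) c(1,2)] pair_mass_U[OF \<delta> a c(1,2)] by simp
        have 2: "pair_mass n \<delta> a c - ?m a
            \<le> (\<integral>t. ?i t * ?V (u a) t \<partial>timespan T) + R * (L * \<delta>) * (c - a)"
          using incV(2) by (simp add: pair_mass_V)
        have "(\<integral>t. ?i t * ?U (v c) t + ?i t * ?V (u a) t \<partial>timespan T) \<le> (\<integral>t. (D + e) * ?i t \<partial>timespan T)"
        proof (rule integral_mono_AE)
          show "AE t in timespan T. ?i t * ?U (v c) t + ?i t * ?V (u a) t \<le> (D + e) * ?i t"
            using diagonal_rate[OF \<delta>, of n]
          proof eventually_elim
            fix t assume diag: "?U (v t) t + ?V (u t) t \<le> C * kernel_variation n b"
            show "?i t * ?U (v c) t + ?i t * ?V (u a) t \<le> (D + e) * ?i t"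
            proof (cases "t \<in> {a..c}")
              case True
              then have t: "0 \<le> t" "t \<le> T" "t \<in> {0..T}" using a c by auto
              have "\<bar>?U (v c) t - ?U (v t) t\<bar> \<le> Q * (\<integral>y. \<bar>v c y - v t y\<bar> \<partial>torus)"
                unfolding Q_def
                by (rule U.doubled_rate_lipschitz[OF _ \<delta> R(2) V.u_meas[OF c(1,2)] V.u_le[OF c(1,2)]
                     V.u_meas[OF t(1,2)] V.u_le[OF t(1,2)] t(3)]) simp
              also have "\<dots> \<le> Q * e'"
                using True as c t by (intro mult_left_mono[OF _ Q0] d2) auto
              finally have 3: "?U (v c) t - ?U (v t) t \<le> Q * e'" by linarith
              have "\<bar>?V (u a) t - ?V (u t) t\<bar> \<le> Q * (\<integral>y. \<bar>u a y - u t y\<bar> \<partial>torus)"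
                unfolding Q_def
                by (rule V.doubled_rate_lipschitz[OF _ \<delta> R(3) U.u_meas[OF a] U.u_le[OF a]
                     U.u_meas[OF t(1,2)] U.u_le[OF t(1,2)] t(3)]) simp
              also have "\<dots> \<le> Q * e'"
                using True as a t by (intro mult_left_mono[OF _ Q0] d1) auto
              finally have 4: "?V (u a) t - ?V (u t) t \<le> Q * e'" by linarith
              have "?U (v c) t + ?V (u a) t \<le> D + e"
                using 3 4 diag Qe unfolding D_def by linarith
              then show ?thesis using True by simp
            next
              case False
              then show ?thesis by simp
            qed
          qed
        qed (use iU iV ii in auto)
        also have "\<dots> = (D + e) * (c - a)" using ii by simp
        finally have "(\<integral>t. ?i t * ?U (v c) t \<partial>timespan T) + (\<integral>t. ?i t * ?V (u a) t \<partial>timespan T)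
            \<le> (D + e) * (c - a)"
          using Bochner_Integration.integral_add[OF iU iV] by linarith
        then have "?m c - ?m a
            \<le> (D + e) * (c - a) + (R * (L * \<delta>) * (c - a) + R * (L * \<delta>) * (c - a))"
          using 1 2 by linarith
        also have "\<dots> = (E + e) * (c - a)" by (simp add: E_def algebra_simps)
        finally show "?m c - ?m a
            \<le> (E + e) * (c - a)" .
      qed (use d1 d2 in auto)
    qed
    then show ?thesis by simp
  qed
  show ?thesis
  proof (cases "T' = 0")
    case False
    then have T0: "0 < T'" using T' by simp
    show ?thesis
    proof (rule field_le_epsilon)
      fix e :: real assume "0 < e"
      then have "0 < e / T'" using T0 by simp
      from local[OF this] show "?m T' - ?m 0
          \<le> (C * kernel_variation n b + 2 * (R * (L * \<delta>))) * T' + e"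
        using T0 by (simp add: D_def E_def distrib_right)
    qed
  qed simp
qed

lemma pair_mass_initial:
  assumes \<delta>: "0 < \<delta>"
  shows "pair_mass n \<delta> 0 0 \<le> smeared_excess n u0 v0"
proof -
  obtain R where R: "0 \<le> R" "U.doubling_kernel (kernelU n) (kernelU' n) R"
    "V.doubling_kernel (kernelV n) (kernelV' n) R"
    using kernel_bound by metis
  have T0: "0 \<le> (0::real)" "0 \<le> T" using U.T_pos by auto
  note K0 = cos_kernel_nonneg
  have "pair_mass n \<delta> 0 0 = U.doubled_mass 1 \<delta> (v 0) (kernelU n) 0"
    by (rule pair_mass_U[OF \<delta> T0 T0, symmetric])
  also have "\<dots> \<le> (\<integral>(y, x). kernelU n (y, x) * smooth_pos \<delta> (1 * (u0 x - v 0 y)) \<partial>torus2)"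
    by (rule U.doubled_initial[OF _ \<delta> R(2) V.u_meas[OF T0] V.u_le[OF T0]]) simp
  also have "\<dots> = (\<integral>(x, y). (\<lambda>(y, x). kernelU n (y, x) * smooth_pos \<delta> (1 * (u0 x - v 0 y))) (y, x) \<partial>torus2)"
    by (rule torus_torus.integral_product_swap[symmetric])
       (rule borel_measurable_integrable,
        rule U.doubled_integral(1)[OF _ \<delta> R(2) V.u_meas[OF T0] V.u_le[OF T0] U.u0_meas U.u0_le], simp)
  also have "\<dots> = V.doubled_mass (- 1) \<delta> u0 (kernelV n) 0"
    by (simp add: V.doubled_mass_def)
  also have "\<dots> \<le> (\<integral>(x, y). kernelV n (x, y) * smooth_pos \<delta> (- 1 * (v0 y - u0 x)) \<partial>torus2)"
    by (rule V.doubled_initial[OF _ \<delta> R(3) U.u0_meas U.u0_le]) simp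
  also have "\<dots> \<le> smeared_excess n u0 v0"
  proof (rule Bochner_Integration.integral_mono)
    show "integrable torus2 (\<lambda>(x, y). kernelV n (x, y) * smooth_pos \<delta> (- 1 * (v0 y - u0 x)))"
      by (rule V.doubled_integral(1)[OF _ \<delta> R(3) U.u0_meas U.u0_le V.u0_meas V.u0_le]) simp
    show "integrable torus2 (\<lambda>(x, y). cos_kernel n (x - y) * max 0 (u0 x - v0 y))"
      by (rule kernel_positive_part(1)[OF U.u0_meas V.u0_meas U.u0_le V.u0_le])
    fix p :: "real \<times> real"
    show "(case p of (x, y) \<Rightarrow> kernelV n (x, y) * smooth_pos \<delta> (- 1 * (v0 y - u0 x)))
        \<le> (case p of (x, y) \<Rightarrow> cos_kernel n (x - y) * max 0 (u0 x - v0 y))"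
      using smooth_pos_bounds(2)[OF \<delta>] K0 by (cases p) (auto intro!: mult_left_mono)
  qed
  finally show ?thesis .
qed

lemma pair_mass_lower:
  assumes \<delta>: "0 < \<delta>" and t: "0 \<le> t" "t \<le> T"
  shows "smeared_excess n (u t) (v t) \<le> pair_mass n \<delta> t t + \<delta>"
proof -
  obtain R where R: "0 \<le> R" "U.doubling_kernel (kernelU n) (kernelU' n) R"
    "V.doubling_kernel (kernelV n) (kernelV' n) R"
    using kernel_bound by metis
  note K0 = cos_kernel_nonneg
  have i1: "integrable torus2 (\<lambda>(x, y). cos_kernel n (x - y) * max 0 (u t x - v t y))"
    by (rule kernel_positive_part(1)[OF U.u_meas[OF t] V.u_meas[OF t] U.u_le[OF t] V.u_le[OF t]])
  have "integrable torus2 (\<lambda>(x, y). kernelV n (x, y) * smooth_pos \<delta> (- 1 * (v t y - u t x)))"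
    by (rule V.doubled_integral(1)[OF _ \<delta> R(3) U.u_meas[OF t] U.u_le[OF t] V.u_meas[OF t] V.u_le[OF t]]) simp
  then have i2: "integrable torus2 (\<lambda>p. cos_kernel n (fst p - snd p) * smooth_pos \<delta> (u t (fst p) - v t (snd p)))"
    by (simp add: case_prod_beta')
  have k3: "(\<integral>p. cos_kernel n (fst p - snd p) * \<delta> \<partial>torus2) = \<delta>"
    and k1: "integrable torus2 (\<lambda>p. cos_kernel n (fst p - snd p) * \<delta>)"
    using cos_kernel_mean[of "\<lambda>_. \<delta>" "\<bar>\<delta>\<bar>" n] by auto
  have "smeared_excess n (u t) (v t)
      \<le> (\<integral>p. cos_kernel n (fst p - snd p) * smooth_pos \<delta> (u t (fst p) - v t (snd p))
          + cos_kernel n (fst p - snd p) * \<delta> \<partial>torus2)"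
  proof (rule Bochner_Integration.integral_mono[OF i1 Bochner_Integration.integrable_add[OF i2 k1]])
    fix p :: "real \<times> real"
    have "cos_kernel n (fst p - snd p) * max 0 (u t (fst p) - v t (snd p))
       \<le> cos_kernel n (fst p - snd p) * (smooth_pos \<delta> (u t (fst p) - v t (snd p)) + \<delta>)"
      using smooth_pos_bounds(1)[OF \<delta>, of "u t (fst p) - v t (snd p)"] by (intro mult_left_mono K0) linarith
    then show "(case p of (x, y) \<Rightarrow> cos_kernel n (x - y) * max 0 (u t x - v t y))
       \<le> cos_kernel n (fst p - snd p) * smooth_pos \<delta> (u t (fst p) - v t (snd p))
          + cos_kernel n (fst p - snd p) * \<delta>"
      by (simp add: case_prod_beta' distrib_left)
  qed
  also have "\<dots> = pair_mass n \<delta> t t + \<delta>"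
    using Bochner_Integration.integral_add[OF i2 k1] k3 by (simp add: pair_mass_def case_prod_beta')
  finally show ?thesis .
qed

text \<open>
The limits are taken in the order \<open>\<delta> \<rightarrow> 0\<close> for a fixed kernel, and then \<open>n \<rightarrow> \<infinity>\<close>: the flux error is
\<open>\<delta>\<close> times a bound for the derivative of the kernel, which grows with \<open>n\<close>.
\<close>

theorem comparison:
  assumes t: "0 \<le> t" "t < T"
  shows "(\<integral>x. max 0 (u t x - v t x) \<partial>torus) \<le> (\<integral>x. max 0 (u0 x - v0 x) \<partial>torus)"
proof -
  have t': "0 \<le> t" "t \<le> T" using t by auto
  note kp = kernel_positive_part[OF U.u_meas[OF t'] V.u_meas[OF t'] U.u_le[OF t'] V.u_le[OF t']]
  note kp0 = kernel_positive_part[OF U.u0_meas V.u0_meas U.u0_le V.u0_le]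
  have le: "(\<integral>x. max 0 (u t x - v t x) \<partial>torus) \<le> (\<integral>x. max 0 (u0 x - v0 x) \<partial>torus)
     + (kernel_variation n (v t) + kernel_variation n v0 + C * kernel_variation n b * t)" for n
  proof -
    obtain R where R: "0 \<le> R" "U.doubling_kernel (kernelU n) (kernelU' n) R"
      "V.doubling_kernel (kernelV n) (kernelV' n) R"
      using kernel_bound by metis
    have "smeared_excess n (u t) (v t)
       \<le> smeared_excess n u0 v0 + C * kernel_variation n b * t"
    proof (rule field_le_epsilon)
      fix e :: real assume e: "0 < e"
      \<comment> \<open>All errors in \<open>\<delta>\<close> sum up to \<open>q \<delta>\<close>: one \<open>\<delta>\<close> from the regularised positive part, the rest from the flux.\<close>
      define q where "q = 1 + 2 * (R * L) * t"
      have q: "0 < q" using R(1) U.L_nonneg t by (simp add: q_def add_pos_nonneg)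
      define \<delta> where "\<delta> = e / q"
      have \<delta>: "0 < \<delta>" using e q by (simp add: \<delta>_def)
      have "smeared_excess n (u t) (v t)
          \<le> smeared_excess n u0 v0
            + (C * kernel_variation n b + 2 * (R * (L * \<delta>))) * t + \<delta>"
        using pair_mass_bound[OF \<delta> R t] pair_mass_initial[OF \<delta>, of n] pair_mass_lower[OF \<delta> t', of n]
        by linarith
      also have "\<dots> = smeared_excess n u0 v0
            + C * kernel_variation n b * t + q * \<delta>"
        by (simp add: q_def algebra_simps)
      also have "q * \<delta> = e" using q by (simp add: \<delta>_def)
      finally show "smeared_excess n (u t) (v t)
       \<le> smeared_excess n u0 v0 + C * kernel_variation n b * t + e" .
    qed
    then show ?thesis using kp(3)[of n] kp0(2)[of n] by linarith
  qed
  have "(\<lambda>n. (\<integral>x. max 0 (u0 x - v0 x) \<partial>torus)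
     + (kernel_variation n (v t) + kernel_variation n v0 + C * kernel_variation n b * t))
     \<longlonglongrightarrow> (\<integral>x. max 0 (u0 x - v0 x) \<partial>torus) + (0 + 0 + C * 0 * t)"
    by (intro tendsto_intros kernel_variation_tendsto_0[OF V.u_meas[OF t'] V.u_le[OF t']]
        kernel_variation_tendsto_0[OF V.u0_meas V.u0_le] kernel_variation_tendsto_0[OF b_meas b_le])
  then have "(\<integral>x. max 0 (u t x - v t x) \<partial>torus)
      \<le> (\<integral>x. max 0 (u0 x - v0 x) \<partial>torus) + (0 + 0 + C * 0 * t)"
    by (rule LIMSEQ_le_const) (use le in auto)
  then show ?thesis by simp
qed

end

text \<open>
A constant \<open>k\<close> acts as a supersolution (\<open>\<sigma> = 1\<close>) or subsolution (\<open>\<sigma> = -1\<close>). With the weight 1 there is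
no flux term, and the damping only decreases \<open>\<integral>(\<sigma> (u - k))\<^sup>+\<close>, which is 0 initially.
\<close>

theorem (in C1_flux_flow) one_sided_bound:
  assumes \<sigma>: "\<sigma> = 1 \<or> \<sigma> = -1" and k: "\<bar>k\<bar> \<le> M"
    and init: "AE x in torus. \<sigma> * (u0 x - k) \<le> 0"
    and damp: "AE t in timespan T. AE x in torus. 0 < \<sigma> * (w (t, x) - k) \<longrightarrow> 0 \<le> \<sigma> * h (t, x)"
    and t: "0 \<le> t" "t < T"
  shows "AE x in torus. \<sigma> * (u t x - k) \<le> 0"
proof -
  have W: "C1_weight (\<lambda>_. 1) (\<lambda>_. 0)" by (simp add: C1_weight_def periodic_def)
  have one: "0 < (1::real)" by simp
  let ?I = "\<lambda>t x. kruzhkov_integrand \<sigma> 1 k 1 0 t x"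
  have "AE t in timespan T. indicator {0..t'} t * (\<integral>x. ?I t x \<partial>torus) \<le> 0" for t'
    using damp
  proof eventually_elim
    fix s assume d: "AE x in torus. 0 < \<sigma> * (w (s, x) - k) \<longrightarrow> 0 \<le> \<sigma> * h (s, x)"
    have "AE x in torus. 0 \<le> - ?I s x"
      using d
    proof eventually_elim
      fix x assume d: "0 < \<sigma> * (w (s, x) - k) \<longrightarrow> 0 \<le> \<sigma> * h (s, x)"
      have "- ?I s x = smooth_sgn 1 (\<sigma> * (w (s, x) - k)) * (\<sigma> * h (s, x))"
        by (simp add: kruzhkov_integrand_def)
      also have "0 \<le> \<dots>"
      proof (cases "0 < \<sigma> * (w (s, x) - k)")
        case True
        then show ?thesis using d by (intro mult_nonneg_nonneg[OF smooth_sgn_bounds(1)[OF one]]) simp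
      next
        case False
        then show ?thesis by (simp add: smooth_sgn_nonpos)
      qed
      finally show "0 \<le> - ?I s x" .
    qed
    then have "0 \<le> (\<integral>x. - ?I s x \<partial>torus)" by (rule integral_nonneg_AE)
    then show "indicator {0..t'} s * (\<integral>x. ?I s x \<partial>torus) \<le> 0"
      by (simp add: indicator_def)
  qed
  then have "AE s in timespan T. 0 \<le> - (indicator {0..t} s * (\<integral>x. ?I s x \<partial>torus))" by simp
  then have "0 \<le> (\<integral>s. - (indicator {0..t} s * (\<integral>x. ?I s x \<partial>torus)) \<partial>timespan T)"
    by (rule integral_nonneg_AE)
  then have J: "(\<integral>s. indicator {0..t} s * (\<integral>x. ?I s x \<partial>torus) \<partial>timespan T) \<le> 0" by simp
  obtain q where E: "C1_entropy f (\<lambda>x. smooth_pos 1 (\<sigma> * (x - k))) (\<lambda>x. \<sigma> * smooth_sgn 1 (\<sigma> * (x - k))) q"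
    using kruzhkov_entropy[OF f_deriv f'_cont f'_le k \<sigma> one] by blast
  have "(\<integral>x. 1 * smooth_pos 1 (\<sigma> * (u0 x - k)) \<partial>torus) = (\<integral>x. 0 \<partial>torus)"
  proof (rule integral_cong_AE)
    show "AE x in torus. 1 * smooth_pos 1 (\<sigma> * (u0 x - k)) = 0"
      using init by eventually_elim (simp add: smooth_pos_eq_0_iff)
    show "(\<lambda>x. 1 * smooth_pos 1 (\<sigma> * (u0 x - k))) \<in> borel_measurable torus"
      unfolding smooth_pos_def by measurable
  qed simp
  then have "mass (\<lambda>x. smooth_pos 1 (\<sigma> * (x - k))) (\<lambda>_. 1) 0 \<le> 0"
    using entropy_initial[OF E W] by simp
  then have "mass (\<lambda>x. smooth_pos 1 (\<sigma> * (x - k))) (\<lambda>_. 1) t \<le> 0"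
    using kruzhkov_increment[OF \<sigma> one k W, of 1 0 0 t] J t by simp
  then have le: "(\<integral>x. smooth_pos 1 (\<sigma> * (u t x - k)) \<partial>torus) \<le> 0" by (simp add: mass_def)
  have nn: "0 \<le> smooth_pos 1 (\<sigma> * (u t x - k))" for x by (rule smooth_pos_bounds(3)) simp
  have [measurable]: "u t \<in> borel_measurable torus" using u_meas t by simp
  have int: "integrable torus (\<lambda>x. smooth_pos 1 (\<sigma> * (u t x - k)))"
  proof (rule torus.integrable_const_bound[where B="2 * M"])
    have "norm (smooth_pos 1 (\<sigma> * (u t x - k))) \<le> 2 * M" for x
    proof -
      have "smooth_pos 1 (\<sigma> * (u t x - k)) \<le> max 0 (\<sigma> * (u t x - k))" by (rule smooth_pos_bounds(2)) simp
      moreover have "\<sigma> * (u t x - k) \<le> 2 * M" using \<sigma> u_le[of t x] t k by auto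
      ultimately show ?thesis using nn[of x] M_nonneg by simp
    qed
    then show "AE x in torus. norm (smooth_pos 1 (\<sigma> * (u t x - k))) \<le> 2 * M" by simp
    show "(\<lambda>x. smooth_pos 1 (\<sigma> * (u t x - k))) \<in> borel_measurable torus"
      unfolding smooth_pos_def by measurable
  qed
  have "(\<integral>x. smooth_pos 1 (\<sigma> * (u t x - k)) \<partial>torus) = 0"
    using le Bochner_Integration.integral_nonneg[of torus, OF nn] by (rule antisym)
  then have "AE x in torus. smooth_pos 1 (\<sigma> * (u t x - k)) = 0"
    using integral_nonneg_eq_0_iff_AE[OF int] nn by simp
  then show ?thesis by eventually_elim (simp add: smooth_pos_eq_0_iff)
qed

section \<open>From admissible solutions to entropy flows\<close>

text \<open>
The possibly multivalued \<open>w / \<bar>w\<bar>\<^sup>\<alpha>\<close>. This form covers \<open>\<alpha> < 1\<close> and \<open>\<alpha> = 1\<close> at the same time: in both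
cases the damping is \<open>a x * s\<close> for some \<open>s\<close> in the graph.
\<close>

definition damping_graph :: "real \<Rightarrow> real \<Rightarrow> real set" where
  "damping_graph \<alpha> r = (if \<alpha> < 1 then {r / \<bar>r\<bar> powr \<alpha>} else Sign r)"

lemma damping_power: "0 < (r::real) \<Longrightarrow> r / \<bar>r\<bar> powr \<alpha> = r powr (1 - \<alpha>)"
  by (simp add: powr_diff)

lemma damping_power_neg: "(r::real) < 0 \<Longrightarrow> r / \<bar>r\<bar> powr \<alpha> = - ((- r) powr (1 - \<alpha>))"
  by (simp add: powr_diff)

lemma damping_graph_sign:
  assumes "s \<in> damping_graph \<alpha> r"
  shows "0 < r \<Longrightarrow> 0 \<le> s" "r < 0 \<Longrightarrow> s \<le> 0"
  using assms by (auto simp: damping_graph_def Sign_def divide_nonpos_nonneg split: if_splits)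

lemma damping_graph_mono:
  assumes "\<alpha> \<le> 1" "s \<in> damping_graph \<alpha> r" "s' \<in> damping_graph \<alpha> r'" "r' < r"
  shows "s' \<le> s"
proof (cases "\<alpha> < 1")
  case True
  then have s: "s = r / \<bar>r\<bar> powr \<alpha>" "s' = r' / \<bar>r'\<bar> powr \<alpha>"
    using assms by (auto simp: damping_graph_def)
  consider "0 < r'" | "r < 0" | "r' \<le> 0" "0 \<le> r" by linarith
  then show ?thesis
  proof cases
    case 1
    then show ?thesis
      using True assms(4) unfolding s by (subst (1 2) damping_power) (auto intro: powr_mono2)
  next
    case 2
    then show ?thesis
      using True assms(4) unfolding s by (subst (1 2) damping_power_neg) (auto intro: powr_mono2)
  next
    case 3
    then show ?thesis unfolding s
      by (meson divide_nonneg_nonneg divide_nonpos_nonneg order_trans powr_ge_zero)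
  qed
next
  case False
  then show ?thesis using assms by (auto simp: damping_graph_def Sign_def split: if_splits)
qed

lemma damping_graph_bound:
  assumes "0 < \<alpha>" "\<alpha> \<le> 1" "s \<in> damping_graph \<alpha> r"
  shows "\<bar>s\<bar> \<le> 1 + \<bar>r\<bar>"
proof (cases "\<alpha> < 1 \<and> r \<noteq> 0")
  case True
  then have "\<bar>s\<bar> = \<bar>r\<bar> powr (1 - \<alpha>)"
    using assms(3) damping_power[of r \<alpha>] damping_power_neg[of r \<alpha>]
    by (cases "0 < r") (auto simp: damping_graph_def)
  also have "\<dots> \<le> 1 + \<bar>r\<bar>"
  proof (cases "\<bar>r\<bar> \<le> 1")
    case True
    then have "\<bar>r\<bar> powr (1 - \<alpha>) \<le> 1 powr (1 - \<alpha>)" using assms by (intro powr_mono2) auto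
    then show ?thesis by simp
  next
    case False
    then have "\<bar>r\<bar> powr (1 - \<alpha>) \<le> \<bar>r\<bar> powr 1" using assms by (intro powr_mono) auto
    then show ?thesis using False by simp
  qed
  finally show ?thesis .
next
  case False
  then show ?thesis using assms by (auto simp: damping_graph_def Sign_def split: if_splits)
qed

lemma avg_deriv_eq:
  assumes "(\<eta> has_real_derivative d) (at r)"
  shows "avg_deriv \<eta> r = d"
proof -
  have lim: "((\<lambda>y. (\<eta> y - \<eta> r) / (y - r)) \<longlongrightarrow> d) (at r)"
    using assms by (simp add: has_field_derivative_iff)
  have "((\<lambda>y. (\<eta> y - \<eta> r) / (y - r)) \<longlongrightarrow> d) (at_left r)" "((\<lambda>y. (\<eta> y - \<eta> r) / (y - r)) \<longlongrightarrow> d) (at_right r)"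
    using lim by (auto intro: tendsto_within_subset)
  then have "Lim (at_left r) (\<lambda>y. (\<eta> y - \<eta> r) / (y - r)) = d" "Lim (at_right r) (\<lambda>y. (\<eta> y - \<eta> r) / (y - r)) = d"
    by (auto intro!: tendsto_Lim trivial_limit_at_left_real trivial_limit_at_right_real)
  then show ?thesis by (simp add: avg_deriv_def)
qed

lemma C1_entropy_pair:
  assumes "C1_entropy f \<eta> \<eta>' q"
  shows "entropy_pair f \<eta> q"
proof -
  have "deriv \<eta> r = \<eta>' r" for r
    using assms by (auto simp: C1_entropy_def intro: DERIV_imp_deriv)
  then show ?thesis
    using assms C1_entropy_continuous(3)[OF assms] by (simp add: entropy_pair_def C1_entropy_def)
qed

lemma product_lipschitz_test:
  assumes W: "C1_weight \<rho> \<rho>'" and \<theta>: "\<And>t. (\<theta> has_real_derivative \<theta>' t) (at t)"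
    and \<theta>c: "continuous_on UNIV \<theta>'" and \<theta>0: "\<And>t. 0 \<le> \<theta> t" and \<theta>T: "\<theta> T = 0"
  shows "lipschitz_test T (\<lambda>t x. \<theta> t * \<rho> x)"
proof -
  obtain R where R: "\<And>x. \<bar>\<rho> x\<bar> \<le> R" "\<And>x. \<bar>\<rho>' x\<bar> \<le> R" "0 \<le> R" using C1_weight_bounded[OF W] by metis
  have c0: "continuous_on UNIV \<theta>" by (rule DERIV_continuous_on[OF has_field_derivative_at_within[OF \<theta>]])
  obtain B1 where B1: "0 \<le> B1" "\<And>t. \<bar>t\<bar> \<le> \<bar>T\<bar> \<Longrightarrow> \<bar>\<theta> t\<bar> \<le> B1"
    using bounded_on_symmetric_interval[OF c0] by metis
  obtain B2 where B2: "0 \<le> B2" "\<And>t. \<bar>t\<bar> \<le> \<bar>T\<bar> \<Longrightarrow> \<bar>\<theta>' t\<bar> \<le> B2"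
    using bounded_on_symmetric_interval[OF \<theta>c] by metis
  have lt: "\<bar>\<theta> t - \<theta> s\<bar> \<le> B2 * \<bar>t - s\<bar>" if "t \<in> {0..T}" "s \<in> {0..T}" for t s
  proof -
    have "norm (\<theta> t - \<theta> s) \<le> B2 * norm (t - s)"
      by (rule field_differentiable_bound[OF _ has_field_derivative_at_within[OF \<theta>], of "{0..T}"])
         (use that B2(2) in auto)
    then show ?thesis by simp
  qed
  have lr: "\<bar>\<rho> x - \<rho> y\<bar> \<le> R * \<bar>x - y\<bar>" for x y
  proof -
    have "norm (\<rho> x - \<rho> y) \<le> R * norm (x - y)"
      by (rule field_differentiable_bound[of UNIV \<rho> \<rho>']) (use W R in \<open>auto simp: C1_weight_def\<close>)
    then show ?thesis by simp
  qed
  have "(B2 * R + B1 * R)-lipschitz_on ({0..T} \<times> UNIV) (\<lambda>(t, x). \<theta> t * \<rho> x)"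
  proof (rule lipschitz_onI)
    fix p p' :: "real \<times> real" assume p: "p \<in> {0..T} \<times> UNIV" "p' \<in> {0..T} \<times> UNIV"
    obtain t x s y where pe: "p = (t, x)" "p' = (s, y)" by fastforce
    have ts: "t \<in> {0..T}" "s \<in> {0..T}" using p by (auto simp: pe)
    have d1: "\<bar>t - s\<bar> \<le> dist p p'" and d2: "\<bar>x - y\<bar> \<le> dist p p'"
      using dist_fst_le[of p p'] dist_snd_le[of p p'] by (auto simp: pe dist_real_def)
    have 1: "\<bar>(\<theta> t - \<theta> s) * \<rho> x\<bar> \<le> B2 * dist p p' * R"
      unfolding abs_mult
      by (rule mult_mono[OF order_trans[OF lt[OF ts] mult_left_mono[OF d1 B2(1)]] R(1)]) (use B2 in auto)
    have 2: "\<bar>\<theta> s * (\<rho> x - \<rho> y)\<bar> \<le> B1 * (R * dist p p')"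
      unfolding abs_mult
      by (rule mult_mono[OF B1(2) order_trans[OF lr mult_left_mono[OF d2 R(3)]]]) (use ts B1 in auto)
    have "\<theta> t * \<rho> x - \<theta> s * \<rho> y = (\<theta> t - \<theta> s) * \<rho> x + \<theta> s * (\<rho> x - \<rho> y)"
      by (simp add: algebra_simps)
    then have "\<bar>\<theta> t * \<rho> x - \<theta> s * \<rho> y\<bar> \<le> B2 * dist p p' * R + B1 * (R * dist p p')"
      using 1 2 by linarith
    then show "dist (case p of (t, x) \<Rightarrow> \<theta> t * \<rho> x) (case p' of (t, x) \<Rightarrow> \<theta> t * \<rho> x)
        \<le> (B2 * R + B1 * R) * dist p p'"
      by (simp add: pe dist_real_def algebra_simps)
  qed (use B1 B2 R in simp)
  then have "\<exists>L. L-lipschitz_on ({0..T} \<times> UNIV) (\<lambda>(t, x). \<theta> t * \<rho> x)" by blast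
  then show ?thesis
    using W \<theta>0 \<theta>T by (auto simp: lipschitz_test_def C1_weight_def periodic_def)
qed

lemma integral_cylinder_AE:
  fixes F G :: "real \<times> real \<Rightarrow> real"
  assumes F: "F \<in> borel_measurable borel" and ae: "AE p in cylinder T. F p = G p"
  shows "(\<integral>p. G p \<partial>cylinder T) = (\<integral>p. F p \<partial>cylinder T)"
proof (rule integral_cong_AE)
  show Fm: "F \<in> borel_measurable (cylinder T)"
    unfolding cylinder_def by (intro measurable_restrict_space1 measurable_completion) (use F in simp)
  show "G \<in> borel_measurable (cylinder T)"
    using borel_measurable_lebesgue_on_AE[OF sets_cylinder_domain] Fm ae unfolding cylinder_def by blast
  show "AE p in cylinder T. G p = F p" using ae by eventually_elim simp
qed

text \<open>
The entropy inequality for the test function \<open>\<theta>(t) \<rho>(x)\<close>, transferred to the Borel versions of the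
solution and of the damping, and to a bounded version of the initial datum.
\<close>

lemma iterated_entropy_ineq:
  assumes ineq: "entropy_ineq f T u0 k u" and T: "0 < T"
    and u0': "u0' \<in> borel_measurable torus" "\<And>x. \<bar>u0' x\<bar> \<le> M" "AE x in torus. u0 x = u0' x"
      and u0: "u0 \<in> borel_measurable torus"
    and w: "w \<in> borel_measurable borel" "\<And>p. \<bar>w p\<bar> \<le> M" "AE (t, x) in cylinder T. u t x = w (t, x)"
    and h: "h \<in> borel_measurable borel" "\<And>p. \<bar>h p\<bar> \<le> H" "AE (t, x) in cylinder T. k t x = h (t, x)"
    and E: "C1_entropy f \<eta> \<eta>' q" and W: "C1_weight \<rho> \<rho>'"
    and \<theta>: "\<And>t. (\<theta> has_real_derivative \<theta>' t) (at t)" "continuous_on UNIV \<theta>'" "\<And>t. 0 \<le> \<theta> t" "\<theta> T = 0"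
  shows "0 \<le> (\<integral>t. \<theta>' t * (\<integral>x. \<rho> x * \<eta> (w (t, x)) \<partial>torus)
            + \<theta> t * (\<integral>x. \<rho>' x * q (w (t, x)) - \<rho> x * \<eta>' (w (t, x)) * h (t, x) \<partial>torus) \<partial>timespan T)
          + \<theta> 0 * (\<integral>x. \<rho> x * \<eta> (u0' x) \<partial>torus)"
proof -
  let ?G = "\<lambda>t x. \<theta>' t * \<rho> x * \<eta> (u t x) + \<theta> t * \<rho>' x * q (u t x)
       - \<theta> t * \<rho> x * \<eta>' (u t x) * k t x"
  have \<rho>d: "(\<rho> has_real_derivative \<rho>' x) (at x)" and \<rho>c': "continuous_on UNIV \<rho>'" for x
    using W by (auto simp: C1_weight_def)
  have \<theta>c: "continuous_on UNIV \<theta>" by (rule DERIV_continuous_on[OF has_field_derivative_at_within[OF \<theta>(1)]])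
  have \<eta>d: "avg_deriv \<eta> r = \<eta>' r" for r
    using E by (auto simp: C1_entropy_def intro: avg_deriv_eq)
  have dt: "deriv_t (\<lambda>t x. \<theta> t * \<rho> x) t x = \<theta>' t * \<rho> x" for t x
    unfolding deriv_t_def by (rule DERIV_imp_deriv) (rule DERIV_cmult_right[OF \<theta>(1)])
  have dx: "deriv_x (\<lambda>t x. \<theta> t * \<rho> x) t x = \<theta> t * \<rho>' x" for t x
    unfolding deriv_x_def by (rule DERIV_imp_deriv) (rule DERIV_cmult[OF \<rho>d])
  have "0 \<le> (\<integral>(t, x). ?G t x \<partial>cylinder T) + (\<integral>x. \<theta> 0 * \<rho> x * \<eta> (u0 x) \<partial>torus)"
    using ineq C1_entropy_pair[OF E] product_lipschitz_test[OF W \<theta>]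
    unfolding entropy_ineq_def by (fastforce simp: dt dx \<eta>d)
  also have "(\<integral>x. \<theta> 0 * \<rho> x * \<eta> (u0 x) \<partial>torus) = (\<integral>x. \<theta> 0 * (\<rho> x * \<eta> (u0' x)) \<partial>torus)"
  proof (rule integral_cong_AE)
    have [measurable]: "\<rho> \<in> borel_measurable torus" "\<eta> \<in> borel_measurable borel"
      by (intro borel_measurable_torus borel_measurable_continuous_onI
          C1_weight_continuous[OF W] C1_entropy_continuous[OF E])+
    note [measurable] = u0 u0'(1)
    show "(\<lambda>x. \<theta> 0 * \<rho> x * \<eta> (u0 x)) \<in> borel_measurable torus"
      "(\<lambda>x. \<theta> 0 * (\<rho> x * \<eta> (u0' x))) \<in> borel_measurable torus" by measurable
    show "AE x in torus. \<theta> 0 * \<rho> x * \<eta> (u0 x) = \<theta> 0 * (\<rho> x * \<eta> (u0' x))"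
      using u0'(3) by eventually_elim simp
  qed
  also have "\<dots> = \<theta> 0 * (\<integral>x. \<rho> x * \<eta> (u0' x) \<partial>torus)" by simp
  finally have 1: "0 \<le> (\<integral>(t, x). ?G t x \<partial>cylinder T) + \<theta> 0 * (\<integral>x. \<rho> x * \<eta> (u0' x) \<partial>torus)" .
  define X where "X p = \<rho> (snd p) * \<eta> (w p)" for p
  define Y where "Y p = \<rho>' (snd p) * q (w p) - \<rho> (snd p) * \<eta>' (w p) * h p" for p
  define F where "F p = \<theta>' (fst p) * X p + \<theta> (fst p) * Y p" for p
  have fs: "fst \<in> borel_measurable (borel :: (real \<times> real) measure)" "snd \<in> borel_measurable (borel :: (real \<times> real) measure)"
    by (intro borel_measurable_continuous_onI continuous_intros)+
  note c = borel_measurable_continuous_onI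
  have XY: "X \<in> borel_measurable borel" "Y \<in> borel_measurable borel" "F \<in> borel_measurable borel"
    unfolding F_def[abs_def] X_def[abs_def] Y_def[abs_def]
    by (intro borel_measurable_times borel_measurable_add borel_measurable_diff h(1)
        measurable_compose[OF w(1)] measurable_compose[OF fs(1)] measurable_compose[OF fs(2)]
        c \<theta>(2) \<theta>c \<rho>c' C1_weight_continuous[OF W] C1_entropy_continuous[OF E])+
  have "AE p in cylinder T. F p = (case p of (t, x) \<Rightarrow> ?G t x)"
    using w(3) h(3) by eventually_elim (auto simp: F_def X_def Y_def algebra_simps)
  then have 2: "(\<integral>(t, x). ?G t x \<partial>cylinder T) = (\<integral>p. F p \<partial>cylinder T)"
    by (rule integral_cylinder_AE[OF XY(3)])
  obtain R where R: "\<And>x. \<bar>\<rho> x\<bar> \<le> R" "\<And>x. \<bar>\<rho>' x\<bar> \<le> R" "0 \<le> R" using C1_weight_bounded[OF W] by metis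
  obtain B1 where B1: "0 \<le> B1" "\<And>t. \<bar>t\<bar> \<le> \<bar>T\<bar> \<Longrightarrow> \<bar>\<theta> t\<bar> \<le> B1"
    using bounded_on_symmetric_interval[OF \<theta>c] by metis
  obtain B2 where B2: "0 \<le> B2" "\<And>t. \<bar>t\<bar> \<le> \<bar>T\<bar> \<Longrightarrow> \<bar>\<theta>' t\<bar> \<le> B2"
    using bounded_on_symmetric_interval[OF \<theta>(2)] by metis
  obtain B3 where B3: "0 \<le> B3" "\<And>r. \<bar>r\<bar> \<le> M \<Longrightarrow> \<bar>\<eta> r\<bar> \<le> B3"
    using bounded_on_symmetric_interval[OF C1_entropy_continuous(1)[OF E]] by metis
  obtain B4 where B4: "0 \<le> B4" "\<And>r. \<bar>r\<bar> \<le> M \<Longrightarrow> \<bar>q r\<bar> \<le> B4"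
    using bounded_on_symmetric_interval[OF C1_entropy_continuous(3)[OF E]] by metis
  have H0: "0 \<le> H" using h(2)[of "(0,0)"] by linarith
  have \<eta>1: "\<bar>\<eta>' r\<bar> \<le> 1" for r using E by (simp add: C1_entropy_def)
  have Xb: "\<bar>X p\<bar> \<le> R * B3" for p
    unfolding X_def abs_mult by (rule mult_mono[OF R(1) B3(2)[OF w(2)] R(3)]) simp
  have Yb: "\<bar>Y p\<bar> \<le> R * B4 + R * 1 * H" for p
  proof -
    have "\<bar>\<rho>' (snd p) * q (w p)\<bar> \<le> R * B4"
      unfolding abs_mult by (rule mult_mono[OF R(2) B4(2)[OF w(2)] R(3)]) simp
    moreover have "\<bar>\<rho> (snd p) * \<eta>' (w p) * h p\<bar> \<le> R * 1 * H"
      unfolding abs_mult by (rule mult_mono[OF mult_mono[OF R(1) \<eta>1 R(3)] h(2)]) (use R in auto)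
    ultimately show ?thesis unfolding Y_def by linarith
  qed
  have "(\<integral>p. F p \<partial>cylinder T) = (\<integral>t. \<integral>x. F (t, x) \<partial>torus \<partial>timespan T)"
  proof (rule integral_cylinder_iterated[OF XY(3)])
    fix t x assume "t \<in> {0..T}"
    then have t: "\<bar>t\<bar> \<le> \<bar>T\<bar>" by auto
    have "\<bar>\<theta>' t * X (t, x)\<bar> \<le> B2 * (R * B3)"
      unfolding abs_mult by (rule mult_mono[OF B2(2)[OF t] Xb B2(1)]) simp
    moreover have "\<bar>\<theta> t * Y (t, x)\<bar> \<le> B1 * (R * B4 + R * 1 * H)"
      unfolding abs_mult by (rule mult_mono[OF B1(2)[OF t] Yb B1(1)]) simp
    ultimately show "\<bar>F (t, x)\<bar> \<le> B2 * (R * B3) + B1 * (R * B4 + R * 1 * H)"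
      unfolding F_def fst_conv by linarith
  qed
  also have "\<dots> = (\<integral>t. \<theta>' t * (\<integral>x. X (t, x) \<partial>torus) + \<theta> t * (\<integral>x. Y (t, x) \<partial>torus) \<partial>timespan T)"
  proof (rule Bochner_Integration.integral_cong[OF refl])
    fix t assume t: "t \<in> space (timespan T)"
    have m: "(\<lambda>x. G (t, x)) \<in> borel_measurable torus" if "G \<in> borel_measurable borel" for G :: "real \<times> real \<Rightarrow> real"
      using measurable_compose[OF measurable_Pair1'[OF t] measurable_compose[OF ident_timespan_torus that]] by simp
    have "integrable torus (\<lambda>x. X (t, x))"
      by (rule torus.integrable_const_bound[OF AE_I2 m[OF XY(1)]]) (use Xb in simp)
    moreover have "integrable torus (\<lambda>x. Y (t, x))"
      by (rule torus.integrable_const_bound[OF AE_I2 m[OF XY(2)]]) (use Yb in simp)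
    ultimately show "(\<integral>x. F (t, x) \<partial>torus) = \<theta>' t * (\<integral>x. X (t, x) \<partial>torus) + \<theta> t * (\<integral>x. Y (t, x) \<partial>torus)"
      by (simp add: F_def)
  qed
  finally show ?thesis using 1 2 by (simp add: X_def Y_def)
qed

lemma Linf_AE_bound:
  assumes "g \<in> Linf N"
  obtains c where "0 \<le> c" "AE x in N. \<bar>g x\<bar> \<le> c"
proof -
  have ae: "AE x in N. ereal \<bar>g x\<bar> \<le> Linf_norm N g"
    unfolding Linf_norm_def by (rule esssup_AE)
  have fin: "Linf_norm N g < \<infinity>" using assms by (simp add: Linf_def)
  show ?thesis
  proof (rule that[of "max 0 (real_of_ereal (Linf_norm N g))"])
    show "AE x in N. \<bar>g x\<bar> \<le> max 0 (real_of_ereal (Linf_norm N g))"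
      using ae
    proof eventually_elim
      fix x assume "ereal \<bar>g x\<bar> \<le> Linf_norm N g"
      then show "\<bar>g x\<bar> \<le> max 0 (real_of_ereal (Linf_norm N g))"
        using fin by (cases "Linf_norm N g") auto
    qed
  qed simp
qed

lemma Linf_bounded_version:
  assumes "g \<in> Linf torus"
  obtains g' c where "g' \<in> borel_measurable torus" "\<And>x. \<bar>g' x\<bar> \<le> c" "AE x in torus. g x = g' x"
proof -
  obtain c where c: "0 \<le> c" "AE x in torus. \<bar>g x\<bar> \<le> c" using Linf_AE_bound[OF assms] by blast
  have [measurable]: "g \<in> borel_measurable torus" using assms by (simp add: Linf_def)
  show ?thesis
  proof (rule that[of "\<lambda>x. max (- c) (min c (g x))" c])
    show "(\<lambda>x. max (- c) (min c (g x))) \<in> borel_measurable torus" by measurable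
    show "\<bar>max (- c) (min c (g x))\<bar> \<le> c" for x using c(1) by auto
    show "AE x in torus. g x = max (- c) (min c (g x))" using c(2) by eventually_elim auto
  qed
qed

text \<open>
For \<open>\<alpha> < 1\<close> the damping is explicit, and a Borel version is obtained from one of \<open>a\<close>; for \<open>\<alpha> = 1\<close>
it is part of the solution. Either way the
damping lies in \<open>a\<close> times the graph.
\<close>

lemma solution_source:
  assumes \<alpha>: "0 < \<alpha>" "\<alpha> \<le> 1" and a: "condition_A a"
    and sol: "admissible_weak_solution f \<alpha> a T u0 u"
    and w: "w \<in> borel_measurable borel" "\<And>p. \<bar>w p\<bar> \<le> M" "AE (t, x) in cylinder T. u t x = w (t, x)"
  obtains k h H where "entropy_ineq f T u0 k u" "h \<in> borel_measurable borel" "\<And>p. \<bar>h p\<bar> \<le> H"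
    "AE (t, x) in cylinder T. k t x = h (t, x)"
    "AE (t, x) in cylinder T. \<exists>s\<in>damping_graph \<alpha> (w (t, x)). h (t, x) = a x * s"
proof (cases "\<alpha> < 1")
  case True
  have aL: "a \<in> Linf torus" using a by (simp add: condition_A_def Linf_torus_def)
  then have am: "a \<in> borel_measurable (lebesgue_on {0..<1})" by (simp add: Linf_def torus_def)
  obtain A where A: "0 \<le> A" "AE x in lebesgue_on {0..<1}. \<bar>a x\<bar> \<le> A"
    using Linf_AE_bound[OF aL] unfolding torus_def by blast
  have S: "{0..<1::real} \<in> sets lebesgue" by simp
  obtain a' where a': "a' \<in> borel_measurable borel" "\<And>x. \<bar>a' x\<bar> \<le> A" "AE x in lebesgue_on {0..<1}. a x = a' x"
    using borel_representative[OF S am A(2,1)] by blast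
  define h where "h p = a' (snd p) * (w p / \<bar>w p\<bar> powr \<alpha>)" for p
  have snd: "snd \<in> borel_measurable (borel :: (real \<times> real) measure)"
    by (intro borel_measurable_continuous_onI continuous_intros)
  have hm: "h \<in> borel_measurable borel"
    unfolding h_def[abs_def]
    by (intro borel_measurable_times borel_measurable_divide powr_real_measurable borel_measurable_abs
        borel_measurable_const w(1) measurable_compose[OF snd a'(1)])
  have g: "w p / \<bar>w p\<bar> powr \<alpha> \<in> damping_graph \<alpha> (w p)" for p using True by (simp add: damping_graph_def)
  have hb: "\<bar>h p\<bar> \<le> A * (1 + M)" for p
    unfolding h_def abs_mult
    using damping_graph_bound[OF \<alpha> g, of p] w(2)[of p] by (intro mult_mono a' A(1)) auto
  have aa: "AE p in cylinder T. a (snd p) = a' (snd p)"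
    using AE_torus_cylinder[of "\<lambda>x. a x = a' x"] a'(3) unfolding torus_def by blast
  show ?thesis
  proof (rule that[of "\<lambda>t x. a x * (u t x / \<bar>u t x\<bar> powr \<alpha>)" h, OF _ hm hb])
    show "entropy_ineq f T u0 (\<lambda>t x. a x * (u t x / \<bar>u t x\<bar> powr \<alpha>)) u"
      using sol True by (simp add: admissible_weak_solution_def)
    show "AE (t, x) in cylinder T. a x * (u t x / \<bar>u t x\<bar> powr \<alpha>) = h (t, x)"
      using aa w(3) by eventually_elim (auto simp: h_def)
    show "AE (t, x) in cylinder T. \<exists>s\<in>damping_graph \<alpha> (w (t, x)). h (t, x) = a x * s"
      using aa by eventually_elim (use True in \<open>auto simp: h_def damping_graph_def\<close>)
  qed
next
  case False
  then obtain k where k: "(\<lambda>(t, x). k t x) \<in> Linf (cylinder T)" "entropy_ineq f T u0 k u"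
    "AE (t, x) in cylinder T. k t x \<in> (\<lambda>s. a x * s) ` Sign (u t x)"
    using sol by (auto simp: admissible_weak_solution_def)
  have km: "(\<lambda>(t, x). k t x) \<in> borel_measurable (lebesgue_on ({0..T} \<times> {0..<1}))"
    using k(1) by (simp add: Linf_def cylinder_def)
  obtain H where H: "0 \<le> H" "AE p in lebesgue_on ({0..T} \<times> {0..<1}). \<bar>case p of (t, x) \<Rightarrow> k t x\<bar> \<le> H"
    using Linf_AE_bound[OF k(1)] unfolding cylinder_def by blast
  obtain h where h: "h \<in> borel_measurable borel" "\<And>p. \<bar>h p\<bar> \<le> H"
    "AE p in lebesgue_on ({0..T} \<times> {0..<1}). (case p of (t, x) \<Rightarrow> k t x) = h p"
    using borel_representative[OF sets_cylinder_domain km H(2,1)] by blast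
  have kh: "AE (t, x) in cylinder T. k t x = h (t, x)"
    using h(3) unfolding cylinder_def by eventually_elim auto
  show ?thesis
  proof (rule that[OF k(2) h(1,2) kh])
    show "AE (t, x) in cylinder T. \<exists>s\<in>damping_graph \<alpha> (w (t, x)). h (t, x) = a x * s"
      using kh k(3) w(3)
    proof eventually_elim
      fix p assume 1: "case p of (t, x) \<Rightarrow> k t x = h (t, x)"
        and 2: "case p of (t, x) \<Rightarrow> k t x \<in> (\<lambda>s. a x * s) ` Sign (u t x)"
        and 3: "case p of (t, x) \<Rightarrow> u t x = w (t, x)"
      obtain t x where p: "p = (t, x)" by fastforce
      obtain s where "s \<in> Sign (w (t, x))" "h (t, x) = a x * s"
        using 1 2 3 by (auto simp: p)
      then show "case p of (t, x) \<Rightarrow> \<exists>s\<in>damping_graph \<alpha> (w (t, x)). h (t, x) = a x * s"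
        using False by (auto simp: p damping_graph_def)
    qed
  qed
qed

lemma solution_flow:
  assumes \<alpha>: "0 < \<alpha>" "\<alpha> \<le> 1" and a: "condition_A a" and u0: "u0 \<in> Linf_torus"
    and sol: "is_solution f \<alpha> a u0 u" and T: "0 < T"
  obtains M H u0' w h where "entropy_flow f T M H u0' u w h" "AE x in torus. u0 x = u0' x"
    "AE t in timespan T. AE x in torus. \<exists>s\<in>damping_graph \<alpha> (w (t, x)). h (t, x) = a x * s"
proof -
  have adm: "admissible_weak_solution f \<alpha> a T u0 u" and cont: "continuous_in_L1 u"
    using sol T by (auto simp: is_solution_def)
  have bm: "bounded_measurable T u" using adm by (simp add: admissible_weak_solution_def)
  have u0L: "u0 \<in> Linf torus" using u0 by (simp add: Linf_torus_def)
  then have u0m: "u0 \<in> borel_measurable torus" by (simp add: Linf_def)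
  obtain u0' c where u0': "u0' \<in> borel_measurable torus" "\<And>x. \<bar>u0' x\<bar> \<le> c" "AE x in torus. u0 x = u0' x"
    using Linf_bounded_version[OF u0L] by blast
  have "bounded ((\<lambda>(t, x). u t x) ` ({0..T} \<times> UNIV))" using bm by (simp add: bounded_measurable_def)
  then obtain M1 where "\<forall>t\<in>{0..T}. \<forall>x. \<bar>u t x\<bar> \<le> M1" by (auto simp: bounded_iff)
  then have M1: "\<And>t x. t \<in> {0..T} \<Longrightarrow> \<bar>u t x\<bar> \<le> M1" by blast
  define M where "M = max c M1"
  have M: "\<And>x. \<bar>u0' x\<bar> \<le> M" "\<And>t x. t \<in> {0..T} \<Longrightarrow> \<bar>u t x\<bar> \<le> M"
    using u0'(2) M1 by (auto simp: M_def le_max_iff_disj)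
  have M0: "0 \<le> M" using M(1)[of 0] by linarith
  have um: "(\<lambda>(t, x). u t x) \<in> borel_measurable (lebesgue_on ({0..T} \<times> {0..<1}))"
    using bm by (simp add: bounded_measurable_def cylinder_def)
  have ub: "AE p in lebesgue_on ({0..T} \<times> {0..<1}). \<bar>case p of (t, x) \<Rightarrow> u t x\<bar> \<le> M"
    by (rule AE_I2) (use M(2) in auto)
  obtain w where w: "w \<in> borel_measurable borel" "\<And>p. \<bar>w p\<bar> \<le> M"
    "AE p in lebesgue_on ({0..T} \<times> {0..<1}). (case p of (t, x) \<Rightarrow> u t x) = w p"
    using borel_representative[OF sets_cylinder_domain um ub M0] by blast
  have uw: "AE (t, x) in cylinder T. u t x = w (t, x)"
    using w(3) unfolding cylinder_def by eventually_elim auto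
  obtain k h H where k: "entropy_ineq f T u0 k u" and h: "h \<in> borel_measurable borel" "\<And>p. \<bar>h p\<bar> \<le> H"
    "AE (t, x) in cylinder T. k t x = h (t, x)"
    and gr: "AE (t, x) in cylinder T. \<exists>s\<in>damping_graph \<alpha> (w (t, x)). h (t, x) = a x * s"
    using solution_source[OF \<alpha> a adm w(1,2) uw] by blast
  have "entropy_flow f T M H u0' u w h"
  proof
    show "u t \<in> borel_measurable torus" if "0 \<le> t" "t \<le> T" for t
      using cont that by (auto simp: continuous_in_L1_def)
    show "\<bar>u t x\<bar> \<le> M" if "0 \<le> t" "t \<le> T" for t x using M(2) that by simp
    show "AE t in timespan T. AE x in torus. u t x = w (t, x)"
      using AE_cylinder_iterated[OF uw] by simp
    show "((\<lambda>s. \<integral>x. \<bar>u s x - u t x\<bar> \<partial>torus) \<longlongrightarrow> 0) (at t within {0..T})" if "0 \<le> t" "t \<le> T" for t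
      using cont that unfolding continuous_in_L1_def
      by (auto intro: tendsto_within_subset[of _ _ _ "{0..}"])
    show "0 \<le> (\<integral>t. \<theta>' t * (\<integral>x. \<rho> x * \<eta> (w (t, x)) \<partial>torus)
            + \<theta> t * (\<integral>x. \<rho>' x * q (w (t, x)) - \<rho> x * \<eta>' (w (t, x)) * h (t, x) \<partial>torus) \<partial>timespan T)
          + \<theta> 0 * (\<integral>x. \<rho> x * \<eta> (u0' x) \<partial>torus)"
      if "C1_entropy f \<eta> \<eta>' q" "C1_weight \<rho> \<rho>'" "\<And>t. (\<theta> has_real_derivative \<theta>' t) (at t)"
        "continuous_on UNIV \<theta>'" "\<And>t. 0 \<le> \<theta> t" "\<theta> T = 0" for \<eta> \<eta>' q \<rho> \<rho>' \<theta> \<theta>'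
      by (rule iterated_entropy_ineq[OF k T u0'(1) M(1) u0'(3) u0m w(1,2) uw h that])
  qed (use T u0' M w h in auto)
  then show ?thesis using that u0'(3) AE_cylinder_iterated[OF gr] by simp
qed

lemma entropy_flow_mono:
  assumes "entropy_flow f T M H u0 u w h" "M \<le> M'" "H \<le> H'"
  shows "entropy_flow f T M' H' u0 u w h"
proof -
  interpret entropy_flow f T M H u0 u w h by fact
  show ?thesis
  proof
    show "\<bar>u0 x\<bar> \<le> M'" for x using u0_le assms(2) by (rule order_trans)
    show "\<bar>u t x\<bar> \<le> M'" if "0 \<le> t" "t \<le> T" for t x
      using u_le[OF that] assms(2) by (rule order_trans)
    show "\<bar>w p\<bar> \<le> M'" for p using w_le assms(2) by (rule order_trans)
    show "\<bar>h p\<bar> \<le> H'" for p using h_le assms(3) by (rule order_trans)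
  qed (fact T_pos u0_meas u_meas w_borel h_borel w_eq u_cont entropy | rule u_meas u_cont entropy; assumption)+
qed

section \<open>The comparison principle\<close>

lemma smooth_C1:
  assumes "smooth f"
  shows "(f has_real_derivative deriv f z) (at z)" "continuous_on UNIV (deriv f)"
proof -
  have "(deriv ^^ 0) f field_differentiable at z" "\<And>z. (deriv ^^ 1) f field_differentiable at z"
    using assms unfolding smooth_def by blast+
  then show "(f has_real_derivative deriv f z) (at z)" "continuous_on UNIV (deriv f)"
    by (auto simp: DERIV_deriv_iff_field_differentiable continuous_on_eq_continuous_at
        intro: field_differentiable_imp_continuous_at)
qed

lemma C1_flux_flowI:
  assumes "smooth f" "entropy_flow f T M H u0 u w h" "\<And>z. \<bar>z\<bar> \<le> M \<Longrightarrow> \<bar>deriv f z\<bar> \<le> L"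
  shows "C1_flux_flow f T M H u0 u w h L"
  using assms smooth_C1[OF assms(1)] by (simp add: C1_flux_flow_def C1_flux_flow_axioms_def)

text \<open>
If \<open>\<sigma> k \<ge> 0\<close>, then \<open>\<sigma> (w - k) > 0\<close> forces \<open>\<sigma> w > 0\<close>, so that the damping has the sign of \<open>\<sigma>\<close>.
\<close>

lemma solution_one_sided:
  assumes f: "smooth f" and \<alpha>: "0 < \<alpha>" "\<alpha> \<le> 1" and a: "condition_A a" and u0: "u0 \<in> Linf_torus"
    and sol: "is_solution f \<alpha> a u0 u" and \<sigma>: "\<sigma> = 1 \<or> \<sigma> = -1" and k: "0 \<le> \<sigma> * k"
    and init: "AE x in torus. \<sigma> * (u0 x - k) \<le> 0" and t: "0 \<le> t"
  shows "AE x in torus. \<sigma> * (u t x - k) \<le> 0"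
proof -
  \<comment> \<open>The horizon must exceed \<open>t\<close>, since test functions vanish at the final time.\<close>
  have T: "0 < t + 1" using t by simp
  obtain M0 H u0' w h where flow0: "entropy_flow f (t + 1) M0 H u0' u w h" and eq: "AE x in torus. u0 x = u0' x"
    and gr: "AE s in timespan (t + 1). AE x in torus. \<exists>r\<in>damping_graph \<alpha> (w (s, x)). h (s, x) = a x * r"
    using solution_flow[OF \<alpha> a u0 sol T] by blast
  define M where "M = max M0 \<bar>k\<bar>"
  have flow: "entropy_flow f (t + 1) M H u0' u w h"
    by (rule entropy_flow_mono[OF flow0]) (auto simp: M_def)
  obtain L where L: "\<And>z. \<bar>z\<bar> \<le> M \<Longrightarrow> \<bar>deriv f z\<bar> \<le> L"
    using bounded_on_symmetric_interval[OF smooth_C1(2)[OF f]] by metis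
  interpret C1_flux_flow f "t + 1" M H u0' u w h L
    by (rule C1_flux_flowI[OF f flow L])
  show ?thesis
  proof (rule one_sided_bound[OF \<sigma>])
    show "\<bar>k\<bar> \<le> M" by (simp add: M_def)
    show "AE x in torus. \<sigma> * (u0' x - k) \<le> 0" using init eq by eventually_elim simp
    show "AE s in timespan (t + 1). AE x in torus. 0 < \<sigma> * (w (s, x) - k) \<longrightarrow> 0 \<le> \<sigma> * h (s, x)"
      using gr
    proof eventually_elim
      fix s assume "AE x in torus. \<exists>r\<in>damping_graph \<alpha> (w (s, x)). h (s, x) = a x * r"
      then show "AE x in torus. 0 < \<sigma> * (w (s, x) - k) \<longrightarrow> 0 \<le> \<sigma> * h (s, x)"
      proof eventually_elim
        fix x assume "\<exists>r\<in>damping_graph \<alpha> (w (s, x)). h (s, x) = a x * r"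
        then obtain r where r: "r \<in> damping_graph \<alpha> (w (s, x))" "h (s, x) = a x * r" by blast
        show "0 < \<sigma> * (w (s, x) - k) \<longrightarrow> 0 \<le> \<sigma> * h (s, x)"
        proof
          assume "0 < \<sigma> * (w (s, x) - k)"
          then have "0 < \<sigma> * w (s, x)" using k by (simp add: right_diff_distrib)
          then have "0 \<le> \<sigma> * r" using \<sigma> damping_graph_sign[OF r(1)] by auto
          moreover have "0 \<le> a x" using a by (simp add: condition_A_def)
          ultimately have "0 \<le> a x * (\<sigma> * r)" by simp
          then show "0 \<le> \<sigma> * h (s, x)" by (simp add: r(2) mult_ac)
        qed
      qed
    qed
  qed (use t in auto)
qed

text \<open>
The two alternatives for the coefficients are those in which the damping of the larger value
dominates: equal coefficients, where monotonicity of the graph is enough, and a larger coefficient for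
\<open>u\<close>, where \<open>v \<ge> 0\<close> ensures that \<open>u\<close> is positive, and thus damped towards \<open>v\<close>, wherever it exceeds \<open>v\<close>.
\<close>

lemma solution_comparison:
  assumes f: "smooth f" and \<alpha>: "0 < \<alpha>" "\<alpha> \<le> 1" and a: "condition_A a" "condition_A a'"
    and u0: "u0 \<in> Linf_torus" "v0 \<in> Linf_torus"
    and sol: "is_solution f \<alpha> a u0 u" "is_solution f \<alpha> a' v0 v"
    and init: "AE x in torus. u0 x \<le> v0 x"
    and coeff: "a = a' \<or> (AE x in torus. a' x \<le> a x) \<and> (\<forall>t\<ge>0. AE x in torus. 0 \<le> v t x)"
    and t: "0 \<le> t"
  shows "AE x in torus. u t x \<le> v t x"
proof -
  have T: "0 < t + 1" using t by simp
  obtain M1 H1 u0' w h where U0: "entropy_flow f (t + 1) M1 H1 u0' u w h" and u0eq: "AE x in torus. u0 x = u0' x"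
    and Ugr: "AE s in timespan (t + 1). AE x in torus. \<exists>r\<in>damping_graph \<alpha> (w (s, x)). h (s, x) = a x * r"
    using solution_flow[OF \<alpha> a(1) u0(1) sol(1) T] by blast
  obtain M2 H2 v0' z g where V0: "entropy_flow f (t + 1) M2 H2 v0' v z g" and v0eq: "AE x in torus. v0 x = v0' x"
    and Vgr: "AE s in timespan (t + 1). AE x in torus. \<exists>r\<in>damping_graph \<alpha> (z (s, x)). g (s, x) = a' x * r"
    using solution_flow[OF \<alpha> a(2) u0(2) sol(2) T] by blast
  define M where "M = max M1 M2"
  define H where "H = max H1 H2"
  have U1: "entropy_flow f (t + 1) M H u0' u w h" and V1: "entropy_flow f (t + 1) M H v0' v z g"
    by (rule entropy_flow_mono[OF U0] entropy_flow_mono[OF V0]; simp add: M_def H_def)+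
  obtain L where L: "\<And>r. \<bar>r\<bar> \<le> M \<Longrightarrow> \<bar>deriv f r\<bar> \<le> L"
    using bounded_on_symmetric_interval[OF smooth_C1(2)[OF f]] by metis
  interpret U: C1_flux_flow f "t + 1" M H u0' u w h L by (rule C1_flux_flowI[OF f U1 L])
  interpret V: C1_flux_flow f "t + 1" M H v0' v z g L by (rule C1_flux_flowI[OF f V1 L])
  have a'L: "a' \<in> Linf torus" using a(2) by (simp add: condition_A_def Linf_torus_def)
  obtain b B where b: "b \<in> borel_measurable torus" "\<And>x. \<bar>b x\<bar> \<le> B" "AE x in torus. a' x = b x"
    using Linf_bounded_version[OF a'L] by blast
  have pos: "0 \<le> a x" "0 \<le> a' x" for x using a by (auto simp: condition_A_def)
  have coeff': "AE s in timespan (t + 1). AE x in torus. AE y in torus.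
      (a x = a' x \<or> a' x \<le> a x \<and> 0 \<le> z (s, y))"
    using coeff
  proof
    assume c: "(AE x in torus. a' x \<le> a x) \<and> (\<forall>t\<ge>0. AE x in torus. 0 \<le> v t x)"
    show ?thesis
      using V.w_eq AE_space
    proof eventually_elim
      fix s assume vz: "AE y in torus. v s y = z (s, y)" and "s \<in> space (timespan (t + 1))"
      then have "AE y in torus. 0 \<le> v s y" using c by auto
      with vz have zp: "AE y in torus. 0 \<le> z (s, y)" by eventually_elim simp
      from c have "AE x in torus. a' x \<le> a x" by blast
      then show "AE x in torus. AE y in torus. (a x = a' x \<or> a' x \<le> a x \<and> 0 \<le> z (s, y))"
      proof eventually_elim
        fix x assume "a' x \<le> a x"
        then show "AE y in torus. (a x = a' x \<or> a' x \<le> a x \<and> 0 \<le> z (s, y))"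
          using zp by (auto elim: eventually_mono)
      qed
    qed
  qed simp
  interpret flow_pair f "t + 1" M H u0' u w h L v0' v z g b B "1 + M"
  proof
    show "b \<in> borel_measurable torus" "\<And>x. \<bar>b x\<bar> \<le> B" by fact+
    show "0 \<le> 1 + M" using U.M_nonneg by simp
    show "AE s in timespan (t + 1). AE x in torus. AE y in torus.
      z (s, y) < w (s, x) \<longrightarrow> - ((1 + M) * \<bar>b x - b y\<bar>) \<le> h (s, x) - g (s, y)"
      using Ugr Vgr coeff'
    proof eventually_elim
      fix s assume hx: "AE x in torus. \<exists>r\<in>damping_graph \<alpha> (w (s, x)). h (s, x) = a x * r"
        and gy: "AE y in torus. \<exists>r\<in>damping_graph \<alpha> (z (s, y)). g (s, y) = a' y * r"
        and cf: "AE x in torus. AE y in torus. (a x = a' x \<or> a' x \<le> a x \<and> 0 \<le> z (s, y))"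
      show "AE x in torus. AE y in torus.
          z (s, y) < w (s, x) \<longrightarrow> - ((1 + M) * \<bar>b x - b y\<bar>) \<le> h (s, x) - g (s, y)"
        using hx cf b(3)
      proof eventually_elim
        fix x assume hx: "\<exists>r\<in>damping_graph \<alpha> (w (s, x)). h (s, x) = a x * r"
          and cf: "AE y in torus. (a x = a' x \<or> a' x \<le> a x \<and> 0 \<le> z (s, y))" and bx: "a' x = b x"
        show "AE y in torus. z (s, y) < w (s, x) \<longrightarrow> - ((1 + M) * \<bar>b x - b y\<bar>) \<le> h (s, x) - g (s, y)"
          using gy cf b(3)
        proof eventually_elim
          fix y assume gy: "\<exists>r\<in>damping_graph \<alpha> (z (s, y)). g (s, y) = a' y * r"
            and cf: "a x = a' x \<or> a' x \<le> a x \<and> 0 \<le> z (s, y)" and by': "a' y = b y"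
          show "z (s, y) < w (s, x) \<longrightarrow> - ((1 + M) * \<bar>b x - b y\<bar>) \<le> h (s, x) - g (s, y)"
          proof
            assume zw: "z (s, y) < w (s, x)"
            obtain r where r: "r \<in> damping_graph \<alpha> (w (s, x))" "h (s, x) = a x * r" using hx by blast
            obtain r' where r': "r' \<in> damping_graph \<alpha> (z (s, y))" "g (s, y) = a' y * r'" using gy by blast
            have mono: "r' \<le> r" by (rule damping_graph_mono[OF \<alpha>(2) r(1) r'(1) zw])
            \<comment> \<open>If \<open>a\<close> may exceed \<open>a'\<close> at \<open>x\<close>, then \<open>w > z \<ge> 0\<close> makes \<open>r\<close> nonnegative.\<close>
            have "a' x * r \<le> a x * r"
              using cf
            proof
              assume c: "a' x \<le> a x \<and> 0 \<le> z (s, y)"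
              then have "0 \<le> r" using zw damping_graph_sign(1)[OF r(1)] by simp
              then show ?thesis using c by (intro mult_right_mono) auto
            qed simp
            moreover have "a' x * r' \<le> a' x * r" by (intro mult_left_mono mono pos)
            moreover have "\<bar>(b x - b y) * r'\<bar> \<le> \<bar>b x - b y\<bar> * (1 + M)"
              unfolding abs_mult
              using damping_graph_bound[OF \<alpha> r'(1)] V.w_le[of "(s, y)"] by (intro mult_left_mono) auto
            moreover have "(b x - b y) * r' = a' x * r' - g (s, y)"
              by (simp add: r'(2) bx by' left_diff_distrib)
            ultimately show "- ((1 + M) * \<bar>b x - b y\<bar>) \<le> h (s, x) - g (s, y)"
              unfolding r(2) by (simp add: mult.commute)
          qed
        qed
      qed
    qed
  qed
  have t': "0 \<le> t" "t < t + 1" "t \<le> t + 1" using t by auto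
  have "(\<integral>x. max 0 (u0' x - v0' x) \<partial>torus) = (\<integral>x. 0 \<partial>torus)"
  proof (rule integral_cong_AE)
    show "AE x in torus. max 0 (u0' x - v0' x) = 0"
      using init u0eq v0eq by eventually_elim auto
  qed (use U.u0_meas V.u0_meas in auto)
  then have le: "(\<integral>x. max 0 (u t x - v t x) \<partial>torus) \<le> 0"
    using comparison[OF t'(1,2)] by simp
  have int: "integrable torus (\<lambda>x. max 0 (u t x - v t x))"
  proof (rule torus.integrable_const_bound[where B="2 * M"])
    have "norm (max 0 (u t x - v t x)) \<le> 2 * M" for x
      using U.u_le[OF t'(1,3), of x] V.u_le[OF t'(1,3), of x] U.M_nonneg by simp
    then show "AE x in torus. norm (max 0 (u t x - v t x)) \<le> 2 * M" by simp
    show "(\<lambda>x. max 0 (u t x - v t x)) \<in> borel_measurable torus"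
      using U.u_meas[OF t'(1,3)] V.u_meas[OF t'(1,3)] by simp
  qed
  have "(\<integral>x. max 0 (u t x - v t x) \<partial>torus) = 0"
    using le by (rule antisym) (rule Bochner_Integration.integral_nonneg, simp)
  then have "AE x in torus. max 0 (u t x - v t x) = 0"
    using integral_nonneg_eq_0_iff_AE[OF int] by simp
  then show ?thesis by eventually_elim auto
qed

lemma solution_Linf_bound:
  assumes f: "smooth f" and \<alpha>: "0 < \<alpha>" "\<alpha> \<le> 1" and a: "condition_A a" and u0: "u0 \<in> Linf_torus"
    and sol: "is_solution f \<alpha> a u0 u" and t: "0 \<le> t"
  shows "AE x in torus. ereal \<bar>u t x\<bar> \<le> Linf_norm torus u0"
proof -
  have ae: "AE x in torus. ereal \<bar>u0 x\<bar> \<le> Linf_norm torus u0"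
    unfolding Linf_norm_def by (rule esssup_AE)
  have "Linf_norm torus u0 < \<infinity>" using u0 by (simp add: Linf_torus_def Linf_def)
  moreover have "0 \<le> Linf_norm torus u0"
  proof -
    have "AE x in torus. 0 \<le> Linf_norm torus u0"
      using ae by eventually_elim (metis abs_ge_zero ereal_less_eq(5) order_trans)
    then show ?thesis by simp
  qed
  ultimately obtain c where c: "Linf_norm torus u0 = ereal c" "0 \<le> c"
    by (cases "Linf_norm torus u0") auto
  have le: "AE x in torus. \<bar>u0 x\<bar> \<le> c" using ae by (simp add: c)
  have "AE x in torus. 1 * (u t x - c) \<le> 0"
    by (rule solution_one_sided[OF f \<alpha> a u0 sol _ _ _ t])
       (use c(2) in simp, use c(2) in simp, use le in eventually_elim, auto)
  moreover have "AE x in torus. - 1 * (u t x - (- c)) \<le> 0"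
    by (rule solution_one_sided[OF f \<alpha> a u0 sol _ _ _ t])
       (use c(2) in simp, use c(2) in simp, use le in eventually_elim, auto)
  ultimately show ?thesis
    by eventually_elim (auto simp: c(1))
qed

theorem proposition1p5:
  fixes f :: "real \<Rightarrow> real" and \<alpha> :: real
  assumes "smooth f" and "0 < \<alpha>" and "\<alpha> \<le> 1"
  shows
    "(\<forall>a u0 v0 u v.
        condition_A a \<and> u0 \<in> Linf_torus \<and> v0 \<in> Linf_torus \<and>
        is_solution f \<alpha> a u0 u \<and> is_solution f \<alpha> a v0 v \<and>
        (AE x in torus. u0 x \<le> v0 x) \<longrightarrow>
        (\<forall>t\<ge>0. AE x in torus. u t x \<le> v t x)) \<and>
     (\<forall>a u0 u.
        condition_A a \<and> u0 \<in> Linf_torus \<and> is_solution f \<alpha> a u0 u \<longrightarrow>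
        (\<forall>t\<ge>0. AE x in torus. ereal \<bar>u t x\<bar> \<le> Linf_norm torus u0)) \<and>
     (\<forall>a1 a2 u0 u1 u2.
        condition_A a1 \<and> condition_A a2 \<and> (AE x in torus. a1 x \<le> a2 x) \<and>
        u0 \<in> Linf_torus \<and> (AE x in torus. 0 \<le> u0 x) \<and>
        is_solution f \<alpha> a1 u0 u1 \<and> is_solution f \<alpha> a2 u0 u2 \<longrightarrow>
        (\<forall>t\<ge>0. AE x in torus. u2 t x \<le> u1 t x \<and> 0 \<le> u2 t x))"
proof (intro conjI allI impI)
  fix a u0 v0 u v and t :: real
  assume *: "condition_A a \<and> u0 \<in> Linf_torus \<and> v0 \<in> Linf_torus \<and>
        is_solution f \<alpha> a u0 u \<and> is_solution f \<alpha> a v0 v \<and> (AE x in torus. u0 x \<le> v0 x)"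
    and t: "0 \<le> t"
  show "AE x in torus. u t x \<le> v t x"
    by (rule solution_comparison[OF assms, of a a u0 v0]) (use * t in auto)
next
  fix a u0 u and t :: real
  assume *: "condition_A a \<and> u0 \<in> Linf_torus \<and> is_solution f \<alpha> a u0 u" and t: "0 \<le> t"
  show "AE x in torus. ereal \<bar>u t x\<bar> \<le> Linf_norm torus u0"
    by (rule solution_Linf_bound[OF assms, of a]) (use * t in auto)
next
  fix a1 a2 u0 u1 u2 and t :: real
  assume *: "condition_A a1 \<and> condition_A a2 \<and> (AE x in torus. a1 x \<le> a2 x) \<and>
        u0 \<in> Linf_torus \<and> (AE x in torus. 0 \<le> u0 x) \<and>
        is_solution f \<alpha> a1 u0 u1 \<and> is_solution f \<alpha> a2 u0 u2" and t: "0 \<le> t"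
  then have init: "AE x in torus. - 1 * (u0 x - 0) \<le> 0" by simp
  have nonneg: "AE x in torus. 0 \<le> u s x"
    if "condition_A a" "is_solution f \<alpha> a u0 u" "0 \<le> s" for a u s
  proof -
    have "AE x in torus. - 1 * (u s x - 0) \<le> 0"
      by (rule solution_one_sided[OF assms that(1) _ that(2) _ _ init that(3)]) (use * in auto)
    then show ?thesis by simp
  qed
  have "AE x in torus. u2 t x \<le> u1 t x"
  proof (rule solution_comparison[OF assms, of a2 a1 u0 u0])
    show "a2 = a1 \<or> (AE x in torus. a1 x \<le> a2 x) \<and> (\<forall>s\<ge>0. AE x in torus. 0 \<le> u1 s x)"
      using * nonneg by blast
  qed (use * t in auto)
  moreover have "AE x in torus. 0 \<le> u2 t x" using nonneg * t by blast
  ultimately show "AE x in torus. u2 t x \<le> u1 t x \<and> 0 \<le> u2 t x" by eventually_elim simp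
qed

end
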